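(* Let $X$ be a smooth variety over an algebraically closed field of characteristic $p>0$. The asymptotic multiplier ideal sheaf $\mathcal{J}(X,\mathfrak{a}_\star^t)$ is coherent for any graded sequence of ideals $\mathfrak{a}_\star$ on $X$ and any $t\in[0,\infty)$.
   Context: A graded sequence of ideals is a sequence $\mathfrak{a}_\star=\{\mathfrak{a}_m\}_{m\ge1}$ of nonzero (quasi-coherent) ideals of $\mathcal{O}_X$ with $\mathfrak{a}_s\mathfrak{a}_t\subseteq\mathfrak{a}_{s+t}$ for all $s,t$. Let $L$ be the function field of $X$. For an open $U\subseteq X$, $\mathrm{Val}_U$ is the set of real-valued valuations $v:L\to\mathbb{R}\cup\{+\infty\}$ centered on $U$ (the center $c_U(v)$ is the point $x\in U$ with $\mathcal{O}_{U,x}$ dominated by the valuation ring of $v$), and $\mathrm{Val}_U^*$ is $\mathrm{Val}_U$ minus the trivial valuation. For an ideal $\mathfrak{a}$, $v(\mathfrak{a})=\min\{v(f):f\in\mathfrak{a}_{c_X(v)}\}$. A $p^{-e}$-linear map on $L$ is an additive $\psi:L\to L$ with $\psi(f^{p^e}g)=f\psi(g)$. Let $(\mathcal{C}^X_e)_x$ be the set of such $\psi$ with $\psi(\mathcal{O}_{X,x})\subseteq\mathcal{O}_{X,x}$. For $\psi\neq0$, $e\ge1$, put $E(f,\psi,v)=\frac{v(f)-p^ev(\psi(f))}{p^e-1}$ for $0\ne f\in L$, $A(v;\psi)=\sup_{f\ne0,n\ge1}E(f,\psi^n,v)$ ($\psi^n$ is the $n$-fold composition), and define the log discrepancy $A_X(v)=\sup_{e\ge1}\sup_{0\ne\psi\in(\mathcal{C}^X_e)_{c_X(v)}}A(v;\psi)$.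 $\mathcal{J}(X,\mathfrak{a}_\star^t)$ is the sheaf whose sections over an affine open $U=\mathrm{Spec}(R)\subseteq X$ are those $f\in R$ such that for every $v\in\mathrm{Val}_U^*$ one has $v(f)+A_X(v)-(t/m)\,v(\mathfrak{a}_m)>0$ for all sufficiently large $m$ (depending on $v$). *)

theory Defs
  imports
    "HOL-Analysis.Analysis"
    "HOL-Library.Poly_Mapping"
    "Jordan_Normal_Form.Determinant"
begin

section \<open>Subrings of a field and their ideals\<close>

definition is_subring :: "'l::field set \<Rightarrow> bool" where
  "is_subring R \<longleftrightarrow> 0 \<in> R \<and> 1 \<in> R \<and>
     (\<forall>a\<in>R. \<forall>b\<in>R. a + b \<in> R \<and> a * b \<in> R \<and> - a \<in> R)"

definition subring_generated :: "'l::field set \<Rightarrow> 'l set" where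
  "subring_generated S = \<Inter>{R. is_subring R \<and> S \<subseteq> R}"

definition is_ideal :: "'l::field set \<Rightarrow> 'l set \<Rightarrow> bool" where
  "is_ideal R I \<longleftrightarrow> I \<subseteq> R \<and> 0 \<in> I \<and> (\<forall>a\<in>I. \<forall>b\<in>I. a + b \<in> I) \<and> (\<forall>r\<in>R. \<forall>a\<in>I. r * a \<in> I)"

definition fg_ideal :: "'l::field set \<Rightarrow> 'l set \<Rightarrow> bool" where
  "fg_ideal R I \<longleftrightarrow> is_ideal R I \<and>
     (\<exists>S. finite S \<and> I = {\<Sum>s\<in>S. c s * s | c. c ` S \<subseteq> R})"

definition nonunits :: "'l::field set \<Rightarrow> 'l set" where
  "nonunits R = {f\<in>R. f = 0 \<or> inverse f \<notin> R}"

definition Spec :: "'l::field set \<Rightarrow> 'l set set" where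
  "Spec R = {P. is_ideal R P \<and> 1 \<notin> P \<and> (\<forall>a\<in>R. \<forall>b\<in>R. a * b \<in> P \<longrightarrow> a \<in> P \<or> b \<in> P)}"

definition zariski :: "'l::field set \<Rightarrow> 'l set topology" where
  "zariski R = topology_generated_by ((\<lambda>f. {P\<in>Spec R. f \<notin> P}) ` R)"

definition localization :: "'l::field set \<Rightarrow> 'l set \<Rightarrow> 'l set" where
  "localization R P = {a / b | a b. a \<in> R \<and> b \<in> R \<and> b \<notin> P}"


section \<open>Integral schemes with a given function field\<close>

text \<open>
  An integral scheme with function field \<open>L\<close> is a topological space together with a sheaf of
  rings. All of its sections over nonempty open sets embed into the stalk \<open>L\<close> at the generic
  point, compatibly with restriction; thus the structure sheaf is a sheaf of subrings of the
  constant sheaf \<open>L\<close> (here the field type \<open>'l\<close>), and restriction maps are inclusions. The value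
  of \<open>Sect X\<close> at the empty set or at sets that are not open plays no role.
\<close>

record ('x, 'l) ringed =
  Topol :: "'x topology"
  Sect :: "'x set \<Rightarrow> 'l set"

definition nopen :: "('x, 'l) ringed \<Rightarrow> 'x set \<Rightarrow> bool" where
  "nopen X U \<longleftrightarrow> openin (Topol X) U \<and> U \<noteq> {}"

definition points :: "('x, 'l) ringed \<Rightarrow> 'x set" where
  "points X = topspace (Topol X)"

text \<open>
  Because restriction maps are inclusions, stalks are unions. Since nonempty open sets of an
  irreducible space meet, sections over the members of a cover glue iff they agree in \<open>L\<close>.
\<close>

definition sheaf_stalk :: "('x, 'l) ringed \<Rightarrow> ('x set \<Rightarrow> 'l set) \<Rightarrow> 'x \<Rightarrow> 'l set" where
  "sheaf_stalk X F x = \<Union>{F U | U. nopen X U \<and> x \<in> U}"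

definition subsheaf_of_const :: "('x, 'l) ringed \<Rightarrow> ('x set \<Rightarrow> 'l set) \<Rightarrow> bool" where
  "subsheaf_of_const X F \<longleftrightarrow>
     (\<forall>U V. nopen X U \<and> nopen X V \<and> V \<subseteq> U \<longrightarrow> F U \<subseteq> F V) \<and>
     (\<forall>\<U>. \<U> \<noteq> {} \<and> (\<forall>U\<in>\<U>. nopen X U) \<longrightarrow> (\<Inter>U\<in>\<U>. F U) \<subseteq> F (\<Union>\<U>))"

definition local_ring :: "('x, 'l::field) ringed \<Rightarrow> 'x \<Rightarrow> 'l set" where
  "local_ring X x = sheaf_stalk X (Sect X) x"

definition max_ideal :: "('x, 'l::field) ringed \<Rightarrow> 'x \<Rightarrow> 'l set" where
  "max_ideal X x = nonunits (local_ring X x)"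

text \<open>
  An open set \<open>U\<close> is affine iff the canonical morphism from \<open>U\<close> to the spectrum of its ring of
  sections is an isomorphism of locally ringed spaces.
\<close>

definition affine_open :: "('x, 'l::field) ringed \<Rightarrow> 'x set \<Rightarrow> bool" where
  "affine_open X U \<longleftrightarrow> nopen X U \<and>
     homeomorphic_map (subtopology (Topol X) U) (zariski (Sect X U)) (\<lambda>x. max_ideal X x \<inter> Sect X U) \<and>
     (\<forall>x\<in>U. local_ring X x = localization (Sect X U) (max_ideal X x \<inter> Sect X U))"

definition integral_scheme :: "('x, 'l::field) ringed \<Rightarrow> bool" where
  "integral_scheme X \<longleftrightarrow>
     points X \<noteq> {} \<and>
     (\<forall>U V. nopen X U \<and> nopen X V \<longrightarrow> U \<inter> V \<noteq> {}) \<and>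
     (\<forall>U. nopen X U \<longrightarrow> is_subring (Sect X U)) \<and>
     subsheaf_of_const X (Sect X) \<and>
     \<Union>{Sect X U | U. nopen X U} = UNIV \<and>
     (\<forall>x\<in>points X. \<exists>U. affine_open X U \<and> x \<in> U)"


section \<open>Smooth varieties over a field\<close>

text \<open>
  The diagonal is a closed immersion iff this holds over the open sets \<open>U \<times> V\<close> with \<open>U\<close>, \<open>V\<close>
  affine, that is, iff \<open>U \<inter> V\<close> is affine and \<open>\<O>(U) \<otimes> \<O>(V) \<rightarrow> \<O>(U \<inter> V)\<close> is onto.
\<close>

definition separated :: "('x, 'l::field) ringed \<Rightarrow> bool" where
  "separated X \<longleftrightarrow> (\<forall>U V. affine_open X U \<and> affine_open X V \<longrightarrow>
     affine_open X (U \<inter> V) \<and> Sect X (U \<inter> V) = subring_generated (Sect X U \<union> Sect X V))"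

text \<open>
  The homomorphism \<open>\<iota>\<close> from the base field \<open>'k\<close> to \<open>'l\<close> encodes the structure morphism.
\<close>

definition finite_type :: "('k::field \<Rightarrow> 'l::field) \<Rightarrow> ('x, 'l) ringed \<Rightarrow> bool" where
  "finite_type \<iota> X \<longleftrightarrow> compact_space (Topol X) \<and>
     (\<forall>x\<in>points X. \<exists>U. affine_open X U \<and> x \<in> U \<and>
        (\<exists>S. finite S \<and> Sect X U = subring_generated (\<iota> ` UNIV \<union> S)))"

definition variety :: "('k::field \<Rightarrow> 'l::field) \<Rightarrow> ('x, 'l) ringed \<Rightarrow> bool" where
  "variety \<iota> X \<longleftrightarrow> integral_scheme X \<and>
     field_hom \<iota> \<and> (\<forall>U. nopen X U \<longrightarrow> \<iota> ` UNIV \<subseteq> Sect X U) \<and>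
     separated X \<and> finite_type \<iota> X"

text \<open>
  Polynomials over \<open>'k\<close> in the variables with index below \<open>n\<close>, their evaluation at \<open>a\<close>
  and their partial derivatives.
\<close>

type_synonym 'k mvpoly = "(nat \<Rightarrow>\<^sub>0 nat) \<Rightarrow>\<^sub>0 'k"

definition mvpolys :: "nat \<Rightarrow> 'k::field mvpoly set" where
  "mvpolys n = {q. \<forall>m\<in>Poly_Mapping.keys q. Poly_Mapping.keys m \<subseteq> {..<n}}"

definition mveval :: "('k::field \<Rightarrow> 'l::field) \<Rightarrow> (nat \<Rightarrow> 'l) \<Rightarrow> 'k mvpoly \<Rightarrow> 'l" where
  "mveval \<iota> a q = (\<Sum>m\<in>Poly_Mapping.keys q.
     \<iota> (Poly_Mapping.lookup q m) * (\<Prod>i\<in>Poly_Mapping.keys m. a i ^ Poly_Mapping.lookup m i))"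

definition mvderiv :: "nat \<Rightarrow> 'k::field mvpoly \<Rightarrow> 'k mvpoly" where
  "mvderiv i q = (\<Sum>m\<in>Poly_Mapping.keys q.
     Poly_Mapping.single (m - Poly_Mapping.single i 1)
       (of_nat (Poly_Mapping.lookup m i) * Poly_Mapping.lookup q m))"

text \<open>
  \<open>R = k[x\<^sub>0,\<dots>,x\<^bsub>n-1\<^esub>]/(f\<^sub>0,\<dots>,f\<^bsub>r-1\<^esub>)\<close>, where the Jacobian determinant with respect to the
  first \<open>r\<close> variables is a unit of \<open>R\<close>.
\<close>

definition standard_smooth :: "('k::field \<Rightarrow> 'l::field) \<Rightarrow> 'l set \<Rightarrow> bool" where
  "standard_smooth \<iota> R \<longleftrightarrow> (\<exists>n r a f. r \<le> n \<and> (\<forall>j<r. f j \<in> mvpolys n) \<and>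
     mveval \<iota> a ` mvpolys n = R \<and>
     {q\<in>mvpolys n. mveval \<iota> a q = 0} = {\<Sum>j<r. g j * f j | g. \<forall>j<r. g j \<in> mvpolys n} \<and>
     Determinant.det (Matrix.mat r r (\<lambda>(i, j). mveval \<iota> a (mvderiv j (f i)))) \<in> R - nonunits R)"

definition smooth_variety :: "('k::field \<Rightarrow> 'l::field) \<Rightarrow> ('x, 'l) ringed \<Rightarrow> bool" where
  "smooth_variety \<iota> X \<longleftrightarrow> variety \<iota> X \<and>
     (\<forall>x\<in>points X. \<exists>U. affine_open X U \<and> x \<in> U \<and> standard_smooth \<iota> (Sect X U))"


section \<open>Ideal sheaves\<close>

definition ideal_sheaf :: "('x, 'l::field) ringed \<Rightarrow> ('x set \<Rightarrow> 'l set) \<Rightarrow> bool" where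
  "ideal_sheaf X \<aa> \<longleftrightarrow> subsheaf_of_const X \<aa> \<and> (\<forall>U. nopen X U \<longrightarrow> is_ideal (Sect X U) (\<aa> U))"

definition quasicoherent_ideal :: "('x, 'l::field) ringed \<Rightarrow> ('x set \<Rightarrow> 'l set) \<Rightarrow> bool" where
  "quasicoherent_ideal X \<aa> \<longleftrightarrow> ideal_sheaf X \<aa> \<and>
     (\<forall>U h. affine_open X U \<and> h \<in> Sect X U \<and> h \<noteq> 0 \<longrightarrow>
        \<aa> {x\<in>U. h \<notin> max_ideal X x} = {s / h ^ n | s n. s \<in> \<aa> U})"

definition coherent_ideal :: "('x, 'l::field) ringed \<Rightarrow> ('x set \<Rightarrow> 'l set) \<Rightarrow> bool" where
  "coherent_ideal X \<aa> \<longleftrightarrow> quasicoherent_ideal X \<aa> \<and>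
     (\<forall>U. affine_open X U \<longrightarrow> fg_ideal (Sect X U) (\<aa> U))"

definition nonzero_sheaf :: "('x, 'l::field) ringed \<Rightarrow> ('x set \<Rightarrow> 'l set) \<Rightarrow> bool" where
  "nonzero_sheaf X \<aa> \<longleftrightarrow> (\<exists>U. nopen X U \<and> (\<exists>f\<in>\<aa> U. f \<noteq> 0))"

text \<open>
  The product of two ideal sheaves is the sheaf generated by the products of sections, so it is
  contained in a third ideal sheaf iff all these products are.
\<close>

definition graded_sequence :: "('x, 'l::field) ringed \<Rightarrow> (nat \<Rightarrow> 'x set \<Rightarrow> 'l set) \<Rightarrow> bool" where
  "graded_sequence X \<aa> \<longleftrightarrow>
     (\<forall>m\<ge>1. quasicoherent_ideal X (\<aa> m) \<and> nonzero_sheaf X (\<aa> m)) \<and>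
     (\<forall>s\<ge>1. \<forall>t\<ge>1. \<forall>U. nopen X U \<longrightarrow> (\<forall>f\<in>\<aa> s U. \<forall>g\<in>\<aa> t U. f * g \<in> \<aa> (s + t) U))"


section \<open>Valuations and log discrepancies\<close>

definition real_valuation :: "('l::field \<Rightarrow> ereal) \<Rightarrow> bool" where
  "real_valuation v \<longleftrightarrow> v 0 = \<infinity> \<and> (\<forall>f. f \<noteq> 0 \<longrightarrow> \<bar>v f\<bar> \<noteq> \<infinity>) \<and>
     (\<forall>f g. v (f * g) = v f + v g) \<and> (\<forall>f g. min (v f) (v g) \<le> v (f + g))"

definition trivial_valuation :: "'l::field \<Rightarrow> ereal" where
  "trivial_valuation f = (if f = 0 then \<infinity> else 0)"

definition is_center :: "('x, 'l::field) ringed \<Rightarrow> ('l \<Rightarrow> ereal) \<Rightarrow> 'x \<Rightarrow> bool" where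
  "is_center X v x \<longleftrightarrow> x \<in> points X \<and>
     local_ring X x \<subseteq> {f. v f \<ge> 0} \<and> max_ideal X x = local_ring X x \<inter> {f. v f > 0}"

definition Val :: "('x, 'l::field) ringed \<Rightarrow> 'x set \<Rightarrow> ('l \<Rightarrow> ereal) set" where
  "Val X U = {v. real_valuation v \<and> (\<exists>x\<in>U. is_center X v x)}"

definition Val_star :: "('x, 'l::field) ringed \<Rightarrow> 'x set \<Rightarrow> ('l \<Rightarrow> ereal) set" where
  "Val_star X U = Val X U - {trivial_valuation}"

text \<open>The center is unique on a separated scheme.\<close>

definition center :: "('x, 'l::field) ringed \<Rightarrow> ('l \<Rightarrow> ereal) \<Rightarrow> 'x" where
  "center X v = (THE x. is_center X v x)"

definition val_ideal :: "('x, 'l::field) ringed \<Rightarrow> ('l \<Rightarrow> ereal) \<Rightarrow> ('x set \<Rightarrow> 'l set) \<Rightarrow> ereal" where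
  "val_ideal X v \<aa> = (INF f\<in>sheaf_stalk X \<aa> (center X v). v f)"

definition p_linear :: "nat \<Rightarrow> nat \<Rightarrow> ('l::field \<Rightarrow> 'l) \<Rightarrow> bool" where
  "p_linear p e \<psi> \<longleftrightarrow> (\<forall>f g. \<psi> (f + g) = \<psi> f + \<psi> g) \<and> (\<forall>f g. \<psi> (f ^ (p ^ e) * g) = f * \<psi> g)"

definition cartier_maps :: "('x, 'l::field) ringed \<Rightarrow> nat \<Rightarrow> nat \<Rightarrow> 'x \<Rightarrow> ('l \<Rightarrow> 'l) set" where
  "cartier_maps X p e x = {\<psi>. p_linear p e \<psi> \<and> \<psi> ` local_ring X x \<subseteq> local_ring X x}"

text \<open>\<open>E p e f \<psi> v\<close> is used for \<open>p\<^sup>-\<^sup>e\<close>-linear \<open>\<psi>\<close>; it is \<open>-\<infinity>\<close> if \<open>\<psi> f = 0\<close>.\<close>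

definition E :: "nat \<Rightarrow> nat \<Rightarrow> 'l::field \<Rightarrow> ('l \<Rightarrow> 'l) \<Rightarrow> ('l \<Rightarrow> ereal) \<Rightarrow> ereal" where
  "E p e f \<psi> v = (v f - ereal (real p ^ e) * v (\<psi> f)) / ereal (real p ^ e - 1)"

text \<open>The \<open>n\<close>-th iterate of a \<open>p\<^sup>-\<^sup>e\<close>-linear map is \<open>p\<^bsup>-en\<^esup>\<close>-linear.\<close>

definition log_disc_map :: "nat \<Rightarrow> nat \<Rightarrow> ('l::field \<Rightarrow> ereal) \<Rightarrow> ('l \<Rightarrow> 'l) \<Rightarrow> ereal" where
  "log_disc_map p e v \<psi> = (SUP f\<in>{f. f \<noteq> 0}. SUP n\<in>{1..}. E p (e * n) f (\<psi> ^^ n) v)"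

definition log_discrepancy :: "('x, 'l::field) ringed \<Rightarrow> nat \<Rightarrow> ('l \<Rightarrow> ereal) \<Rightarrow> ereal" where
  "log_discrepancy X p v =
     (SUP e\<in>{1..}. SUP \<psi>\<in>cartier_maps X p e (center X v) - {\<lambda>_. 0}. log_disc_map p e v \<psi>)"


section \<open>Asymptotic multiplier ideals\<close>

text \<open>
  The condition defining the sections over affine open sets is stated for every open \<open>U\<close>. It is
  a condition on each valuation centered on \<open>U\<close> separately, so this is the sheaf determined by
  its sections over affine open sets.
\<close>

definition asymptotic_multiplier ::
    "('x, 'l::field) ringed \<Rightarrow> nat \<Rightarrow> (nat \<Rightarrow> 'x set \<Rightarrow> 'l set) \<Rightarrow> real \<Rightarrow> 'x set \<Rightarrow> 'l set" where
  "asymptotic_multiplier X p \<aa> t U = {f\<in>Sect X U. \<forall>v\<in>Val_star X U.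
     eventually (\<lambda>m. v f + log_discrepancy X p v - ereal (t / real m) * val_ideal X v (\<aa> m) > 0)
       sequentially}"

end

(*
  Let U be affine and h a section over U. If no power of h multiplied s into the multiplier ideal
  of U, there would be valuations v_n, centered in U, such that h^n s violates the defining
  inequality at v_n. Finitely many standard smooth affine opens cover X, so infinitely many v_n are
  centered in one of them, with ring of sections S. Two facts about the log discrepancy A are used:
  it is lower semicontinuous, because p^-e-linear maps of a local ring extend over S after clearing
  denominators; and for every nonzero q in S there is a constant C with v(q) <= C A(v). By the
  violated inequality and the second fact, the v_n normalised by v_n(g) = 1, for a section g of a_1,
  are bounded on each element of the function field, so they have a limit point v in a compact
  product. It is a valuation centered in U with v(h) = 0, and lower semicontinuity of A together
  with upper semicontinuity of v -> inf_m v(a_m)/m contradicts the inequality for s on the open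
  set where h is invertible.

  The bound v(q) <= C A(v) is a form of strong F-regularity. For S = k[x]/(f_1,...,f_r) standard
  smooth, Fedder's maps s -> pi((f_1...f_r)^(p-1) s), with pi taking the coefficients over p-th
  powers, satisfy s = sum_i phi_i(s)^p b_i: applying (p-1)-st powers of derivations dual to the f_j
  recovers s up to a unit. Hence the ideal generated by all images of q under p^-e-linear maps of S
  is contained in its own square, so it is the unit ideal.
*)
theory Submission
  imports Defs
begin

text \<open>For m = 1 the violated inequality gives n v_n(h) + A(v_n) <= t v_n(g). As A is positive
  on nontrivial valuations, this forces t > 0 and v_n(g) > 0. It bounds A(v_n) / v_n(g) by t, hence
  v_n(q) / v_n(g) by C t for q in S, and it gives v_n(h) / v_n(g) <= t / n, which tends to 0.

  The definition of A tests only maps on the local ring at the center, and the centers of the v_n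
  differ from that of the limit v. After clearing denominators a map acts on S, so it tests A at
  every valuation centered there; the factor c that is multiplied in is a unit at the center of v,
  so v does not see it.

  A field may be uncountable, and a sequence in a product of uncountably many intervals may have no
  convergent subsequence. The limit is therefore taken along a filter finer than
  \<open>sequentially\<close>.

  Finite generation is a separate matter: it holds for every ideal of sections over an affine open
  set, because such a set is covered by standard smooth ones, whose rings are noetherian.\<close>

lemma subringD:
  assumes "is_subring R"
  shows "0 \<in> R" "1 \<in> R" "\<And>a b. a \<in> R \<Longrightarrow> b \<in> R \<Longrightarrow> a + b \<in> R"
    "\<And>a b. a \<in> R \<Longrightarrow> b \<in> R \<Longrightarrow> a * b \<in> R" "\<And>a. a \<in> R \<Longrightarrow> - a \<in> R"
    "\<And>a b. a \<in> R \<Longrightarrow> b \<in> R \<Longrightarrow> a - b \<in> R"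
proof -
  show "0 \<in> R" "1 \<in> R" "\<And>a b. a \<in> R \<Longrightarrow> b \<in> R \<Longrightarrow> a + b \<in> R"
    "\<And>a b. a \<in> R \<Longrightarrow> b \<in> R \<Longrightarrow> a * b \<in> R" "\<And>a. a \<in> R \<Longrightarrow> - a \<in> R"
    using assms by (auto simp: is_subring_def)
  then show "a - b \<in> R" if "a \<in> R" "b \<in> R" for a b
    using that by (metis add_uminus_conv_diff)
qed

lemma subring_power: "is_subring R \<Longrightarrow> a \<in> R \<Longrightarrow> a ^ n \<in> R"
  by (induction n) (auto simp: subringD)

lemma subring_sum: "is_subring R \<Longrightarrow> (\<And>i. i \<in> K \<Longrightarrow> f i \<in> R) \<Longrightarrow> sum f K \<in> R"
  by (induction K rule: infinite_finite_induct) (auto simp: subringD)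

lemma subring_prod: "is_subring R \<Longrightarrow> (\<And>i. i \<in> K \<Longrightarrow> f i \<in> R) \<Longrightarrow> prod f K \<in> R"
  by (induction K rule: infinite_finite_induct) (auto simp: subringD)

lemma idealD:
  assumes "is_ideal R I"
  shows "I \<subseteq> R" "0 \<in> I" "\<And>a b. a \<in> I \<Longrightarrow> b \<in> I \<Longrightarrow> a + b \<in> I"
    "\<And>r a. r \<in> R \<Longrightarrow> a \<in> I \<Longrightarrow> r * a \<in> I" "\<And>r a. r \<in> R \<Longrightarrow> a \<in> I \<Longrightarrow> a * r \<in> I"
  using assms by (auto simp: is_ideal_def mult.commute)

lemma ideal_uminus: "is_subring R \<Longrightarrow> is_ideal R I \<Longrightarrow> a \<in> I \<Longrightarrow> - a \<in> I"
  using idealD(4)[of R I "-1" a] subringD[of R] by simp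

lemma ideal_diff: "is_subring R \<Longrightarrow> is_ideal R I \<Longrightarrow> a \<in> I \<Longrightarrow> b \<in> I \<Longrightarrow> a - b \<in> I"
  using idealD(3)[of R I a "- b"] ideal_uminus[of R I b] by simp

lemma ideal_sum: "is_ideal R I \<Longrightarrow> (\<And>i. i \<in> K \<Longrightarrow> f i \<in> I) \<Longrightarrow> sum f K \<in> I"
  by (induction K rule: infinite_finite_induct) (auto simp: idealD)


section \<open>Noetherian subrings\<close>

definition ideal_gen :: "'l::field set \<Rightarrow> 'l set \<Rightarrow> 'l set" where
  "ideal_gen R G = \<Inter>{I. is_ideal R I \<and> G \<subseteq> I}"

lemma ideal_gen_superset: "G \<subseteq> ideal_gen R G"
  by (auto simp: ideal_gen_def)

lemma ideal_gen_least: "is_ideal R I \<Longrightarrow> G \<subseteq> I \<Longrightarrow> ideal_gen R G \<subseteq> I"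
  by (auto simp: ideal_gen_def)

lemma is_ideal_self: "is_subring R \<Longrightarrow> is_ideal R R"
  by (auto simp: is_ideal_def is_subring_def)

lemma ideal_gen_ideal:
  assumes "is_subring R" "G \<subseteq> R" shows "is_ideal R (ideal_gen R G)"
proof -
  have "is_ideal R R" by (simp add: assms is_ideal_self)
  with assms show ?thesis
    unfolding is_ideal_def ideal_gen_def by (auto simp: subset_eq)
qed

lemma ideal_gen_mono: "G \<subseteq> H \<Longrightarrow> ideal_gen R G \<subseteq> ideal_gen R H"
  by (auto simp: ideal_gen_def)

lemma is_ideal_span:
  assumes R: "is_subring R" and K: "f ` K \<subseteq> R"
  shows "is_ideal R {\<Sum>i\<in>K. c i * f i | c. c ` K \<subseteq> R}" (is "is_ideal R ?M")
  unfolding is_ideal_def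
proof (intro conjI ballI)
  show "?M \<subseteq> R" using K by (auto intro!: subring_sum[OF R] subringD(4)[OF R])
  show "0 \<in> ?M"
    by (rule CollectI, rule exI[of _ "\<lambda>_. 0"]) (use subringD[OF R] in auto)
  fix a assume "a \<in> ?M"
  then obtain c where c: "a = (\<Sum>i\<in>K. c i * f i)" "c ` K \<subseteq> R" by auto
  show "r * a \<in> ?M" if "r \<in> R" for r
    using c that
    by (intro CollectI exI[of _ "\<lambda>i. r * c i"])
      (use subringD[OF R] in \<open>auto simp: sum_distrib_left mult_ac\<close>)
  fix b assume "b \<in> ?M"
  then obtain d where "b = (\<Sum>i\<in>K. d i * f i)" "d ` K \<subseteq> R" by auto
  then show "a + b \<in> ?M"
    using c by (intro CollectI exI[of _ "\<lambda>i. c i + d i"])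
      (use subringD[OF R] in \<open>auto simp: sum.distrib algebra_simps\<close>)
qed

text \<open>Coefficients belong to indices rather than to elements, so that \<open>f\<close> may
  repeat values. In the basis theorem the leading coefficients can coincide.\<close>

lemma ideal_gen_image:
  assumes R: "is_subring R" and K: "f ` K \<subseteq> R" "finite K"
  shows "ideal_gen R (f ` K) = {\<Sum>i\<in>K. c i * f i | c. c ` K \<subseteq> R}" (is "_ = ?M")
proof
  show "ideal_gen R (f ` K) \<subseteq> ?M"
  proof (rule ideal_gen_least[OF is_ideal_span[OF R K(1)]], safe)
    fix j assume "j \<in> K"
    then have "f j = (\<Sum>i\<in>K. (if i = j then 1 else 0) * f i)"
      using K(2) by (simp add: if_distrib[of "\<lambda>x. x * _"] cong: if_cong)
    then show "\<exists>c. f j = (\<Sum>i\<in>K. c i * f i) \<and> c ` K \<subseteq> R"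
      by (intro exI[of _ "\<lambda>i. if i = j then 1 else 0"]) (use subringD[OF R] in auto)
  qed
next
  have I: "is_ideal R (ideal_gen R (f ` K))" by (rule ideal_gen_ideal[OF R K(1)])
  show "?M \<subseteq> ideal_gen R (f ` K)"
    using ideal_gen_superset[of "f ` K" R]
    by (auto intro!: ideal_sum[OF I] idealD(4)[OF I])
qed

text \<open>The ideals generated by finite subsets of \<open>G\<close> are directed, so their union
  is an ideal, and it contains \<open>G\<close>.\<close>

lemma ideal_gen_finite_subset:
  assumes R: "is_subring R" and G: "G \<subseteq> R" and x: "x \<in> ideal_gen R G"
  obtains F where "finite F" "F \<subseteq> G" "x \<in> ideal_gen R F"
proof -
  let ?M = "\<Union>{ideal_gen R F | F. finite F \<and> F \<subseteq> G}"
  have id: "is_ideal R (ideal_gen R F)" if "F \<subseteq> G" for F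
    using that G by (intro ideal_gen_ideal[OF R]) auto
  have M: "is_ideal R ?M"
    unfolding is_ideal_def
  proof (intro conjI ballI)
    show "?M \<subseteq> R" using idealD(1)[OF id] by blast
    show "0 \<in> ?M" using idealD(2)[OF id[of "{}"]] by blast
    show "a + b \<in> ?M" if ab: "a \<in> ?M" "b \<in> ?M" for a b
    proof -
      from ab obtain F1 F2 where F: "finite F1" "F1 \<subseteq> G" "a \<in> ideal_gen R F1"
          "finite F2" "F2 \<subseteq> G" "b \<in> ideal_gen R F2" by auto
      then have "a \<in> ideal_gen R (F1 \<union> F2)" "b \<in> ideal_gen R (F1 \<union> F2)"
        using ideal_gen_mono[of _ "F1 \<union> F2" R] by auto
      then have "a + b \<in> ideal_gen R (F1 \<union> F2)"
        using F by (intro idealD(3)[OF id]) auto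
      moreover have "finite (F1 \<union> F2)" "F1 \<union> F2 \<subseteq> G" using F by auto
      ultimately show ?thesis by blast
    qed
    show "r * a \<in> ?M" if "r \<in> R" "a \<in> ?M" for r a
      using that idealD(4)[OF id] by blast
  qed
  have GM: "G \<subseteq> ?M"
  proof
    fix g assume "g \<in> G"
    then show "g \<in> ?M" using ideal_gen_superset[of "{g}" R] by (intro UnionI[of "ideal_gen R {g}"]) auto
  qed
  from subsetD[OF ideal_gen_least[OF M GM] x] show ?thesis using that by auto
qed

definition noetherian :: "'l::field set \<Rightarrow> bool" where
  "noetherian R \<longleftrightarrow> is_subring R \<and> (\<forall>I. is_ideal R I \<longrightarrow> (\<exists>G. finite G \<and> G \<subseteq> I \<and> I = ideal_gen R G))"

lemma noetherianD:
  assumes "noetherian R"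
  shows "is_subring R"
    and "is_ideal R I \<Longrightarrow> \<exists>G. finite G \<and> G \<subseteq> I \<and> I = ideal_gen R G"
  using assms by (auto simp: noetherian_def)

lemma fg_idealI:
  assumes "is_subring R" "is_ideal R I" "finite G" "G \<subseteq> I" "I \<subseteq> ideal_gen R G"
  shows "fg_ideal R I"
proof -
  have "I = ideal_gen R G" using assms ideal_gen_least by blast
  moreover have "G \<subseteq> R" using assms idealD(1) by blast
  ultimately have "I = {\<Sum>s\<in>G. c s * s | c. c ` G \<subseteq> R}"
    using ideal_gen_image[OF assms(1), of "\<lambda>x. x" G] assms by simp
  then show ?thesis using assms unfolding fg_ideal_def by blast
qed

text \<open>The ascending chain condition in the form used below: the finitely many generators of
  the ideal of all terms already lie in the ideal of an initial segment.\<close>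

lemma noetherian_sequence:
  assumes N: "noetherian R" and a: "\<And>n. a n \<in> R"
  obtains m :: nat where "a m \<in> ideal_gen R (a ` {..<m})"
proof -
  have R: "is_subring R" using N by (simp add: noetherianD)
  have r: "range a \<subseteq> R" using a by auto
  have "is_ideal R (ideal_gen R (range a))" by (rule ideal_gen_ideal[OF R r])
  then obtain G where G: "finite G" "G \<subseteq> ideal_gen R (range a)" "ideal_gen R (range a) = ideal_gen R G"
    using noetherianD(2)[OF N] by blast
  have "\<exists>m. g \<in> ideal_gen R (a ` {..<m})" if "g \<in> G" for g
  proof -
    have "g \<in> ideal_gen R (range a)" using G(2) that by auto
    then obtain F where F: "finite F" "F \<subseteq> range a" "g \<in> ideal_gen R F"
      by (rule ideal_gen_finite_subset[OF R r])
    obtain N where "finite N" "F = a ` N" using F finite_subset_image by metis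
    then obtain m where "N \<subseteq> {..<m}" using finite_nat_iff_bounded by blast
    then have "F \<subseteq> a ` {..<m}" using \<open>F = a ` N\<close> by auto
    then show ?thesis using F ideal_gen_mono by blast
  qed
  then obtain m where m: "g \<in> ideal_gen R (a ` {..<m g})" if "g \<in> G" for g by metis
  obtain M where M: "m g \<le> M" if "g \<in> G" for g
    using G(1) by (meson finite_imageI finite_nat_set_iff_bounded_le imageI)
  have "G \<subseteq> ideal_gen R (a ` {..<M})"
  proof
    fix g assume g: "g \<in> G"
    then have "a ` {..<m g} \<subseteq> a ` {..<M}" using M[of g] by auto
    from ideal_gen_mono[OF this] show "g \<in> ideal_gen R (a ` {..<M})" using m[OF g] by blast
  qed
  then have "ideal_gen R G \<subseteq> ideal_gen R (a ` {..<M})"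
    using ideal_gen_ideal[OF R, of "a ` {..<M}"] a by (intro ideal_gen_least) auto
  moreover have "a M \<in> ideal_gen R (range a)" by (rule subsetD[OF ideal_gen_superset]) simp
  ultimately show ?thesis using that[of M] G(3) by blast
qed

section \<open>Adjoining one element to a noetherian subring\<close>

definition adjoin :: "'l::field set \<Rightarrow> 'l \<Rightarrow> 'l set" where
  "adjoin A x = {poly q x | q. \<forall>i. poly.coeff q i \<in> A}"

lemma adjoin_subring:
  assumes A: "is_subring A" shows "is_subring (adjoin A x)"
  unfolding is_subring_def
proof (intro conjI ballI)
  show "0 \<in> adjoin A x" unfolding adjoin_def
    by (rule CollectI, rule exI[of _ 0]) (use subringD[OF A] in auto)
  show "1 \<in> adjoin A x" unfolding adjoin_def
    by (rule CollectI, rule exI[of _ 1]) (use subringD[OF A] in \<open>auto simp: coeff_1\<close>)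
  fix a b assume "a \<in> adjoin A x" "b \<in> adjoin A x"
  then obtain p q where p: "a = poly p x" "\<forall>i. poly.coeff p i \<in> A" and q: "b = poly q x" "\<forall>i. poly.coeff q i \<in> A"
    by (auto simp: adjoin_def)
  show "a + b \<in> adjoin A x" unfolding adjoin_def
    by (rule CollectI, rule exI[of _ "p + q"]) (use p q subringD[OF A] in auto)
  show "- a \<in> adjoin A x" unfolding adjoin_def
    by (rule CollectI, rule exI[of _ "- p"]) (use p subringD[OF A] in auto)
  show "a * b \<in> adjoin A x" unfolding adjoin_def
    by (rule CollectI, rule exI[of _ "p * q"])
      (use p q in \<open>auto simp: coeff_mult intro!: subring_sum[OF A] subringD(4)[OF A]\<close>)
qed

lemma adjoin_superset: assumes "is_subring A" shows "A \<subseteq> adjoin A x" "x \<in> adjoin A x"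
proof -
  show "A \<subseteq> adjoin A x" unfolding adjoin_def
  proof safe
    fix a assume "a \<in> A"
    then show "\<exists>q. a = poly q x \<and> (\<forall>i. poly.coeff q i \<in> A)"
      by (intro exI[of _ "[:a:]"]) (use subringD[OF assms] in \<open>auto simp: coeff_pCons split: nat.splits\<close>)
  qed
  show "x \<in> adjoin A x" unfolding adjoin_def
    by (rule CollectI, rule exI[of _ "[:0,1:]"])
      (use subringD[OF assms] in \<open>auto simp: coeff_pCons split: nat.splits\<close>)
qed

lemma adjoin_least: "is_subring B \<Longrightarrow> A \<subseteq> B \<Longrightarrow> x \<in> B \<Longrightarrow> adjoin A x \<subseteq> B"
  by (auto simp: adjoin_def poly_altdef intro!: subring_sum subringD(4) subring_power)

text \<open>Dependent choice in which each choice sees the set of all earlier ones. The recursion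
  accumulates that set, and the values are read off afterwards.\<close>

lemma sequence_of_finite_choices:
  assumes "\<And>F. finite F \<Longrightarrow> \<exists>y. P F y"
  shows "\<exists>f. \<forall>n::nat. P (f ` {..<n}) (f n)"
proof -
  from assms obtain g where g: "finite F \<Longrightarrow> P F (g F)" for F by metis
  define F where "F = rec_nat {} (\<lambda>_ S. insert (g S) S)"
  have F: "F 0 = {}" "F (Suc n) = insert (g (F n)) (F n)" for n
    by (simp_all add: F_def)
  have e: "F n = (\<lambda>k. g (F k)) ` {..<n}" for n
    by (induction n) (auto simp: F lessThan_Suc)
  have "P ((\<lambda>k. g (F k)) ` {..<n}) (g (F n))" for n
    using e[of n] g[of "F n"] by simp
  then show ?thesis by blast
qed

text \<open>
  Hilbert's basis theorem. Choosing polynomials of minimal degree whose values avoid the ideal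
  generated so far, the leading coefficients would contradict the noetherian property of \<open>A\<close>.
\<close>

theorem noetherian_adjoin:
  assumes N: "noetherian A" shows "noetherian (adjoin A x)"
proof -
  have A: "is_subring A" using N by (rule noetherianD)
  let ?B = "adjoin A x"
  have B: "is_subring ?B" by (rule adjoin_subring[OF A])
  have pB: "poly q x \<in> ?B" if "\<forall>i. poly.coeff q i \<in> A" for q
    using that by (auto simp: adjoin_def)
  show ?thesis unfolding noetherian_def
  proof (intro conjI B allI impI, rule ccontr)
    fix I assume I: "is_ideal ?B I" and neg: "\<nexists>G. finite G \<and> G \<subseteq> I \<and> I = ideal_gen ?B G"
    \<comment> \<open>The element \<open>x\<close> may be algebraic over \<open>A\<close>, so
      degrees are measured on polynomials and not on their values in
      \<open>adjoin A x\<close>.\<close>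
    define Q where "Q = {q. (\<forall>i. poly.coeff q i \<in> A) \<and> poly q x \<in> I}"
    \<comment> \<open>Intersecting with \<open>Q\<close> gives \<open>bad\<close> a meaning for
      every finite \<open>F\<close>, as \<open>sequence_of_finite_choices\<close> demands.\<close>
    define bad where "bad F q \<longleftrightarrow> q \<in> Q \<and> poly q x \<notin> ideal_gen ?B ((\<lambda>q. poly q x) ` (F \<inter> Q))" for F q
    have "\<exists>q. bad F q \<and> (\<forall>r. bad F r \<longrightarrow> degree q \<le> degree r)" if "finite F" for F
    proof -
      let ?G = "(\<lambda>q. poly q x) ` (F \<inter> Q)"
      have G: "?G \<subseteq> I" "finite ?G" using that by (auto simp: Q_def)
      then have "ideal_gen ?B ?G \<noteq> I" using neg by blast
      moreover have "ideal_gen ?B ?G \<subseteq> I" by (rule ideal_gen_least[OF I G(1)])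
      ultimately obtain y where "y \<in> I" "y \<notin> ideal_gen ?B ?G" by blast
      moreover then obtain q where "y = poly q x" "\<forall>i. poly.coeff q i \<in> A"
        using idealD(1)[OF I] by (auto simp: adjoin_def)
      ultimately have "bad F q" by (auto simp: bad_def Q_def)
      then show ?thesis using ex_has_least_nat[of "bad F" q degree] by blast
    qed
    from sequence_of_finite_choices[of "\<lambda>F q. bad F q \<and> (\<forall>r. bad F r \<longrightarrow> degree q \<le> degree r)", OF this]
    obtain f where f': "\<forall>n::nat. bad (f ` {..<n}) (f n) \<and> (\<forall>r. bad (f ` {..<n}) r \<longrightarrow> degree (f n) \<le> degree r)" ..
    then have f: "bad (f ` {..<n}) (f n)" "\<And>r. bad (f ` {..<n}) r \<Longrightarrow> degree (f n) \<le> degree r" for n :: nat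
      by blast+
    have fQ: "f n \<in> Q" for n using f(1)[of n] by (simp add: bad_def)
    then have fA: "poly.coeff (f n) i \<in> A" for n i by (auto simp: Q_def)
    have bad_mono: "bad F q" if "bad F' q" "F \<subseteq> F'" for F F' q
    proof -
      have "(\<lambda>q. poly q x) ` (F \<inter> Q) \<subseteq> (\<lambda>q. poly q x) ` (F' \<inter> Q)" using that by auto
      from ideal_gen_mono[OF this] show ?thesis using that unfolding bad_def by blast
    qed
    \<comment> \<open>\<open>f m\<close> was already a candidate when \<open>f i\<close> was chosen,
      so minimality makes the degrees increase.\<close>
    have deg: "degree (f i) \<le> degree (f m)" if "i < m" for i m
      by (rule f(2), rule bad_mono[OF f(1)[of m]]) (use that in auto)
    obtain m where m: "lead_coeff (f m) \<in> ideal_gen A ((\<lambda>n. lead_coeff (f n)) ` {..<m})"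
      using noetherian_sequence[OF N, of "\<lambda>n. lead_coeff (f n)"] fA by blast
    moreover have "ideal_gen A ((\<lambda>n. lead_coeff (f n)) ` {..<m})
        = {\<Sum>i<m. c i * lead_coeff (f i) | c. c ` {..<m} \<subseteq> A}"
      by (rule ideal_gen_image[OF A]) (use fA in auto)
    ultimately obtain c where c: "lead_coeff (f m) = (\<Sum>i<m. c i * lead_coeff (f i))" "c ` {..<m} \<subseteq> A"
      by auto
    \<comment> \<open>The combination of earlier polynomials with the same leading term as
      \<open>f m\<close>. Subtracting it keeps \<open>f m\<close> bad but lowers the degree, or
      gives \<open>0\<close>, whose value lies in every ideal.\<close>
    define d where "d = (\<Sum>i<m. Polynomial.monom (c i) (degree (f m) - degree (f i)) * f i)"
    have dA: "poly.coeff d i \<in> A" for i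
      unfolding d_def coeff_sum coeff_mult coeff_monom
      using c(2) fA subringD[OF A] by (intro subring_sum[OF A] subringD(4)[OF A]) auto
    have gen: "is_ideal ?B (ideal_gen ?B ((\<lambda>q. poly q x) ` (f ` {..<m} \<inter> Q)))"
      using pB by (intro ideal_gen_ideal[OF B]) (auto simp: Q_def)
    have "poly d x = (\<Sum>i<m. poly (Polynomial.monom (c i) (degree (f m) - degree (f i))) x * poly (f i) x)"
      by (simp add: d_def poly_sum)
    also have "\<dots> \<in> ideal_gen ?B ((\<lambda>q. poly q x) ` (f ` {..<m} \<inter> Q))"
    proof (rule ideal_sum[OF gen], rule idealD(4)[OF gen])
      fix i assume i: "i \<in> {..<m}"
      show "poly (Polynomial.monom (c i) (degree (f m) - degree (f i))) x \<in> ?B"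
        using c(2) i subringD[OF A] by (intro pB) (auto simp: coeff_monom)
      have "poly (f i) x \<in> (\<lambda>q. poly q x) ` (f ` {..<m} \<inter> Q)" using i fQ by auto
      then show "poly (f i) x \<in> ideal_gen ?B ((\<lambda>q. poly q x) ` (f ` {..<m} \<inter> Q))"
        by (rule subsetD[OF ideal_gen_superset])
    qed
    finally have dg: "poly d x \<in> ideal_gen ?B ((\<lambda>q. poly q x) ` (f ` {..<m} \<inter> Q))" .
    have "bad (f ` {..<m}) (f m - d)"
    proof -
      have "poly d x \<in> I"
        using dg ideal_gen_least[OF I, of "(\<lambda>q. poly q x) ` (f ` {..<m} \<inter> Q)"] by (auto simp: Q_def)
      then have "f m - d \<in> Q"
        using fQ[of m] dA subringD[OF A] ideal_diff[OF B I] by (auto simp: Q_def)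
      moreover have False if "poly (f m - d) x \<in> ideal_gen ?B ((\<lambda>q. poly q x) ` (f ` {..<m} \<inter> Q))"
        using idealD(3)[OF gen that dg] f(1)[of m] by (simp add: bad_def)
      ultimately show ?thesis by (auto simp: bad_def)
    qed
    moreover have "degree (f m - d) < degree (f m) \<or> f m - d = 0"
    proof -
      have t: "degree (Polynomial.monom (c i) (degree (f m) - degree (f i)) * f i) \<le> degree (f m)" if "i < m" for i
        using degree_mult_le[of "Polynomial.monom (c i) (degree (f m) - degree (f i))" "f i"]
          degree_monom_le[of "c i" "degree (f m) - degree (f i)"] deg[OF that] by linarith
      have dd: "degree d \<le> degree (f m)"
        unfolding d_def by (rule degree_sum_le) (use t in auto)
      have "poly.coeff d (degree (f m)) = (\<Sum>i<m. c i * lead_coeff (f i))"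
        unfolding d_def coeff_sum
      proof (rule sum.cong[OF refl])
        fix i assume "i \<in> {..<m}"
        then have "degree (f i) \<le> degree (f m)" using deg by simp
        then show "poly.coeff (Polynomial.monom (c i) (degree (f m) - degree (f i)) * f i) (degree (f m))
            = c i * lead_coeff (f i)"
          using coeff_monom_mult[of "c i" "degree (f m) - degree (f i)" "f i" "degree (f m)"] by simp
      qed
      then have z: "poly.coeff (f m - d) (degree (f m)) = 0" using c by simp
      have le: "degree (f m - d) \<le> degree (f m)" using dd by (simp add: degree_diff_le)
      show ?thesis
      proof (rule ccontr)
        assume "\<not> ?thesis"
        with le have "degree (f m - d) = degree (f m)" "f m - d \<noteq> 0" by auto
        with z show False by (metis leading_coeff_0_iff)
      qed
    qed
    ultimately show False
      using f(2)[of m "f m - d"] idealD(2)[OF gen] by (auto simp: bad_def)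
  qed
qed

lemma noetherian_subfield:
  assumes A: "is_subring A" and inv: "\<And>a. a \<in> A \<Longrightarrow> inverse a \<in> A"
  shows "noetherian A"
  unfolding noetherian_def
proof (intro conjI A allI impI)
  fix I assume I: "is_ideal A I"
  show "\<exists>G. finite G \<and> G \<subseteq> I \<and> I = ideal_gen A G"
  proof (cases "I = {0}")
    case True
    then have "I = ideal_gen A {}"
      using ideal_gen_least[OF I, of "{}"] idealD(2)[OF ideal_gen_ideal[OF A, of "{}"]] by auto
    then show ?thesis by (intro exI[of _ "{}"]) auto
  next
    case False
    then obtain a where a: "a \<in> I" "a \<noteq> 0" using idealD(2)[OF I] by auto
    have "y \<in> ideal_gen A {a}" if y: "y \<in> I" for y
    proof -
      have aA: "a \<in> A" "y \<in> A" using a y idealD(1)[OF I] by auto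
      have "(y * inverse a) * a \<in> ideal_gen A {a}"
        using aA ideal_gen_superset[of "{a}" A] subringD(4)[OF A] inv
        by (intro idealD(4)[OF ideal_gen_ideal[OF A]]) auto
      then show ?thesis using a by (simp add: mult.assoc)
    qed
    then show ?thesis using a ideal_gen_least[OF I, of "{a}"] by (intro exI[of _ "{a}"]) auto
  qed
qed


section \<open>Prime ideals\<close>

lemma SpecD:
  assumes "P \<in> Spec R"
  shows "is_ideal R P" "1 \<notin> P" "\<And>a b. a \<in> R \<Longrightarrow> b \<in> R \<Longrightarrow> a * b \<in> P \<Longrightarrow> a \<in> P \<or> b \<in> P"
  using assms by (auto simp: Spec_def)

lemma Spec_power: "is_subring R \<Longrightarrow> P \<in> Spec R \<Longrightarrow> a \<in> R \<Longrightarrow> a ^ n \<in> P \<Longrightarrow> a \<in> P"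
  by (induction n) (auto simp: SpecD(2) dest: SpecD(3) subring_power)

text \<open>An ideal that is maximal among those containing \<open>D\<close> and missing all powers
  of \<open>h\<close> is prime: if \<open>a\<close> and \<open>b\<close> lay outside it, adding
  either would capture a power of \<open>h\<close>, and the product of the two expressions would put
  a power of \<open>h\<close> into the ideal itself.\<close>

lemma prime_avoiding_powers:
  assumes R: "is_subring R" and D: "is_ideal R D" and h: "h \<in> R" "\<And>n. h ^ n \<notin> D"
  obtains P where "P \<in> Spec R" "D \<subseteq> P" "h \<notin> P"
proof -
  define S where "S = {I. is_ideal R I \<and> D \<subseteq> I \<and> (\<forall>n. h ^ n \<notin> I)}"
  have "\<exists>M\<in>S. \<forall>X\<in>S. M \<subseteq> X \<longrightarrow> X = M"
  proof (rule subset_Zorn_nonempty)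
    show "S \<noteq> {}" using D h by (auto simp: S_def)
    fix C assume C: "C \<noteq> {}" "subset.chain S C"
    have CS: "is_ideal R I" "D \<subseteq> I" "h ^ n \<notin> I" if "I \<in> C" for I n
      using C that by (auto simp: subset.chain_def S_def)
    have "is_ideal R (\<Union>C)" unfolding is_ideal_def
    proof (intro conjI ballI)
      show "\<Union>C \<subseteq> R" using CS(1) idealD(1) by blast
      show "0 \<in> \<Union>C" using CS(1) idealD(2) C(1) by blast
      show "r * a \<in> \<Union>C" if "r \<in> R" "a \<in> \<Union>C" for r a
        using CS(1) idealD(4) that by blast
      fix a b assume "a \<in> \<Union>C" "b \<in> \<Union>C"
      then obtain I J where IJ: "I \<in> C" "J \<in> C" "a \<in> I" "b \<in> J" by auto
      then consider "I \<subseteq> J" | "J \<subseteq> I" using C(2) by (auto simp: subset.chain_def)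
      then show "a + b \<in> \<Union>C"
        using IJ CS(1) idealD(3) by cases blast+
    qed
    moreover have "D \<subseteq> \<Union>C" using C(1) CS(2) by blast
    ultimately show "\<Union>C \<in> S" using CS(3) by (auto simp: S_def)
  qed
  then obtain M where M: "M \<in> S" "\<And>X. X \<in> S \<Longrightarrow> M \<subseteq> X \<Longrightarrow> X = M" by blast
  have MI: "is_ideal R M" "D \<subseteq> M" "\<And>n. h ^ n \<notin> M" using M(1) by (auto simp: S_def)
  have ext: "\<exists>n m r. m \<in> M \<and> r \<in> R \<and> h ^ n = m + r * a" if a: "a \<in> R" "a \<notin> M" for a
  proof -
    let ?N = "{m + r * a | m r. m \<in> M \<and> r \<in> R}"
    have "is_ideal R ?N" unfolding is_ideal_def
    proof (intro conjI ballI)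
      show "?N \<subseteq> R" using idealD(1)[OF MI(1)] a subringD[OF R] by auto
      have "0 = 0 + 0 * a" by simp
      then show "0 \<in> ?N" using idealD(2)[OF MI(1)] subringD(1)[OF R] by blast
      fix u assume "u \<in> ?N"
      then obtain m r where u: "u = m + r * a" "m \<in> M" "r \<in> R" by auto
      show "s * u \<in> ?N" if "s \<in> R" for s
      proof -
        have "s * u = s * m + (s * r) * a" using u by (simp add: algebra_simps)
        then show ?thesis using u that idealD(4)[OF MI(1)] subringD(4)[OF R] by blast
      qed
      fix w assume "w \<in> ?N"
      then obtain m' r' where w: "w = m' + r' * a" "m' \<in> M" "r' \<in> R" by auto
      have "u + w = (m + m') + (r + r') * a" using u w by (simp add: algebra_simps)
      then show "u + w \<in> ?N" using u w idealD(3)[OF MI(1)] subringD(3)[OF R] by blast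
    qed
    moreover have MN: "M \<subseteq> ?N"
    proof
      fix m assume "m \<in> M"
      moreover have "m = m + 0 * a" by simp
      ultimately show "m \<in> ?N" using subringD(1)[OF R] by blast
    qed
    moreover have "a \<in> ?N"
    proof -
      have "a = 0 + 1 * a" by simp
      then show ?thesis using subringD(2)[OF R] idealD(2)[OF MI(1)] by blast
    qed
    ultimately have "?N \<notin> S" using M(2)[of ?N] a by blast
    then obtain n where "h ^ n \<in> ?N"
      using \<open>is_ideal R ?N\<close> MN MI(2) by (auto simp: S_def)
    then show ?thesis by auto
  qed
  have "M \<in> Spec R" unfolding Spec_def
  proof (intro CollectI conjI ballI impI MI)
    show "1 \<notin> M" using MI(3)[of 0] by simp
    fix a b assume ab: "a \<in> R" "b \<in> R" "a * b \<in> M"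
    show "a \<in> M \<or> b \<in> M"
    proof (rule ccontr)
      assume "\<not> ?thesis"
      then obtain n m r n' m' r' where e: "m \<in> M" "r \<in> R" "h ^ n = m + r * a" "m' \<in> M" "r' \<in> R" "h ^ n' = m' + r' * b"
        using ext[of a] ext[of b] ab by blast
      have "h ^ (n + n') = m * (m' + r' * b) + (r * a) * m' + (r * r') * (a * b)"
        unfolding power_add e by (simp add: algebra_simps)
      moreover have "m * (m' + r' * b) \<in> M"
        using e ab idealD(1)[OF MI(1)] subringD[OF R] by (intro idealD(5)[OF MI(1)]) auto
      moreover have "(r * a) * m' \<in> M" "(r * r') * (a * b) \<in> M"
        using e ab subringD[OF R] by (auto intro!: idealD(4)[OF MI(1)])
      ultimately have "h ^ (n + n') \<in> M" using idealD(3)[OF MI(1)] by metis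
      then show False using MI(3) by blast
    qed
  qed
  then show ?thesis using that MI(2) MI(3)[of 1] by auto
qed

lemma in_ideal_if_all_primes:
  assumes "is_subring R" "is_ideal R D" "\<And>P. P \<in> Spec R \<Longrightarrow> \<not> D \<subseteq> P"
  shows "1 \<in> D"
  using prime_avoiding_powers[OF assms(1,2), of 1] assms(3) subringD(2)[OF assms(1)] by auto


section \<open>Idempotent ideals\<close>

text \<open>Gaussian elimination on a homogeneous system that is congruent to the identity modulo
  \<open>b\<close>. All pivots stay congruent to 1, so they are nonzero because
  \<open>1 \<notin> b\<close>. Allowing a factor \<open>u\<close> in front of \<open>x\<close> lets
  the elimination multiply by the pivot instead of dividing by it.\<close>

lemma nakayama_elimination:
  assumes R: "is_subring R" and b: "is_ideal R b" and 1: "1 \<notin> b" and "finite G"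
    and "\<And>x. x \<in> G \<Longrightarrow> \<exists>u c. 1 - u \<in> b \<and> c ` G \<subseteq> b \<and> u * x = (\<Sum>y\<in>G. c y * y)"
  shows "x \<in> G \<Longrightarrow> x = 0"
  using assms(4,5)
proof (induction G arbitrary: x rule: finite_induct)
  case empty
  then show ?case by simp
next
  case (insert g G)
  from insert.prems(2)[of g] obtain u c where u: "1 - u \<in> b" "c ` insert g G \<subseteq> b"
      "u * g = c g * g + (\<Sum>y\<in>G. c y * y)"
    using insert.hyps by auto
  define w where "w = u - c g"
  have "1 - w = (1 - u) + c g" by (simp add: w_def)
  moreover have "(1 - u) + c g \<in> b" using u by (intro idealD(3)[OF b]) auto
  ultimately have w1: "1 - w \<in> b" by metis
  have wR: "w \<in> R"
  proof -
    have "1 - w \<in> R" using w1 idealD(1)[OF b] by auto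
    then have "1 - (1 - w) \<in> R" by (rule subringD(6)[OF R subringD(2)[OF R]])
    moreover have "1 - (1 - w) = w" by (simp add: algebra_simps)
    ultimately show ?thesis by (simp only:)
  qed
  have wg: "w * g = (\<Sum>y\<in>G. c y * y)" using u by (simp add: w_def algebra_simps)
  have G0: "y = 0" if "y \<in> G" for y
  proof (rule insert.IH[OF that])
    fix x assume "x \<in> G"
    with insert.prems(2)[of x] obtain v d where v: "1 - v \<in> b" "d ` insert g G \<subseteq> b"
      "v * x = d g * g + (\<Sum>y\<in>G. d y * y)"
      using insert.hyps by auto
    have "1 - w * v = (1 - w) + w * (1 - v)" by (simp add: algebra_simps)
    moreover have "(1 - w) + w * (1 - v) \<in> b" using w1 v wR by (intro idealD(3,4)[OF b]) auto
    ultimately have "1 - w * v \<in> b" by metis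
    moreover have "w * v * x = (\<Sum>y\<in>G. (d g * c y + w * d y) * y)"
    proof -
      have "w * v * x = w * (v * x)" by (simp add: mult.assoc)
      also have "\<dots> = d g * (w * g) + w * (\<Sum>y\<in>G. d y * y)"
        unfolding v(3) by (simp add: distrib_left mult.left_commute)
      also have "\<dots> = (\<Sum>y\<in>G. (d g * c y + w * d y) * y)"
        unfolding wg by (simp add: sum_distrib_left distrib_right sum.distrib mult.assoc)
      finally show ?thesis .
    qed
    moreover have "(\<lambda>y. d g * c y + w * d y) ` G \<subseteq> b"
    proof (rule image_subsetI)
      fix y assume "y \<in> G"
      then have "d g \<in> R" "c y \<in> b" "d y \<in> b" using u(2) v(2) idealD(1)[OF b] by auto
      then show "d g * c y + w * d y \<in> b" using wR by (intro idealD(3)[OF b] idealD(4)[OF b])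
    qed
    ultimately show "\<exists>u c. 1 - u \<in> b \<and> c ` G \<subseteq> b \<and> u * x = (\<Sum>y\<in>G. c y * y)" by blast
  qed
  have "w * g = 0" unfolding wg by (rule sum.neutral) (simp add: G0)
  moreover have "w \<noteq> 0" using w1 1 by auto
  ultimately show ?case using insert.prems(1) G0 by auto
qed

text \<open>Otherwise each generator of \<open>b\<close> is a combination of the generators with
  coefficients in \<open>b\<close>, and the elimination above makes all of them zero.\<close>

lemma idempotent_ideal:
  assumes N: "noetherian R" and b: "is_ideal R b"
    and sq: "\<And>x. x \<in> b \<Longrightarrow> x \<in> ideal_gen R {y * z | y z. y \<in> b \<and> z \<in> b}"
    and ne: "x \<in> b" "x \<noteq> 0"
  shows "1 \<in> b"
proof (rule ccontr)
  assume 1: "1 \<notin> b"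
  have R: "is_subring R" using N by (rule noetherianD)
  obtain G where G: "finite G" "G \<subseteq> b" "b = ideal_gen R G" using noetherianD(2)[OF N b] by blast
  have GR: "G \<subseteq> R" using G idealD(1)[OF b] by blast
  have b_eq: "b = {\<Sum>s\<in>G. c s * s | c. c ` G \<subseteq> R}"
    using ideal_gen_image[OF R, of "\<lambda>x. x" G] G GR by simp
  have bb: "is_ideal R {\<Sum>s\<in>G. c s * s | c. c ` G \<subseteq> b}" (is "is_ideal R ?M")
    unfolding is_ideal_def
  proof (intro conjI ballI)
    show "?M \<subseteq> R" using GR idealD(1)[OF b] by (auto intro!: subring_sum[OF R] subringD(4)[OF R])
    show "0 \<in> ?M" by (rule CollectI, rule exI[of _ "\<lambda>_. 0"]) (use idealD[OF b] in auto)
    fix u assume "u \<in> ?M"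
    then obtain c where c: "u = (\<Sum>s\<in>G. c s * s)" "c ` G \<subseteq> b" by auto
    show "r * u \<in> ?M" if "r \<in> R" for r
      using c that idealD(4)[OF b] by (intro CollectI exI[of _ "\<lambda>s. r * c s"])
        (auto simp: sum_distrib_left mult_ac)
    fix w assume "w \<in> ?M"
    then obtain d where d: "w = (\<Sum>s\<in>G. d s * s)" "d ` G \<subseteq> b" by auto
    show "u + w \<in> ?M"
      using c d idealD(3)[OF b] by (intro CollectI exI[of _ "\<lambda>s. c s + d s"])
        (auto simp: sum.distrib algebra_simps)
  qed
  \<comment> \<open>Expanding only the second factor in the generators leaves the coefficients in
    \<open>b\<close>.\<close>
  have "{y * z | y z. y \<in> b \<and> z \<in> b} \<subseteq> ?M"
  proof safe
    fix y z assume "y \<in> b" "z \<in> b"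
    then obtain c where c: "z = (\<Sum>s\<in>G. c s * s)" "c ` G \<subseteq> R" using b_eq by blast
    show "\<exists>c. y * z = (\<Sum>s\<in>G. c s * s) \<and> c ` G \<subseteq> b"
      using c \<open>y \<in> b\<close>
      by (intro exI[of _ "\<lambda>s. y * c s"])
        (auto simp: sum_distrib_left mult.assoc intro!: idealD(5)[OF b])
  qed
  then have M: "x \<in> ?M" if "x \<in> b" for x
    using subsetD[OF ideal_gen_least[OF bb] sq[OF that]] by simp
  have "g = 0" if "g \<in> G" for g
  proof (rule nakayama_elimination[OF R b 1 G(1) _ that])
    fix x assume "x \<in> G"
    then obtain c where "x = (\<Sum>s\<in>G. c s * s)" "c ` G \<subseteq> b" using M G(2) by blast
    then show "\<exists>u c. 1 - u \<in> b \<and> c ` G \<subseteq> b \<and> u * x = (\<Sum>y\<in>G. c y * y)"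
      using idealD(2)[OF b] by (intro exI[of _ 1]) auto
  qed
  then have "b \<subseteq> {0}" unfolding b_eq by (auto intro!: sum.neutral)
  then show False using ne by auto
qed

section \<open>Polynomials in characteristic \<open>p\<close>\<close>

text \<open>Reduces an identity between additive maps to monomials. Only exponents occurring in
  \<open>q\<close> are tested, so a bound on the variables of \<open>q\<close> stays
  available.\<close>

lemma poly_mapping_additive_eq:
  fixes F G :: "('m \<Rightarrow>\<^sub>0 'k::comm_monoid_add) \<Rightarrow> 'b::ab_group_add"
  assumes F: "\<And>q r. F (q + r) = F q + F r" and G: "\<And>q r. G (q + r) = G q + G r"
    and s: "\<And>m c. m \<in> Poly_Mapping.keys q \<Longrightarrow>
      F (Poly_Mapping.single m c) = G (Poly_Mapping.single m c)"
  shows "F q = G q"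
proof -
  have z: "F 0 = 0" "G 0 = 0" using F[of 0 0] G[of 0 0] by simp_all
  have Fs: "F (sum h A) = (\<Sum>m\<in>A. F (h m))" "G (sum h A) = (\<Sum>m\<in>A. G (h m))"
    for A :: "'m set" and h :: "'m \<Rightarrow> ('m \<Rightarrow>\<^sub>0 'k)"
    by (induction A rule: infinite_finite_induct) (auto simp: F G z)
  have q: "q = (\<Sum>m\<in>Poly_Mapping.keys q. Poly_Mapping.single m (Poly_Mapping.lookup q m))"
    by (rule poly_mapping_eqI) (auto simp: lookup_sum lookup_single when_def in_keys_iff)
  have "F q = (\<Sum>m\<in>Poly_Mapping.keys q. F (Poly_Mapping.single m (Poly_Mapping.lookup q m)))"
    by (subst q) (rule Fs)
  also have "\<dots> = (\<Sum>m\<in>Poly_Mapping.keys q. G (Poly_Mapping.single m (Poly_Mapping.lookup q m)))"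
    by (rule sum.cong) (auto simp: s)
  also have "\<dots> = G q" by (subst (2) q) (rule Fs(2)[symmetric])
  finally show ?thesis .
qed

section \<open>Polynomials in finitely many variables, their evaluation and derivatives\<close>

lemma mvpolysI:
  "(\<And>m i. m \<in> Poly_Mapping.keys q \<Longrightarrow> i \<in> Poly_Mapping.keys m \<Longrightarrow> i < n) \<Longrightarrow> q \<in> mvpolys n"
  by (auto simp: mvpolys_def)

lemma mvpolys_0: "0 \<in> mvpolys n"
  by (simp add: mvpolys_def)

lemma mvpolys_add: "q \<in> mvpolys n \<Longrightarrow> r \<in> mvpolys n \<Longrightarrow> q + r \<in> mvpolys n"
  using keys_add[of q r] by (fastforce simp: mvpolys_def)

lemma mvpolys_sum: "(\<And>i. i \<in> K \<Longrightarrow> f i \<in> mvpolys n) \<Longrightarrow> sum f K \<in> mvpolys n"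
  by (induction K rule: infinite_finite_induct) (auto simp: mvpolys_0 mvpolys_add)

lemma mvpolys_single: "Poly_Mapping.keys m \<subseteq> {..<n} \<Longrightarrow> Poly_Mapping.single m c \<in> mvpolys n"
  by (auto simp: mvpolys_def)

lemma mvpolys_mult: 
  assumes "q \<in> mvpolys n" "r \<in> mvpolys n" shows "q * r \<in> mvpolys n"
proof (rule mvpolysI)
  fix m i assume "m \<in> Poly_Mapping.keys (q * r)" and i: "i \<in> Poly_Mapping.keys m"
  then obtain a b where ab: "m = a + b" "a \<in> Poly_Mapping.keys q" "b \<in> Poly_Mapping.keys r"
    using keys_mult[of q r] by auto
  then have "i \<in> Poly_Mapping.keys a \<or> i \<in> Poly_Mapping.keys b"
    using i keys_add[of a b] by auto
  then show "i < n" using ab assms by (auto simp: mvpolys_def)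
qed

lemma mvpolys_1: "1 \<in> mvpolys n"
  by (auto simp: mvpolys_def)

lemma mvpolys_power: "q \<in> mvpolys n \<Longrightarrow> q ^ k \<in> mvpolys n"
  by (induction k) (auto simp: mvpolys_1 mvpolys_mult)

lemma mvpolys_prod: "(\<And>i. i \<in> K \<Longrightarrow> f i \<in> mvpolys n) \<Longrightarrow> prod f K \<in> mvpolys n"
  by (induction K rule: infinite_finite_induct) (auto simp: mvpolys_1 mvpolys_mult)

lemma mvpolys_uminus: "q \<in> mvpolys n \<Longrightarrow> - q \<in> mvpolys n"
  by (auto simp: mvpolys_def)

lemma mvpolys_diff: "q \<in> mvpolys n \<Longrightarrow> r \<in> mvpolys n \<Longrightarrow> q - r \<in> mvpolys n"
  using mvpolys_add[of q n "- r"] mvpolys_uminus by auto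

lemma mveval_add:
  assumes "field_hom \<iota>" shows "mveval \<iota> a (q + r) = mveval \<iota> a q + mveval \<iota> a r"
proof -
  interpret field_hom \<iota> by fact
  show ?thesis unfolding mveval_def
    by (rule setsum_keys_plus_distrib) (auto simp: hom_add algebra_simps)
qed

lemma mveval_single:
  assumes "field_hom \<iota>"
  shows "mveval \<iota> a (Poly_Mapping.single m c) =
    \<iota> c * (\<Prod>i\<in>Poly_Mapping.keys m. a i ^ Poly_Mapping.lookup m i)"
proof -
  interpret field_hom \<iota> by fact
  show ?thesis by (cases "c = 0") (auto simp: mveval_def)
qed

lemma monomial_value_add:
  fixes a :: "nat \<Rightarrow> 'l::field"
  shows "(\<Prod>i\<in>Poly_Mapping.keys (m + m'). a i ^ Poly_Mapping.lookup (m + m') i) =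
    (\<Prod>i\<in>Poly_Mapping.keys m. a i ^ Poly_Mapping.lookup m i) *
    (\<Prod>i\<in>Poly_Mapping.keys m'. a i ^ Poly_Mapping.lookup m' i)"
proof -
  let ?K = "Poly_Mapping.keys m \<union> Poly_Mapping.keys m'"
  have e: "(\<Prod>i\<in>Poly_Mapping.keys u. a i ^ Poly_Mapping.lookup u i) = (\<Prod>i\<in>?K. a i ^ Poly_Mapping.lookup u i)"
    if "Poly_Mapping.keys u \<subseteq> ?K" for u
    by (rule prod.mono_neutral_left) (use that in \<open>auto simp: in_keys_iff\<close>)
  show ?thesis
    by (subst (1 2 3) e) (use keys_add[of m m'] in \<open>auto simp: lookup_add power_add prod.distrib\<close>)
qed

lemma mveval_mult:
  assumes "field_hom \<iota>" shows "mveval \<iota> a (q * r) = mveval \<iota> a q * mveval \<iota> a r"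
proof -
  interpret field_hom \<iota> by fact
  show ?thesis
  proof (rule poly_mapping_additive_eq[where q = q])
    fix m c
    show "mveval \<iota> a (Poly_Mapping.single m c * r) = mveval \<iota> a (Poly_Mapping.single m c) * mveval \<iota> a r"
      by (rule poly_mapping_additive_eq[where q = r])
        (auto simp: mveval_add[OF assms] distrib_left mult_single mveval_single[OF assms]
          monomial_value_add hom_mult algebra_simps)
  qed (auto simp: mveval_add[OF assms] distrib_right)
qed

lemma mveval_0: "mveval \<iota> a 0 = 0"
  by (simp add: mveval_def)

lemma mveval_1: "field_hom \<iota> \<Longrightarrow> mveval \<iota> a 1 = 1"
proof -
  assume "field_hom \<iota>"
  then interpret field_hom \<iota> .
  show ?thesis by (simp add: mveval_def)
qed

lemma mveval_uminus: "field_hom \<iota> \<Longrightarrow> mveval \<iota> a (- q) = - mveval \<iota> a q"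
  using mveval_add[of \<iota> a q "- q"] by (simp add: mveval_0 add_eq_0_iff)

lemma mveval_diff: "field_hom \<iota> \<Longrightarrow> mveval \<iota> a (q - r) = mveval \<iota> a q - mveval \<iota> a r"
  using mveval_add[of \<iota> a q "- r"] by (simp add: mveval_uminus)

lemma mveval_sum: "field_hom \<iota> \<Longrightarrow> mveval \<iota> a (sum f K) = (\<Sum>i\<in>K. mveval \<iota> a (f i))"
  by (induction K rule: infinite_finite_induct) (auto simp: mveval_0 mveval_add)

lemma mveval_power: "field_hom \<iota> \<Longrightarrow> mveval \<iota> a (q ^ k) = mveval \<iota> a q ^ k"
  by (induction k) (auto simp: mveval_1 mveval_mult)

lemma mvderiv_add: "mvderiv i (q + r) = mvderiv i q + mvderiv i r"
  unfolding mvderiv_def by (rule setsum_keys_plus_distrib) (auto simp: single_add algebra_simps)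

lemma mvderiv_single: "mvderiv i (Poly_Mapping.single m c) =
    Poly_Mapping.single (m - Poly_Mapping.single i 1) (of_nat (Poly_Mapping.lookup m i) * c)"
  by (cases "c = 0") (auto simp: mvderiv_def)

lemma mvderiv_mult:
  fixes q r :: "'k::field mvpoly"
  shows "mvderiv i (q * r) = mvderiv i q * r + q * mvderiv i r"
proof (rule poly_mapping_additive_eq[where q = q])
  fix m and c :: 'k
  show "mvderiv i (Poly_Mapping.single m c * r) =
      mvderiv i (Poly_Mapping.single m c) * r + Poly_Mapping.single m c * mvderiv i r"
  proof (rule poly_mapping_additive_eq[where q = r])
    fix m' and c' :: 'k
    let ?e = "Poly_Mapping.single i (1::nat)"
    \<comment> \<open>Subtraction of exponents is truncated, so the two exponents differ when
      \<open>u\<close> does not involve the variable \<open>i\<close>; then the coefficient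
      vanishes.\<close>
    have e: "Poly_Mapping.single (u - ?e + w) (of_nat (Poly_Mapping.lookup u i) * d)
        = Poly_Mapping.single (u + w - ?e) (of_nat (Poly_Mapping.lookup u i) * d)" for u w and d :: 'k
    proof (cases "Poly_Mapping.lookup u i = 0")
      case False
      then have "u - ?e + w = u + w - ?e"
        by (intro poly_mapping_eqI) (auto simp: lookup_add lookup_minus lookup_single when_def)
      then show ?thesis by simp
    qed auto
    show "mvderiv i (Poly_Mapping.single m c * Poly_Mapping.single m' c') =
        mvderiv i (Poly_Mapping.single m c) * Poly_Mapping.single m' c'
        + Poly_Mapping.single m c * mvderiv i (Poly_Mapping.single m' c')"
      using e[of m m' "c * c'"] e[of m' m "c * c'"]
      by (simp add: mult_single mvderiv_single lookup_add algebra_simps single_add)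
  qed (auto simp: mvderiv_add algebra_simps)
qed (auto simp: mvderiv_add algebra_simps)

lemma mvpolys_mvderiv: "q \<in> mvpolys n \<Longrightarrow> mvderiv i q \<in> mvpolys n"
  unfolding mvderiv_def
proof (intro mvpolys_sum mvpolys_single subsetI)
  fix m j assume q: "q \<in> mvpolys n" "m \<in> Poly_Mapping.keys q"
    and "j \<in> Poly_Mapping.keys (m - Poly_Mapping.single i 1)"
  then have "j \<in> Poly_Mapping.keys m" by (auto simp: in_keys_iff lookup_minus)
  then show "j \<in> {..<n}" using q by (auto simp: mvpolys_def)
qed

lemma CHAR_mvpoly: "CHAR('k::field mvpoly) = CHAR('k)"
proof (rule CHAR_eqI)
  have *: "(of_nat n :: 'k mvpoly) = Poly_Mapping.single 0 (of_nat n)" for n by simp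
  show "of_nat CHAR('k) = (0 :: 'k mvpoly)" unfolding * by simp
  show "CHAR('k) dvd x" if "of_nat x = (0 :: 'k mvpoly)" for x
  proof -
    have "Poly_Mapping.lookup (of_nat x :: 'k mvpoly) 0 = 0" using that by simp
    then have "(of_nat x :: 'k) = 0" by (simp add: lookup_of_nat)
    then show ?thesis by (simp add: of_nat_eq_0_iff_char_dvd)
  qed
qed

lemma CHAR_field_hom:
  fixes \<iota> :: "'k::field \<Rightarrow> 'l::field"
  assumes "field_hom \<iota>" shows "CHAR('l) = CHAR('k)"
proof -
  interpret field_hom \<iota> by fact
  have *: "\<iota> (of_nat n) = of_nat n" for n by (induction n) (auto simp: hom_add)
  have inj: "\<iota> x = 0 \<Longrightarrow> x = 0" for x
    by (metis hom_mult hom_one mult_zero_left right_inverse zero_neq_one)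
  show ?thesis
  proof (rule CHAR_eqI)
    show "of_nat CHAR('k) = (0::'l)" using *[of "CHAR('k)"] by simp
    show "CHAR('k) dvd x" if "of_nat x = (0::'l)" for x
      using *[of x] inj[of "of_nat x"] that by (simp add: of_nat_eq_0_iff_char_dvd)
  qed
qed

lemma prime_CHAR_field: "CHAR('k::field) > 0 \<Longrightarrow> prime CHAR('k)"
  by (rule prime_CHAR_semidom)

lemma single_power:
  "Poly_Mapping.single (m :: nat \<Rightarrow>\<^sub>0 nat) (c::'k::field) ^ k = Poly_Mapping.single (Poly_Mapping.map ((*) k) m) (c ^ k)"
proof (induction k)
  case 0
  have "Poly_Mapping.map (\<lambda>_. 0) m = (0 :: nat \<Rightarrow>\<^sub>0 nat)" by (rule poly_mapping_eqI) (simp add: map.rep_eq)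
  then show ?case by simp
next
  case (Suc k)
  have "m + Poly_Mapping.map ((*) k) m = Poly_Mapping.map ((*) (Suc k)) m"
    by (rule poly_mapping_eqI) (auto simp: lookup_add map.rep_eq when_def)
  then show ?case by (simp add: Suc mult_single del: mult_Suc)
qed


section \<open>Decomposing a polynomial over its ring of \<open>p\<close>-th powers\<close>

definition frob_root :: "nat \<Rightarrow> 'k::field \<Rightarrow> 'k" where
  "frob_root p c = (SOME x. x ^ p = c)"

lemma frob_root:
  fixes c :: "'k::alg_closed_field"
  assumes "p > 0" shows "frob_root p c ^ p = c"
  unfolding frob_root_def by (rule someI_ex) (rule nth_root_exists[OF assms])

lemma frobenius_inj:
  fixes x y :: "'k::field"
  assumes p: "CHAR('k) = p" "p > 0" and e: "x ^ p = y ^ p" shows "x = y"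
proof -
  have "prime p" using p prime_CHAR_field by auto
  then have "((x - y) + y) ^ p = (x - y) ^ p + y ^ p"
    by (intro freshmans_dream) (simp_all add: p)
  then have "(x - y) ^ p = 0" using e by simp
  then show ?thesis by simp
qed

text \<open>Over the ring of p-th powers, the monomials with exponents below \<open>p\<close> form a
  basis. This is the p-th root of the coefficient at the monomial \<open>\<alpha>\<close>; taking
  the root makes the map p^-1-linear.\<close>

definition pcomp :: "nat \<Rightarrow> (nat \<Rightarrow>\<^sub>0 nat) \<Rightarrow> 'k::field mvpoly \<Rightarrow> 'k mvpoly" where
  "pcomp p \<alpha> q = (\<Sum>m\<in>Poly_Mapping.keys q.
     if Poly_Mapping.map (\<lambda>x. x mod p) m = \<alpha>
     then Poly_Mapping.single (Poly_Mapping.map (\<lambda>x. x div p) m) (frob_root p (Poly_Mapping.lookup q m))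
     else 0)"

definition exponents_below :: "nat \<Rightarrow> nat \<Rightarrow> (nat \<Rightarrow>\<^sub>0 nat) set" where
  "exponents_below p n = {\<alpha>. Poly_Mapping.keys \<alpha> \<subseteq> {..<n} \<and> (\<forall>i. Poly_Mapping.lookup \<alpha> i < p)}"

lemma finite_exponents_below: "finite (exponents_below p n)"
proof -
  have "inj_on (\<lambda>\<alpha>. restrict (Poly_Mapping.lookup \<alpha>) {..<n}) (exponents_below p n)"
  proof (rule inj_onI, rule poly_mapping_eqI)
    fix \<alpha> \<beta> i assume a: "\<alpha> \<in> exponents_below p n" "\<beta> \<in> exponents_below p n"
      "restrict (Poly_Mapping.lookup \<alpha>) {..<n} = restrict (Poly_Mapping.lookup \<beta>) {..<n}"
    show "Poly_Mapping.lookup \<alpha> i = Poly_Mapping.lookup \<beta> i"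
    proof (cases "i < n")
      case True
      then show ?thesis using fun_cong[OF a(3), of i] by simp
    next
      case False
      then have "i \<notin> Poly_Mapping.keys \<alpha>" "i \<notin> Poly_Mapping.keys \<beta>"
        using a(1,2) by (auto simp: exponents_below_def)
      then show ?thesis by (simp add: in_keys_iff)
    qed
  qed
  moreover have "(\<lambda>\<alpha>. restrict (Poly_Mapping.lookup \<alpha>) {..<n}) ` exponents_below p n
      \<subseteq> PiE {..<n} (\<lambda>_. {..<p})"
    by (rule image_subsetI, rule PiE_I) (auto simp: exponents_below_def)
  ultimately show ?thesis
    by (meson finite_PiE finite_imageD finite_lessThan finite_subset)
qed

context
  fixes p :: nat and k :: "'k::alg_closed_field itself"
  assumes p: "CHAR('k) = p" "p > 0"
begin

lemma prime_p: "prime p"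
  using p prime_CHAR_field by auto

lemma frob_root_add: "frob_root p (c + d :: 'k) = frob_root p c + frob_root p d"
  by (rule frobenius_inj[OF p]) (simp add: frob_root p freshmans_dream prime_p)

lemma frob_root_0: "frob_root p (0 :: 'k) = 0"
  using frob_root_add[of 0 0] by (metis add_cancel_right_right)

lemma frob_root_power_mult: "frob_root p (c ^ p * d :: 'k) = c * frob_root p d"
  by (rule frobenius_inj[OF p]) (simp add: frob_root p power_mult_distrib)

lemma mvpoly_power_add: "(q + r :: 'k mvpoly) ^ p = q ^ p + r ^ p"
  by (rule freshmans_dream) (use p prime_p in \<open>auto simp: CHAR_mvpoly\<close>)

lemma pcomp_add: "pcomp p \<alpha> (q + r :: 'k mvpoly) = pcomp p \<alpha> q + pcomp p \<alpha> r"
  unfolding pcomp_def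
  by (rule setsum_keys_plus_distrib) (auto simp: frob_root_add frob_root_0 single_add)

lemma pcomp_single: "pcomp p \<alpha> (Poly_Mapping.single m (c::'k)) =
    (if Poly_Mapping.map (\<lambda>x. x mod p) m = \<alpha>
     then Poly_Mapping.single (Poly_Mapping.map (\<lambda>x. x div p) m) (frob_root p c) else 0)"
  by (cases "c = 0") (auto simp: pcomp_def frob_root_0)

lemma mvpolys_pcomp: "(q :: 'k mvpoly) \<in> mvpolys n \<Longrightarrow> pcomp p \<alpha> q \<in> mvpolys n"
  unfolding pcomp_def
proof (intro mvpolys_sum)
  fix m assume "q \<in> mvpolys n" "m \<in> Poly_Mapping.keys q"
  then have "Poly_Mapping.keys m \<subseteq> {..<n}" by (auto simp: mvpolys_def)
  moreover have "Poly_Mapping.keys (Poly_Mapping.map (\<lambda>x. x div p) m) \<subseteq> Poly_Mapping.keys m"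
    by (auto simp: in_keys_iff map.rep_eq when_def split: if_splits)
  ultimately show "(if Poly_Mapping.map (\<lambda>x. x mod p) m = \<alpha>
      then Poly_Mapping.single (Poly_Mapping.map (\<lambda>x. x div p) m) (frob_root p (Poly_Mapping.lookup q m))
      else 0) \<in> mvpolys n"
    using mvpolys_0[of n] by (auto intro!: mvpolys_single)
qed

text \<open>Both sides are additive in \<open>h\<close> because Frobenius is. For monomials, adding
  p times an exponent preserves residues modulo \<open>p\<close> and shifts the quotients.\<close>

lemma pcomp_power_mult: "pcomp p \<alpha> (h ^ p * q :: 'k mvpoly) = h * pcomp p \<alpha> q"
proof (rule poly_mapping_additive_eq[where q = q])
  fix m and c :: 'k
  show "pcomp p \<alpha> (h ^ p * Poly_Mapping.single m c) = h * pcomp p \<alpha> (Poly_Mapping.single m c)"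
  proof (rule poly_mapping_additive_eq[where q = h])
    fix u and d :: 'k
    let ?w = "Poly_Mapping.map ((*) p) u + m"
    have "Poly_Mapping.map (\<lambda>x. x mod p) ?w = Poly_Mapping.map (\<lambda>x. x mod p) m"
      by (rule poly_mapping_eqI) (auto simp: lookup_add map.rep_eq when_def)
    moreover have "Poly_Mapping.map (\<lambda>x. x div p) ?w = u + Poly_Mapping.map (\<lambda>x. x div p) m"
      using p(2) by (intro poly_mapping_eqI) (auto simp: lookup_add map.rep_eq when_def)
    ultimately show "pcomp p \<alpha> (Poly_Mapping.single u d ^ p * Poly_Mapping.single m c)
        = Poly_Mapping.single u d * pcomp p \<alpha> (Poly_Mapping.single m c)"
      by (simp add: single_power mult_single pcomp_single frob_root_power_mult)
  qed (auto simp: mvpoly_power_add pcomp_add algebra_simps)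
qed (auto simp: pcomp_add algebra_simps)

lemma pcomp_decomposition:
  fixes q :: "'k mvpoly"
  assumes q: "q \<in> mvpolys n"
  shows "q = (\<Sum>\<alpha>\<in>exponents_below p n. pcomp p \<alpha> q ^ p * Poly_Mapping.single \<alpha> 1)"
proof (rule poly_mapping_additive_eq[where q = q])
  fix m and c :: 'k assume "m \<in> Poly_Mapping.keys q"
  then have m: "Poly_Mapping.keys m \<subseteq> {..<n}" using q by (auto simp: mvpolys_def)
  let ?a = "Poly_Mapping.map (\<lambda>x. x mod p) m"
  have "?a \<in> exponents_below p n"
    using m p(2)
    by (auto simp: exponents_below_def in_keys_iff map.rep_eq when_def subset_eq split: if_splits)
  moreover have "pcomp p \<alpha> (Poly_Mapping.single m c) ^ p * Poly_Mapping.single \<alpha> 1 =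
      (if \<alpha> = ?a then Poly_Mapping.single m c else 0)" for \<alpha>
  proof -
    have "Poly_Mapping.map ((*) p) (Poly_Mapping.map (\<lambda>x. x div p) m) + ?a = m"
    proof (rule poly_mapping_eqI)
      fix i
      show "Poly_Mapping.lookup (Poly_Mapping.map ((*) p) (Poly_Mapping.map (\<lambda>x. x div p) m) + ?a) i
          = Poly_Mapping.lookup m i"
        by (auto simp: lookup_add map.rep_eq when_def) (metis add_0 mult_0_right mult_div_mod_eq)
    qed
    then show ?thesis using p(2)
      by (auto simp: pcomp_single single_power mult_single frob_root)
  qed
  ultimately show "Poly_Mapping.single m c =
      (\<Sum>\<alpha>\<in>exponents_below p n. pcomp p \<alpha> (Poly_Mapping.single m c) ^ p * Poly_Mapping.single \<alpha> 1)"
    by (simp add: finite_exponents_below)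
qed (auto simp: pcomp_add mvpoly_power_add distrib_right sum.distrib)

end

section \<open>Powers of an ideal and derivations\<close>

text \<open>\<open>kernel_power E m\<close> is the \<open>m\<close>-th power of the kernel of \<open>E\<close>.\<close>

inductive kernel_power :: "('a::comm_ring_1 \<Rightarrow> 'b::comm_ring_1) \<Rightarrow> nat \<Rightarrow> 'a \<Rightarrow> bool" for E where
  zero: "kernel_power E 0 q"
| step: "kernel_power E m q \<Longrightarrow> E a = 0 \<Longrightarrow> kernel_power E (Suc m) (a * q)"
| add: "kernel_power E m q \<Longrightarrow> kernel_power E m q' \<Longrightarrow> kernel_power E m (q + q')"

text \<open>\<open>E\<close> will be the evaluation onto the quotient, while \<open>d\<close> acts
  on its source: a derivation with \<open>E (d f) = 1\<close> for some \<open>f\<close> in the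
  kernel of \<open>E\<close> does not descend to the quotient.\<close>

locale ring_map_derivation =
  fixes E :: "'a::comm_ring_1 \<Rightarrow> 'b::comm_ring_1" and d :: "'a \<Rightarrow> 'a"
  assumes E_add: "E (x + y) = E x + E y" and E_mult: "E (x * y) = E x * E y" and E_1: "E 1 = 1"
    and d_add: "d (x + y) = d x + d y" and d_mult: "d (x * y) = d x * y + x * d y"
begin

lemma E_diff: "E (x - y) = E x - E y"
  using E_add[of "x - y" y] by simp

lemma d_1: "d 1 = 0"
  using d_mult[of 1 1] by simp

lemma d_diff: "d (x - y) = d x - d y"
  using d_add[of "x - y" y] by simp

lemma kp_mult: "kernel_power E m q \<Longrightarrow> kernel_power E m (b * q)"
proof (induction arbitrary: b rule: kernel_power.induct)
  case (step m q a)
  then show ?case using kernel_power.step[of E m "b * q" a] by (simp add: mult.left_commute)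
qed (auto simp: distrib_left intro: kernel_power.intros)

lemma kp_mult': "kernel_power E m q \<Longrightarrow> kernel_power E m (q * b)"
  using kp_mult[of m q b] by (simp add: mult.commute)

lemma kp_Suc_E: "kernel_power E m q \<Longrightarrow> m = Suc l \<Longrightarrow> E q = 0"
  by (induction arbitrary: l rule: kernel_power.induct) (auto simp: E_mult E_add)

lemma kp_prod: "kernel_power E m x \<Longrightarrow> kernel_power E l y \<Longrightarrow> kernel_power E (m + l) (x * y)"
proof (induction rule: kernel_power.induct)
  case (zero q)
  then show ?case by (simp add: kp_mult)
next
  case (step m q a)
  then show ?case using kernel_power.step[of E "m + l" "q * y" a] by (simp add: mult.assoc)
qed (auto simp: distrib_right intro: kernel_power.add)

lemma kp_power: "E x = 0 \<Longrightarrow> kernel_power E k (x ^ k)"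
  by (induction k) (auto intro: kernel_power.intros)

text \<open>By the Leibniz rule a derivation destroys at most one kernel factor of each
  product.\<close>

lemma kp_d: "kernel_power E m q \<Longrightarrow> kernel_power E (m - 1) (d q)"
proof (induction rule: kernel_power.induct)
  case (step m q a)
  have "kernel_power E m (a * d q)"
  proof (cases m)
    case (Suc m')
    then show ?thesis using step kernel_power.step[of E m' "d q" a] by simp
  qed (auto intro: kernel_power.zero)
  moreover have "kernel_power E m (d a * q)" using step by (simp add: kp_mult)
  ultimately show ?case by (simp add: d_mult kernel_power.add)
qed (auto simp: d_add intro: kernel_power.intros)

lemma d_power_kp: "E f = 0 \<Longrightarrow> E (d f) = 0 \<Longrightarrow> kernel_power E k (d (f ^ k))"
proof (induction k)
  case 0
  then show ?case by (simp add: kernel_power.zero)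
next
  case (Suc k)
  then have "kernel_power E (Suc k) (d f * f ^ k)" "kernel_power E (Suc k) (f * d (f ^ k))"
    by (auto intro!: kernel_power.step kp_power)
  then show ?case by (simp add: d_mult kernel_power.add)
qed

lemma prod_kp:
  "finite J \<Longrightarrow> (\<And>j. j \<in> J \<Longrightarrow> E (f j) = 0) \<Longrightarrow> kernel_power E (card J * k) (\<Prod>j\<in>J. f j ^ k)"
proof (induction J rule: finite_induct)
  case (insert i J)
  have "kernel_power E (k + card J * k) (f i ^ k * (\<Prod>j\<in>J. f j ^ k))"
    using insert by (intro kp_prod kp_power) auto
  then show ?case using insert.hyps by simp
qed (simp add: kernel_power.zero)

text \<open>Here, in contrast to \<open>kp_d\<close>, no order is lost, since the factor that gets
  differentiated is replaced by one that is again in the kernel.\<close>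

lemma d_prod_kp:
  assumes "finite J" "\<And>j. j \<in> J \<Longrightarrow> E (f j) = 0" "\<And>j. j \<in> J \<Longrightarrow> E (d (f j)) = 0"
  shows "kernel_power E (card J * k) (d (\<Prod>j\<in>J. f j ^ k))"
  using assms
proof (induction J rule: finite_induct)
  case empty
  then show ?case by (simp add: kernel_power.zero)
next
  case (insert i J)
  let ?G = "\<Prod>j\<in>J. f j ^ k"
  have "kernel_power E (card J * k) ?G"
    using insert by (intro prod_kp) auto
  then have "kernel_power E (k + card J * k) (d (f i ^ k) * ?G)"
    using insert.prems by (intro kp_prod d_power_kp) auto
  moreover have "kernel_power E (k + card J * k) (f i ^ k * d ?G)"
    using insert by (intro kp_prod kp_power) auto
  ultimately show ?case using insert.hyps by (simp add: d_mult kernel_power.add)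
qed

lemma d_power_unit:
  assumes "E f = 0" "E (d f) = 1"
  shows "kernel_power E k (d (f ^ k) - of_nat k * f ^ (k - 1))"
proof (induction k)
  case 0
  then show ?case by (simp add: kernel_power.zero)
next
  case (Suc k)
  have "kernel_power E (Suc k) ((d f - 1) * f ^ k)"
    by (intro kernel_power.step kp_power) (use assms in \<open>auto simp: E_diff E_1\<close>)
  moreover have "kernel_power E (Suc k) (f * (d (f ^ k) - of_nat k * f ^ (k - 1)))"
    by (intro kernel_power.step Suc) (use assms in auto)
  ultimately have "kernel_power E (Suc k) ((d f - 1) * f ^ k + f * (d (f ^ k) - of_nat k * f ^ (k - 1)))"
    by (rule kernel_power.add)
  moreover have "(d f - 1) * f ^ k + f * (d (f ^ k) - of_nat k * f ^ (k - 1))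
      = d (f ^ Suc k) - of_nat (Suc k) * f ^ (Suc k - 1)"
    by (cases k) (auto simp: d_mult d_1 algebra_simps)
  ultimately show ?case by simp
qed

text \<open>Up to terms of the full order \<open>k + g\<close>, the derivation acts on
  \<open>s * f ^ k * G\<close> like d/df with \<open>s\<close> and \<open>G\<close> treated as
  constants.\<close>

lemma d_step:
  assumes "E f = 0" "E (d f) = 1" "kernel_power E g G" "kernel_power E g (d G)"
  shows "kernel_power E (k + g) (d (s * f ^ k * G) - of_nat k * s * f ^ (k - 1) * G)"
proof -
  have "kernel_power E (k + g) (d s * (f ^ k * G))"
    by (intro kp_mult kp_prod kp_power assms)
  moreover have "kernel_power E (k + g) (s * ((d (f ^ k) - of_nat k * f ^ (k - 1)) * G))"
    by (intro kp_mult kp_prod d_power_unit assms)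
  moreover have "kernel_power E (k + g) (s * (f ^ k * d G))"
    by (intro kp_mult kp_prod kp_power assms)
  ultimately have "kernel_power E (k + g) (d s * (f ^ k * G)
      + s * ((d (f ^ k) - of_nat k * f ^ (k - 1)) * G) + s * (f ^ k * d G))"
    by (intro kernel_power.add)
  moreover have "d s * (f ^ k * G) + s * ((d (f ^ k) - of_nat k * f ^ (k - 1)) * G) + s * (f ^ k * d G)
      = d (s * f ^ k * G) - of_nat k * s * f ^ (k - 1) * G"
    by (simp add: d_mult algebra_simps)
  ultimately show ?thesis by simp
qed

text \<open>Each application lowers the order of the error by one, from \<open>k + g + 1\<close>
  down to \<open>g + 1\<close>. This is still one more than the order known for \<open>G\<close>, so
  the term \<open>k! s G\<close> stays visible.\<close>

lemma d_iterate:
  assumes f: "E f = 0" "E (d f) = 1" and G: "kernel_power E g G" "kernel_power E g (d G)"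
    and w: "kernel_power E (k + g + 1) (w - s * f ^ k * G)"
  shows "kernel_power E (g + 1) ((d ^^ k) w - of_nat (fact k) * s * G)"
  using w
proof (induction k arbitrary: w s)
  case (Suc k)
  have "kernel_power E (k + g + 1) (d (w - s * f ^ Suc k * G))"
    using kp_d[OF Suc.prems] by simp
  moreover have "kernel_power E (k + g + 1) (d (s * f ^ Suc k * G) - of_nat (Suc k) * s * f ^ k * G)"
    using d_step[OF f G, of "Suc k" s] by simp
  ultimately have "kernel_power E (k + g + 1) (d (w - s * f ^ Suc k * G)
      + (d (s * f ^ Suc k * G) - of_nat (Suc k) * s * f ^ k * G))"
    by (rule kernel_power.add)
  then have "kernel_power E (k + g + 1) (d w - (of_nat (Suc k) * s) * f ^ k * G)"
    by (simp add: d_diff)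
  from Suc.IH[OF this] show ?case
    by (simp add: funpow_swap1 algebra_simps)
qed simp

lemma d_p_linear:
  assumes "of_nat p = (0::'a)" shows "d (h ^ p * q) = h ^ p * d q"
proof -
  have "d (h ^ k) = of_nat k * h ^ (k - 1) * d h" for k
  proof (induction k)
    case (Suc k)
    then show ?case by (cases k) (auto simp: d_mult d_1 algebra_simps)
  qed (simp add: d_1)
  then show ?thesis by (simp add: d_mult assms)
qed

end


section \<open>Standard smooth algebras are projective over their \<open>p\<close>-th powers\<close>

lemma subring_det:
  assumes S: "is_subring S" and A: "A \<in> carrier_mat r r"
    "\<And>i j. i < r \<Longrightarrow> j < r \<Longrightarrow> A $$ (i, j) \<in> S"
  shows "Determinant.det A \<in> S"
proof -
  have "A $$ (i, q i) \<in> S" if "q permutes {0..<r}" "i < r" for q i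
    using that A permutes_in_image[OF that(1), of i] by auto
  then show ?thesis using A(1) unfolding Determinant.det_def
    by (auto intro!: subring_sum[OF S] subringD(4)[OF S] subring_prod[OF S]
      simp: sign_def subringD[OF S])
qed

text \<open>\<open>C\<close> is the transpose of the inverse matrix, built from the adjugate. Its
  entries remain in \<open>S\<close> because the determinant is a unit of \<open>S\<close>.\<close>

lemma subring_inverse_matrix:
  fixes S :: "'l::field set"
  assumes S: "is_subring S" and A: "A \<in> carrier_mat r r"
      "\<And>i j. i < r \<Longrightarrow> j < r \<Longrightarrow> A $$ (i, j) \<in> S"
    and d: "Determinant.det A \<in> S - nonunits S"
  obtains C where "\<And>i j. i < r \<Longrightarrow> j < r \<Longrightarrow> C i j \<in> S"
    "\<And>i j. i < r \<Longrightarrow> j < r \<Longrightarrow> (\<Sum>l<r. A $$ (j, l) * C i l) = (if i = j then 1 else 0)"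
proof -
  let ?d = "Determinant.det A"
  have d: "?d \<noteq> 0" "inverse ?d \<in> S" using d by (auto simp: nonunits_def)
  define C where "C i l = adj_mat A $$ (l, i) * inverse ?d" for i l
  show ?thesis
  proof (rule that[of C])
    fix i j assume ij: "i < r" "j < r"
    have "mat_delete A i j \<in> carrier_mat (r - 1) (r - 1)"
      by (rule mat_delete_carrier[OF A(1)])
    moreover have "mat_delete A i j $$ (a, b) \<in> S" if "a < r - 1" "b < r - 1" for a b
      using that A by (auto simp: mat_delete_def)
    ultimately have "Determinant.det (mat_delete A i j) \<in> S"
      using subring_det[OF S] by blast
    then have "cofactor A i j \<in> S"
      unfolding cofactor_def
      by (intro subringD(4)[OF S] subring_power[OF S] subringD(5)[OF S subringD(2)[OF S]])
    then have "adj_mat A $$ (j, i) \<in> S" using ij A(1) by (simp add: adj_mat_def)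
    then show "C i j \<in> S" using d by (auto simp: C_def intro: subringD(4)[OF S])
    have "(A * adj_mat A) $$ (j, i) = (\<Sum>l<r. A $$ (j, l) * adj_mat A $$ (l, i))"
      using ij A(1) adj_mat(1)[OF A(1)] by (auto simp: scalar_prod_def lessThan_atLeast0)
    moreover have "(A * adj_mat A) $$ (j, i) = (if i = j then ?d else 0)"
      using ij by (simp add: adj_mat(2)[OF A(1)])
    ultimately show "(\<Sum>l<r. A $$ (j, l) * C i l) = (if i = j then 1 else 0)"
      using d by (auto simp: C_def simp flip: sum_distrib_right mult.assoc)
  qed
qed

locale smooth_presentation =
  fixes \<iota> :: "'k::alg_closed_field \<Rightarrow> 'l::field" and p :: nat and S :: "'l set"
    and n r :: nat and a :: "nat \<Rightarrow> 'l" and f :: "nat \<Rightarrow> 'k mvpoly"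
  assumes hom: "field_hom \<iota>" and p: "CHAR('k) = p" "p > 0"
    and rn: "r \<le> n" and f: "\<And>j. j < r \<Longrightarrow> f j \<in> mvpolys n"
    and S: "mveval \<iota> a ` mvpolys n = S"
    and kernel: "{q\<in>mvpolys n. mveval \<iota> a q = 0} = {\<Sum>j<r. g j * f j | g. \<forall>j<r. g j \<in> mvpolys n}"
    and jacobian: "Determinant.det (Matrix.mat r r (\<lambda>(i, j). mveval \<iota> a (mvderiv j (f i)))) \<in> S - nonunits S"
begin

abbreviation ev where "ev \<equiv> mveval \<iota> a"

lemmas ev_simps = mveval_add[OF hom] mveval_mult[OF hom] mveval_diff[OF hom] mveval_0
  mveval_1[OF hom] mveval_power[OF hom] mveval_sum[OF hom] mveval_uminus[OF hom]

lemma ev_S: "q \<in> mvpolys n \<Longrightarrow> ev q \<in> S"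
  using S by auto

lemma S_const: "\<iota> c \<in> S"
  using ev_S[OF mvpolys_single[of 0 n c]] by (simp add: mveval_single[OF hom])

lemma S_var: "i < n \<Longrightarrow> a i \<in> S"
proof -
  interpret field_hom \<iota> by (rule hom)
  assume "i < n"
  then show ?thesis
    using ev_S[OF mvpolys_single[of "Poly_Mapping.single i 1" n 1]] by (simp add: mveval_single[OF hom])
qed

lemma S_subring: "is_subring S"
  unfolding is_subring_def S[symmetric]
proof (intro conjI ballI)
  show "0 \<in> ev ` mvpolys n" using mvpolys_0 ev_simps by (metis image_eqI)
  show "1 \<in> ev ` mvpolys n" using mvpolys_1 ev_simps by (metis image_eqI)
qed (auto simp flip: ev_simps intro!: imageI mvpolys_add mvpolys_mult mvpolys_uminus)

lemma ev_f: "j < r \<Longrightarrow> ev (f j) = 0"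
proof -
  assume j: "j < r"
  have "f j = (\<Sum>i<r. (if i = j then 1 else 0) * f i)"
    using j by (simp add: if_distrib[of "\<lambda>x. x * _"] cong: if_cong)
  moreover have "\<forall>i<r. (if i = j then 1 else 0) \<in> mvpolys n" by (simp add: mvpolys_0 mvpolys_1)
  ultimately have "f j \<in> {\<Sum>j<r. g j * f j | g. \<forall>j<r. g j \<in> mvpolys n}"
    by (intro CollectI exI[of _ "\<lambda>i. if i = j then 1 else 0"]) auto
  then show ?thesis unfolding kernel[symmetric] by simp
qed

definition lift :: "'l \<Rightarrow> 'k mvpoly" where
  "lift s = (SOME q. q \<in> mvpolys n \<and> ev q = s)"

lemma lift: "s \<in> S \<Longrightarrow> lift s \<in> mvpolys n" "s \<in> S \<Longrightarrow> ev (lift s) = s"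
proof -
  assume "s \<in> S"
  then have "\<exists>q. q \<in> mvpolys n \<and> ev q = s" using S by auto
  from someI_ex[OF this] show "lift s \<in> mvpolys n" "ev (lift s) = s" by (auto simp: lift_def)
qed

definition F where "F = (\<Prod>j<r. f j ^ (p - 1))"

lemma F_mvpolys: "F \<in> mvpolys n"
  unfolding F_def by (intro mvpolys_prod mvpolys_power f) auto

text \<open>Fedder's construction: multiplication by \<open>F\<close> makes \<open>pcomp\<close> descend to the quotient.\<close>

definition \<phi> :: "(nat \<Rightarrow>\<^sub>0 nat) \<Rightarrow> 'l \<Rightarrow> 'l" where
  "\<phi> \<alpha> s = ev (pcomp p \<alpha> (F * lift s))"

text \<open>\<open>F * f j\<close> is divisible by \<open>f j ^ p\<close>, which leaves
  \<open>pcomp\<close> as a factor \<open>f j\<close> and evaluates to zero.\<close>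

lemma pcomp_F_kernel:
  assumes q: "q \<in> mvpolys n" "ev q = 0"
  shows "ev (pcomp p \<alpha> (F * q)) = 0"
proof -
  have "q \<in> {\<Sum>j<r. g j * f j | g. \<forall>j<r. g j \<in> mvpolys n}" using q unfolding kernel[symmetric] by simp
  then obtain g where g: "q = (\<Sum>j<r. g j * f j)" by auto
  have t: "ev (pcomp p \<alpha> (F * (g j * f j))) = 0" if j: "j < r" for j
  proof -
    have "F = f j ^ (p - 1) * (\<Prod>i\<in>{..<r} - {j}. f i ^ (p - 1))"
      unfolding F_def using j by (intro prod.remove) auto
    moreover have "f j ^ p = f j ^ (p - 1) * f j" using p(2) by (cases p) (auto simp: mult.commute)
    ultimately have "F * (g j * f j) = f j ^ p * ((\<Prod>i\<in>{..<r} - {j}. f i ^ (p - 1)) * g j)"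
      by (simp add: mult_ac)
    then show ?thesis by (simp only: pcomp_power_mult[OF p] ev_simps ev_f[OF j] mult_zero_left)
  qed
  have "pcomp p \<alpha> (\<Sum>j\<in>J. h j) = (\<Sum>j\<in>J. pcomp p \<alpha> (h j :: 'k mvpoly))" for h and J :: "nat set"
    by (induction J rule: infinite_finite_induct) (auto simp: pcomp_add[OF p] pcomp_def[of p \<alpha> 0])
  then show ?thesis using t by (simp add: g sum_distrib_left ev_simps)
qed

lemma pcomp_F_cong:
  assumes "q \<in> mvpolys n" "q' \<in> mvpolys n" "ev q = ev q'"
  shows "ev (pcomp p \<alpha> (F * q)) = ev (pcomp p \<alpha> (F * q'))"
proof -
  have "ev (pcomp p \<alpha> (F * (q - q'))) = 0"
    using assms by (intro pcomp_F_kernel mvpolys_diff) (auto simp: ev_simps)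
  moreover have "F * q = F * (q - q') + F * q'" by (simp add: algebra_simps)
  ultimately show ?thesis by (simp add: pcomp_add[OF p] ev_simps)
qed

lemma \<phi>_S: "s \<in> S \<Longrightarrow> \<phi> \<alpha> s \<in> S"
  unfolding \<phi>_def by (intro ev_S mvpolys_pcomp[OF p] mvpolys_mult F_mvpolys lift)

lemma \<phi>_add: "s \<in> S \<Longrightarrow> s' \<in> S \<Longrightarrow> \<phi> \<alpha> (s + s') = \<phi> \<alpha> s + \<phi> \<alpha> s'"
proof -
  assume s: "s \<in> S" "s' \<in> S"
  then have "\<phi> \<alpha> (s + s') = ev (pcomp p \<alpha> (F * (lift s + lift s')))"
    unfolding \<phi>_def
    by (intro pcomp_F_cong mvpolys_add lift) (auto simp: ev_simps lift subringD(3)[OF S_subring])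
  then show ?thesis by (simp add: \<phi>_def distrib_left pcomp_add[OF p] ev_simps)
qed

lemma \<phi>_power_mult: "s \<in> S \<Longrightarrow> s' \<in> S \<Longrightarrow> \<phi> \<alpha> (s ^ p * s') = s * \<phi> \<alpha> s'"
proof -
  assume s: "s \<in> S" "s' \<in> S"
  then have "\<phi> \<alpha> (s ^ p * s') = ev (pcomp p \<alpha> (F * (lift s ^ p * lift s')))"
    unfolding \<phi>_def
    by (intro pcomp_F_cong mvpolys_mult mvpolys_power lift)
      (auto simp: ev_simps lift subringD(4)[OF S_subring] subring_power[OF S_subring])
  also have "F * (lift s ^ p * lift s') = lift s ^ p * (F * lift s')" by (simp add: mult_ac)
  finally show ?thesis using s by (simp add: \<phi>_def pcomp_power_mult[OF p] ev_simps lift)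
qed

text \<open>Combine the partial derivatives in the first \<open>r\<close> variables with the columns
  of the inverse Jacobian. Its entries are elements of \<open>S\<close> and have to be lifted, so
  duality holds only after evaluation.\<close>

lemma dual_derivations:
  obtains \<delta> :: "nat \<Rightarrow> 'k mvpoly \<Rightarrow> 'k mvpoly" where
    "\<And>i. i < r \<Longrightarrow> ring_map_derivation ev (\<delta> i)"
    "\<And>i j. i < r \<Longrightarrow> j < r \<Longrightarrow> ev (\<delta> i (f j)) = (if i = j then 1 else 0)"
    "\<And>i q. i < r \<Longrightarrow> q \<in> mvpolys n \<Longrightarrow> \<delta> i q \<in> mvpolys n"
proof -
  let ?A = "Matrix.mat r r (\<lambda>(i, j). ev (mvderiv j (f i)))"
  have "?A $$ (i, j) \<in> S" if "i < r" "j < r" for i j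
    using that by (auto intro!: ev_S mvpolys_mvderiv f)
  then have A: "?A \<in> carrier_mat r r" "\<And>i j. i < r \<Longrightarrow> j < r \<Longrightarrow> ?A $$ (i, j) \<in> S" by simp_all
  obtain C where C: "\<And>i j. i < r \<Longrightarrow> j < r \<Longrightarrow> C i j \<in> S"
    "\<And>i j. i < r \<Longrightarrow> j < r \<Longrightarrow> (\<Sum>l<r. ?A $$ (j, l) * C i l) = (if i = j then 1 else 0)"
    using subring_inverse_matrix[OF S_subring A jacobian] by blast
  define \<delta> where "\<delta> i q = (\<Sum>l<r. lift (C i l) * mvderiv l q)" for i q
  show ?thesis
  proof (rule that[of \<delta>])
    fix i assume i: "i < r"
    show "ring_map_derivation ev (\<delta> i)"
      by unfold_locales
        (auto simp: ev_simps \<delta>_def mvderiv_add mvderiv_mult sum.distrib sum_distrib_left algebra_simps)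
    show "\<delta> i q \<in> mvpolys n" if "q \<in> mvpolys n" for q
      unfolding \<delta>_def by (intro mvpolys_sum mvpolys_mult lift C mvpolys_mvderiv that i) auto
    fix j assume j: "j < r"
    have "ev (\<delta> i (f j)) = (\<Sum>l<r. ?A $$ (j, l) * C i l)"
      unfolding \<delta>_def using i j by (auto simp: ev_simps lift C mult.commute intro!: sum.cong)
    then show "ev (\<delta> i (f j)) = (if i = j then 1 else 0)" using C(2) i j by simp
  qed
qed

text \<open>\<open>D\<close> is the composite of the (p-1)-st powers of the dual derivations. Each
  of them turns one factor \<open>f i ^ (p - 1)\<close> of \<open>F\<close> into (p-1)!, and all of
  them commute with multiplication by p-th powers.\<close>

lemma reconstruction_operator:
  obtains D :: "'k mvpoly \<Rightarrow> 'k mvpoly" where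
    "\<And>q q'. D (q + q') = D q + D q'" "\<And>h q. D (h ^ p * q) = h ^ p * D q"
    "\<And>q. q \<in> mvpolys n \<Longrightarrow> D q \<in> mvpolys n"
    "\<And>q. ev (D (F * q)) = of_nat (fact (p - 1)) ^ r * ev q"
proof -
  obtain \<delta> :: "nat \<Rightarrow> 'k mvpoly \<Rightarrow> 'k mvpoly" where \<delta>: "\<And>i. i < r \<Longrightarrow> ring_map_derivation ev (\<delta> i)"
    "\<And>i j. i < r \<Longrightarrow> j < r \<Longrightarrow> ev (\<delta> i (f j)) = (if i = j then 1 else 0)"
    "\<And>i q. i < r \<Longrightarrow> q \<in> mvpolys n \<Longrightarrow> \<delta> i q \<in> mvpolys n"
    using dual_derivations by metis
  define D where "D = rec_nat (\<lambda>q. q) (\<lambda>i G q. (\<delta> i ^^ (p - 1)) (G q))"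
  have D: "D 0 q = q" "D (Suc i) q = (\<delta> i ^^ (p - 1)) (D i q)" for i q by (simp_all add: D_def)
  have p0: "of_nat p = (0 :: 'k mvpoly)" using CHAR_mvpoly[where 'k='k] p(1) of_nat_CHAR by metis
  have add: "D i (q + q') = D i q + D i q'" if "i \<le> r" for i q q'
    using that
  proof (induction i)
    case (Suc i)
    interpret ring_map_derivation ev "\<delta> i" using \<delta> Suc by auto
    have "(\<delta> i ^^ k) (q + q') = (\<delta> i ^^ k) q + (\<delta> i ^^ k) q'" for k q q'
      by (induction k) (auto simp: d_add)
    then show ?case using Suc by (simp add: D)
  qed (simp add: D)
  have lin: "D i (h ^ p * q) = h ^ p * D i q" if "i \<le> r" for i h q
    using that
  proof (induction i)
    case (Suc i)
    interpret ring_map_derivation ev "\<delta> i" using \<delta> Suc by auto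
    have "(\<delta> i ^^ k) (h ^ p * q) = h ^ p * (\<delta> i ^^ k) q" for k q
      by (induction k) (auto simp: d_p_linear[OF p0])
    then show ?case using Suc by (simp add: D)
  qed (simp add: D)
  have mv: "D i q \<in> mvpolys n" if "i \<le> r" "q \<in> mvpolys n" for i q
    using that
  proof (induction i)
    case (Suc i)
    have "(\<delta> i ^^ k) q \<in> mvpolys n" if "q \<in> mvpolys n" for k q
      using that Suc by (induction k) (auto simp: \<delta>)
    then show ?case using Suc by (simp add: D)
  qed (simp add: D)
  \<comment> \<open>The error always has order one more than the product of the factors still
    present. At \<open>i = r\<close> the product is empty and the error lies in the kernel.\<close>
  have main: "kernel_power ev ((r - i) * (p - 1) + 1)
      (D i (F * q) - of_nat (fact (p - 1)) ^ i * q * (\<Prod>j\<in>{i..<r}. f j ^ (p - 1)))" if "i \<le> r" for i q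
    using that
  proof (induction i)
    case 0
    have "kernel_power ev m 0" for m
      by (induction m) (use kernel_power.step[of ev _ 0 0] in \<open>auto intro: kernel_power.zero simp: ev_simps\<close>)
    then show ?case by (simp add: D F_def lessThan_atLeast0 mult.commute)
  next
    case (Suc i)
    interpret ring_map_derivation ev "\<delta> i" using \<delta> Suc by auto
    let ?G = "\<Prod>j\<in>{Suc i..<r}. f j ^ (p - 1)" and ?g = "(r - Suc i) * (p - 1)"
    have e: "(\<Prod>j\<in>{i..<r}. f j ^ (p - 1)) = f i ^ (p - 1) * ?G" "(r - i) * (p - 1) = (p - 1) + ?g"
      using Suc.prems by (simp_all add: prod.atLeast_Suc_lessThan Suc_diff_Suc flip: mult_Suc)
    have G: "kernel_power ev ?g ?G"
      using prod_kp[of "{Suc i..<r}" f "p - 1"] by (simp add: ev_f)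
    have dG: "kernel_power ev ?g (\<delta> i ?G)"
      using d_prod_kp[of "{Suc i..<r}" f "p - 1"] Suc.prems by (simp add: ev_f \<delta>)
    have "kernel_power ev (p - 1 + ?g + 1) (D i (F * q) - (of_nat (fact (p - 1)) ^ i * q) * f i ^ (p - 1) * ?G)"
      using Suc e by (simp add: mult.assoc)
    from d_iterate[OF _ _ G dG this] Suc.prems show ?case
      by (simp add: D ev_f \<delta> mult.assoc)
  qed
  have "ev (of_nat m) = of_nat m" for m by (induction m) (auto simp: ev_simps)
  moreover have "ev (D r (F * q) - of_nat (fact (p - 1)) ^ r * q) = 0" for q
  \<comment> \<open>For \<open>r = 0\<close> there is no derivation with which to enter the locale,
    but then \<open>F = 1\<close> and \<open>D 0\<close> is the identity.\<close>
  proof (cases "r = 0")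
    case True
    then have F1: "F = 1" unfolding F_def by simp
    show ?thesis unfolding F1 using True by (simp add: D mveval_0)
  next
    case False
    then interpret ring_map_derivation ev "\<delta> 0" using \<delta> by auto
    show ?thesis using kp_Suc_E[OF main[of r q]] by simp
  qed
  ultimately have "ev (D r (F * q)) = of_nat (fact (p - 1)) ^ r * ev q" for q
    by (simp add: ev_simps)
  then show ?thesis using that[of "D r"] add lin mv by auto
qed

text \<open>Decompose \<open>F * lift s\<close> over p-th powers, apply \<open>D\<close>, which
  passes through the p-th powers, and evaluate. The result is \<open>c * s\<close> with c a power of
  (p-1)!, nonzero in characteristic p and the image of a constant, so its inverse is in
  \<open>S\<close>.\<close>

theorem frobenius_basis:
  obtains e where "\<And>\<alpha>. \<alpha> \<in> exponents_below p n \<Longrightarrow> e \<alpha> \<in> S"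
    "\<And>s. s \<in> S \<Longrightarrow> s = (\<Sum>\<alpha>\<in>exponents_below p n. \<phi> \<alpha> s ^ p * e \<alpha>)"
proof -
  interpret h: field_hom \<iota> by (rule hom)
  obtain D :: "'k mvpoly \<Rightarrow> 'k mvpoly" where D: "\<And>q q'. D (q + q') = D q + D q'" "\<And>h q. D (h ^ p * q) = h ^ p * D q"
    "\<And>q. q \<in> mvpolys n \<Longrightarrow> D q \<in> mvpolys n"
    "\<And>q. ev (D (F * q)) = of_nat (fact (p - 1)) ^ r * ev q"
    using reconstruction_operator by metis
  have D0: "D 0 = 0" using D(1)[of 0 0] by (metis add_cancel_right_right)
  have Ds: "D (sum h A) = (\<Sum>x\<in>A. D (h x))" for h and A :: "(nat \<Rightarrow>\<^sub>0 nat) set"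
    by (induction A rule: infinite_finite_induct) (auto simp: D D0)
  define c :: 'l where "c = of_nat (fact (p - 1)) ^ r"
  have \<iota>n: "\<iota> (of_nat m) = of_nat m" for m by (induction m) (auto simp: h.hom_add)
  have c\<iota>: "c = \<iota> (of_nat (fact (p - 1)) ^ r)"
    unfolding c_def by (simp only: h.hom_power \<iota>n of_nat_fact)
  have "\<not> p dvd fact (p - 1)"
    using prime_dvd_fact_iff[of p "p - 1"] prime_p[OF p] p(2) by auto
  then have "(of_nat (fact (p - 1)) :: 'k) \<noteq> 0" using p(1) by (simp add: of_nat_eq_0_iff_char_dvd del: of_nat_fact)
  then have k0: "(of_nat (fact (p - 1)) :: 'k) ^ r \<noteq> 0" by simp
  have ci: "c * \<iota> (inverse (of_nat (fact (p - 1)) ^ r)) = 1"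
    unfolding c\<iota> h.hom_mult[symmetric] using k0 by (simp del: of_nat_fact)
  then have c0: "c \<noteq> 0" by auto
  then have "inverse c = \<iota> (inverse (of_nat (fact (p - 1)) ^ r))"
    using ci by (metis inverse_unique)
  then have cS: "inverse c \<in> S" using S_const by metis
  define e where "e \<alpha> = inverse c * ev (D (Poly_Mapping.single \<alpha> 1))" for \<alpha>
  show ?thesis
  proof (rule that[of e])
    show "e \<alpha> \<in> S" if "\<alpha> \<in> exponents_below p n" for \<alpha>
      unfolding e_def using that
      by (intro subringD(4)[OF S_subring] cS ev_S D mvpolys_single) (auto simp: exponents_below_def)
    fix s assume s: "s \<in> S"
    have "F * lift s = (\<Sum>\<alpha>\<in>exponents_below p n. pcomp p \<alpha> (F * lift s) ^ p * Poly_Mapping.single \<alpha> 1)"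
      by (rule pcomp_decomposition[OF p]) (intro mvpolys_mult F_mvpolys lift s)
    then have "ev (D (F * lift s))
        = ev (D (\<Sum>\<alpha>\<in>exponents_below p n. pcomp p \<alpha> (F * lift s) ^ p * Poly_Mapping.single \<alpha> 1))"
      by (rule arg_cong)
    also have "\<dots> = (\<Sum>\<alpha>\<in>exponents_below p n. \<phi> \<alpha> s ^ p * ev (D (Poly_Mapping.single \<alpha> 1)))"
      by (simp only: Ds D(2) ev_simps \<phi>_def)
    finally have "ev (D (F * lift s)) = (\<Sum>\<alpha>\<in>exponents_below p n. \<phi> \<alpha> s ^ p * ev (D (Poly_Mapping.single \<alpha> 1)))" .
    then have "c * s = (\<Sum>\<alpha>\<in>exponents_below p n. \<phi> \<alpha> s ^ p * ev (D (Poly_Mapping.single \<alpha> 1)))"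
      using s by (simp add: D(4) lift c_def)
    then have "inverse c * (c * s) = (\<Sum>\<alpha>\<in>exponents_below p n. \<phi> \<alpha> s ^ p * e \<alpha>)"
      by (simp add: sum_distrib_left e_def mult_ac)
    then show "s = (\<Sum>\<alpha>\<in>exponents_below p n. \<phi> \<alpha> s ^ p * e \<alpha>)"
      using c0 by (simp flip: mult.assoc)
  qed
qed

text \<open>\<open>S\<close> arises from the image of the base field by adjoining
  \<open>a 0\<close>, ..., \<open>a (n-1)\<close> one at a time.\<close>

lemma S_noetherian: "noetherian S"
proof -
  interpret h: field_hom \<iota> by (rule hom)
  define A where "A = rec_nat (range \<iota>) (\<lambda>i B. adjoin B (a i))"
  have A: "A 0 = range \<iota>" "A (Suc i) = adjoin (A i) (a i)" for i by (simp_all add: A_def)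
  have r: "is_subring (range \<iota>)" unfolding is_subring_def
  proof (intro conjI ballI)
    show "0 \<in> range \<iota>" by (metis h.hom_zero rangeI)
    show "1 \<in> range \<iota>" by (metis h.hom_one rangeI)
  qed (auto simp flip: h.hom_add h.hom_mult h.hom_uminus)
  have N: "noetherian (A i)" for i
  proof (induction i)
    case 0
    show ?case unfolding A
      by (rule noetherian_subfield[OF r]) (auto simp flip: h.hom_inverse)
  qed (simp add: A noetherian_adjoin)
  then have sub: "is_subring (A i)" for i using noetherianD(1) by blast
  have "A i \<subseteq> S" if "i \<le> n" for i
    using that
  proof (induction i)
    case (Suc i)
    then show ?case unfolding A
      by (intro adjoin_least S_subring) (auto simp: S_var)
  qed (auto simp: A S_const)
  moreover have "S \<subseteq> A n"
  proof
    have step: "A i \<subseteq> A (Suc i)" for i unfolding A by (rule adjoin_superset[OF sub])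
    have mono: "A i \<subseteq> A j" if "i \<le> j" for i j
      using lift_Suc_mono_le[of A, OF step that] .
    have var: "a i \<in> A n" if "i < n" for i
    proof -
      have "a i \<in> A (Suc i)" unfolding A by (rule adjoin_superset[OF sub])
      then show ?thesis using mono[of "Suc i" n] that by auto
    qed
    have const: "\<iota> c \<in> A n" for c using mono[of 0 n] by (auto simp: A)
    fix s assume "s \<in> S"
    then obtain q where "q \<in> mvpolys n" "s = ev q" using S by auto
    then show "s \<in> A n" unfolding mveval_def
      by (auto intro!: subring_sum[OF sub] subringD(4)[OF sub] subring_prod[OF sub] subring_power[OF sub]
        const var simp: mvpolys_def subset_eq)
  qed
  ultimately show ?thesis using N[of n] by (metis subset_antisym order_refl)
qed

end

section \<open>Extending \<open>p\<^sup>-\<^sup>e\<close>-linear maps to the fraction field\<close>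

lemma p_linearD:
  assumes "p_linear p e \<psi>"
  shows "\<psi> (f + g) = \<psi> f + \<psi> g" "\<psi> (f ^ (p ^ e) * g) = f * \<psi> g" "\<psi> 0 = 0"
    "\<psi> (sum h K) = (\<Sum>i\<in>K. \<psi> (h i))"
proof -
  show a: "\<psi> (f + g) = \<psi> f + \<psi> g" for f g using assms by (auto simp: p_linear_def)
  show "\<psi> (f ^ (p ^ e) * g) = f * \<psi> g" using assms by (auto simp: p_linear_def)
  show z: "\<psi> 0 = 0" using a[of 0 0] by (metis add_cancel_right_right)
  show "\<psi> (sum h K) = (\<Sum>i\<in>K. \<psi> (h i))"
    by (induction K rule: infinite_finite_induct) (auto simp: a z)
qed

lemma p_linear_comp:
  fixes \<phi> \<psi> :: "'l::field \<Rightarrow> 'l"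
  assumes "p_linear p d \<phi>" "p_linear p e \<psi>"
  shows "p_linear p (e + d) (\<lambda>z. \<phi> (\<psi> z))"
  unfolding p_linear_def
proof (intro conjI allI)
  fix f g :: 'l
  have "f ^ p ^ (e + d) = (f ^ p ^ d) ^ p ^ e"
    unfolding power_add power_mult[symmetric] by (simp add: mult.commute)
  then show "\<phi> (\<psi> (f ^ p ^ (e + d) * g)) = f * \<phi> (\<psi> g)"
    using assms by (simp add: p_linearD(2))
qed (simp add: p_linearD[OF assms(1)] p_linearD[OF assms(2)])

lemma p_linear_scale:
  assumes "p_linear p e \<psi>" shows "p_linear p e (\<lambda>z. b * \<psi> z)"
  using assms by (auto simp: p_linear_def algebra_simps)

lemma p_linear_funpow:
  assumes "p_linear p e \<psi>" shows "p_linear p (e * n) (\<psi> ^^ n)"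
proof (induction n)
  case (Suc n)
  then show ?case using p_linear_comp[OF assms Suc] by (simp add: comp_def add.commute)
qed (simp add: p_linear_def)

text \<open>Rewriting a / b with denominator b^(p^e) makes the denominator a p^e-th power, which
  leaves \<open>\<psi>\<close> as b.\<close>

lemma p_linear_localization:
  assumes S: "is_subring S" and \<psi>: "p_linear p e \<psi>" "\<psi> ` S \<subseteq> S" and p: "p > 0" and P: "P \<in> Spec S"
  shows "\<psi> ` localization S P \<subseteq> localization S P"
proof (rule image_subsetI)
  fix z assume "z \<in> localization S P"
  then obtain a b where z: "z = a / b" "a \<in> S" "b \<in> S" "b \<notin> P" by (auto simp: localization_def)
  have b0: "b \<noteq> 0" using z(4) idealD(2)[OF SpecD(1)[OF P]] by auto
  have "p ^ e = Suc (p ^ e - 1)" using p by simp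
  then have "b ^ p ^ e = b * b ^ (p ^ e - 1)" by (metis power_Suc)
  then have "z = (1 / b) ^ p ^ e * (a * b ^ (p ^ e - 1))" using b0 z by (simp add: power_one_over field_simps)
  then have "\<psi> z = \<psi> (a * b ^ (p ^ e - 1)) / b" using \<psi> by (simp add: p_linearD(2))
  moreover have "a * b ^ (p ^ e - 1) \<in> S"
    using z by (intro subringD(4)[OF S] subring_power[OF S])
  then have "\<psi> (a * b ^ (p ^ e - 1)) \<in> S" using \<psi>(2) by blast
  ultimately show "\<psi> z \<in> localization S P" using z(3,4) unfolding localization_def by blast
qed

text \<open>Linearity forces the value \<phi>(a b^(q-1)) / b at a / b. Fractions are chosen
  arbitrarily, and \<open>key\<close> shows that the value does not depend on the choice.\<close>

lemma extend_p_linear: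
  fixes S :: "'l::field set"
  assumes S: "is_subring S" and frac: "\<And>z. \<exists>a\<in>S. \<exists>b\<in>S. b \<noteq> 0 \<and> z = a / b"
    and add: "\<And>s t. s \<in> S \<Longrightarrow> t \<in> S \<Longrightarrow> \<phi> (s + t) = \<phi> s + \<phi> t"
    and lin: "\<And>s t. s \<in> S \<Longrightarrow> t \<in> S \<Longrightarrow> \<phi> (s ^ q * t) = s * \<phi> t"
    and q: "q = p ^ e" "p > 0"
  obtains \<psi> where "p_linear p e \<psi>" "\<And>s. s \<in> S \<Longrightarrow> \<psi> s = \<phi> s"
proof -
  obtain k where k: "q = Suc k" using q by (metis gr0_implies_Suc zero_less_power)
  obtain num den where nd: "num z \<in> S" "den z \<in> S" "den z \<noteq> 0" "z = num z / den z" for z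
    using frac by metis
  define \<psi> where "\<psi> z = \<phi> (num z * den z ^ k) / den z" for z
  have cl: "a * b ^ k \<in> S" if "a \<in> S" "b \<in> S" for a b
    using that by (intro subringD(4)[OF S] subring_power[OF S])
  have key: "\<psi> z = \<phi> (a * b ^ k) / b" if ab: "a \<in> S" "b \<in> S" "b \<noteq> 0" "z = a / b" for z a b
  proof -
    let ?c = "num z" and ?d = "den z"
    have e: "?c * b = a * ?d" using nd(3,4)[of z] ab by (metis nonzero_eq_divide_eq nonzero_divide_eq_eq mult.commute times_divide_eq_left)
    have "b ^ q * (?c * ?d ^ k) = ?d ^ k * b ^ k * (?c * b)" by (simp add: k mult_ac)
    also have "\<dots> = ?d ^ q * (a * b ^ k)" unfolding e by (simp add: k mult_ac)
    finally have "\<phi> (b ^ q * (?c * ?d ^ k)) = \<phi> (?d ^ q * (a * b ^ k))" by simp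
    then have "b * \<phi> (?c * ?d ^ k) = ?d * \<phi> (a * b ^ k)"
      using ab nd cl by (simp add: lin)
    then show ?thesis using nd(3)[of z] ab(3) by (simp add: \<psi>_def field_simps)
  qed
  show ?thesis
  proof (rule that[of \<psi>])
    show "p_linear p e \<psi>" unfolding p_linear_def
    proof (intro conjI allI)
      fix f g
      obtain a b c d where ab: "a \<in> S" "b \<in> S" "b \<noteq> 0" "f = a / b"
        and cd: "c \<in> S" "d \<in> S" "d \<noteq> 0" "g = c / d" using frac by metis
      have m: "x * y \<in> S" if "x \<in> S" "y \<in> S" for x y using that by (rule subringD(4)[OF S])
      have "\<psi> f = \<phi> ((a * d) * (b * d) ^ k) / (b * d)" "\<psi> g = \<phi> ((c * b) * (b * d) ^ k) / (b * d)"
        using ab cd m by (intro key; simp)+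
      moreover have "\<psi> (f + g) = \<phi> ((a * d + c * b) * (b * d) ^ k) / (b * d)"
        using ab cd m subringD(3)[OF S] by (intro key) (auto simp: field_simps)
      moreover have "\<phi> ((a * d + c * b) * (b * d) ^ k) = \<phi> ((a * d) * (b * d) ^ k) + \<phi> ((c * b) * (b * d) ^ k)"
        unfolding distrib_right by (rule add) (use ab cd m cl in auto)
      ultimately show "\<psi> (f + g) = \<psi> f + \<psi> g" by (simp add: add_divide_distrib)
      have p: "x ^ j \<in> S" if "x \<in> S" for x j using that by (rule subring_power[OF S])
      have "\<psi> (f ^ q * g) = \<phi> ((a ^ q * c) * (b ^ q * d) ^ k) / (b ^ q * d)"
        using ab cd m p by (intro key) (auto simp: field_simps)
      also have "(a ^ q * c) * (b ^ q * d) ^ k = (a * b ^ k) ^ q * (c * d ^ k)"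
        by (simp add: power_mult_distrib mult_ac flip: power_mult)
      also have "\<phi> \<dots> = a * b ^ k * \<phi> (c * d ^ k)" using ab cd cl by (intro lin)
      also have "a * b ^ k * \<phi> (c * d ^ k) / (b ^ q * d) = f * (\<phi> (c * d ^ k) / d)"
        using ab cd by (simp add: k)
      also have "\<phi> (c * d ^ k) / d = \<psi> g" using key[OF cd] by simp
      finally show "\<psi> (f ^ p ^ e * g) = f * \<psi> g" by (simp add: q)
    qed
    show "\<psi> s = \<phi> s" if "s \<in> S" for s
      using key[of s 1 s] that subringD(2)[OF S] by simp
  qed
qed

text \<open>The assumption \<open>basis\<close> says that the \<open>b i\<close> and the maps s ->
  \<phi>_i(s)^p form a dual basis of \<open>S\<close> over its subring of p-th powers, so
  \<open>S\<close> is a finite projective module over it.\<close>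

locale frobenius_projective =
  fixes p :: nat and S :: "'l::field set" and A :: "'i set" and \<phi> :: "'i \<Rightarrow> 'l \<Rightarrow> 'l" and b :: "'i \<Rightarrow> 'l"
  assumes char: "CHAR('l) = p" "p > 0" and noeth: "noetherian S"
    and frac: "\<And>z. \<exists>a\<in>S. \<exists>b\<in>S. b \<noteq> 0 \<and> z = a / b"
    and A: "finite A" and \<phi>: "\<And>i. i \<in> A \<Longrightarrow> p_linear p 1 (\<phi> i)" "\<And>i. i \<in> A \<Longrightarrow> \<phi> i ` S \<subseteq> S"
    and b: "\<And>i. i \<in> A \<Longrightarrow> b i \<in> S"
    and basis: "\<And>s. s \<in> S \<Longrightarrow> s = (\<Sum>i\<in>A. \<phi> i s ^ p * b i)"
begin

lemma S_subring: "is_subring S"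
  using noeth by (rule noetherianD)

lemma p_ge_2: "p \<ge> 2"
  using prime_CHAR_field[where 'k='l] char prime_ge_2_nat by auto

text \<open>
  The ideal generated by all \<open>\<psi> q\<close> is contained in its square, since it is stable under the
  maps \<open>\<phi> i\<close> and \<open>\<phi> i x\<close> occurs with exponent \<open>p \<ge> 2\<close> in \<open>basis\<close>.
\<close>

lemma cartier_images_generate:
  assumes q: "q \<in> S" "q \<noteq> 0"
  shows "1 \<in> ideal_gen S {\<psi> q | \<psi> e. e \<ge> 1 \<and> p_linear p e \<psi> \<and> \<psi> ` S \<subseteq> S}"
    (is "1 \<in> ideal_gen S ?G")
proof -
  have G: "?G \<subseteq> S" using q by auto
  let ?b = "ideal_gen S ?G"
  have bI: "is_ideal S ?b" by (rule ideal_gen_ideal[OF S_subring G])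
  have stable: "\<phi> i x \<in> ?b" if x: "x \<in> ?b" and i: "i \<in> A" for x i
  proof -
    \<comment> \<open>\<open>\<phi> i\<close> is not \<open>S\<close>-linear. Quantifying over all
      multiples of \<open>x\<close> is what makes this set an ideal.\<close>
    let ?I = "{x \<in> S. \<forall>r\<in>S. \<phi> i (r * x) \<in> ?b}"
    have "is_ideal S ?I" unfolding is_ideal_def
    proof (intro conjI ballI)
      show "0 \<in> ?I" using subringD(1)[OF S_subring] idealD(2)[OF bI] p_linearD(3)[OF \<phi>(1)[OF i]] by simp
      fix u assume u: "u \<in> ?I"
      show "u + w \<in> ?I" if "w \<in> ?I" for w
        using u that subringD(3)[OF S_subring] idealD(3)[OF bI] p_linearD(1)[OF \<phi>(1)[OF i]]
        by (simp add: distrib_left)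
      show "r * u \<in> ?I" if "r \<in> S" for r
        using u that subringD(4)[OF S_subring] by (simp flip: mult.assoc)
    qed auto
    moreover have "?G \<subseteq> ?I"
    proof safe
      fix \<psi> e assume \<psi>: "1 \<le> e" "p_linear p e \<psi>" "\<psi> ` S \<subseteq> S"
      show "\<psi> q \<in> S" using \<psi> q by auto
      fix r assume r: "r \<in> S"
      have "p_linear p (e + 1) (\<lambda>z. \<phi> i (r * \<psi> z))"
        by (rule p_linear_comp[OF \<phi>(1)[OF i] p_linear_scale[OF \<psi>(2)]])
      moreover have "(\<lambda>z. \<phi> i (r * \<psi> z)) ` S \<subseteq> S"
        using \<psi>(3) r \<phi>(2)[OF i] subringD(4)[OF S_subring] by (auto simp: image_subset_iff)
      ultimately have "\<phi> i (r * \<psi> q) \<in> ?G"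
        by (intro CollectI exI[of _ "\<lambda>z. \<phi> i (r * \<psi> z)"] exI[of _ "e + 1"]) auto
      then show "\<phi> i (r * \<psi> q) \<in> ?b" by (rule subsetD[OF ideal_gen_superset])
    qed
    ultimately have "x \<in> ?I" using ideal_gen_least x by blast
    then show ?thesis using subringD(2)[OF S_subring] by force
  qed
  \<comment> \<open>The ideal is nonzero; without this an idempotent ideal could be zero.\<close>
  have "\<exists>i\<in>A. \<phi> i q \<noteq> 0"
  proof (rule ccontr)
    assume "\<not> ?thesis"
    then have "(\<Sum>i\<in>A. \<phi> i q ^ p * b i) = 0" using char by (intro sum.neutral) simp
    then show False using basis[OF q(1)] q(2) by simp
  qed
  then obtain i where i: "i \<in> A" "\<phi> i q \<noteq> 0" by blast
  have "\<phi> i q \<in> ?G" using \<phi>[OF i(1)] by blast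
  then have ib: "\<phi> i q \<in> ?b" by (rule subsetD[OF ideal_gen_superset])
  let ?Q = "{y * z | y z. y \<in> ?b \<and> z \<in> ?b}"
  have bS: "?b \<subseteq> S" by (rule idealD(1)[OF bI])
  have QS: "?Q \<subseteq> S" using bS subringD(4)[OF S_subring] by blast
  have "x \<in> ideal_gen S ?Q" if x: "x \<in> ?b" for x
  proof -
    have QI: "is_ideal S (ideal_gen S ?Q)" by (rule ideal_gen_ideal[OF S_subring QS])
    have "x = (\<Sum>i\<in>A. \<phi> i x ^ p * b i)" using basis bS x by blast
    also have "\<dots> \<in> ideal_gen S ?Q"
    proof (rule ideal_sum[OF QI])
      fix i assume i: "i \<in> A"
      have "\<phi> i x * \<phi> i x \<in> ?Q" using stable[OF x i] by blast
      then have "\<phi> i x * \<phi> i x \<in> ideal_gen S ?Q" by (rule subsetD[OF ideal_gen_superset])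
      moreover have "\<phi> i x ^ (p - 2) * b i \<in> S"
        using stable[OF x i] bS by (intro subringD(4)[OF S_subring] subring_power[OF S_subring] b i) auto
      ultimately have "(\<phi> i x * \<phi> i x) * (\<phi> i x ^ (p - 2) * b i) \<in> ideal_gen S ?Q"
        by (rule idealD(5)[OF QI, rotated])
      moreover have "\<phi> i x ^ p = \<phi> i x * \<phi> i x * \<phi> i x ^ (p - 2)"
        using p_ge_2 by (metis le_add_diff_inverse power2_eq_square power_add)
      ultimately show "\<phi> i x ^ p * b i \<in> ideal_gen S ?Q" by (simp add: mult.assoc)
    qed
    finally show ?thesis .
  qed
  from idempotent_ideal[OF noeth bI this ib i(2)] show ?thesis .
qed

text \<open>\<open>S\<close> is finite over its p^e-th powers, so the values of a p^-e-linear map on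
  \<open>S\<close> lie in the \<open>S\<close>-module spanned by its values on finitely many
  elements. These depend on \<open>e\<close> only, not on the map.\<close>

lemma p_linear_image_bound:
  obtains G where "finite G" "G \<subseteq> S"
    "\<And>\<theta> M. p_linear p e \<theta> \<Longrightarrow> \<theta> ` G \<subseteq> M \<Longrightarrow> 0 \<in> M \<Longrightarrow> (\<And>x y. x \<in> M \<Longrightarrow> y \<in> M \<Longrightarrow> x + y \<in> M) \<Longrightarrow>
      (\<And>s x. s \<in> S \<Longrightarrow> x \<in> M \<Longrightarrow> s * x \<in> M) \<Longrightarrow> \<theta> ` S \<subseteq> M"
proof -
  define gen where "gen e G \<longleftrightarrow> (\<forall>\<theta> M. p_linear p e \<theta> \<longrightarrow> \<theta> ` G \<subseteq> M \<longrightarrow> 0 \<in> M \<longrightarrow>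
      (\<forall>x y. x \<in> M \<longrightarrow> y \<in> M \<longrightarrow> x + y \<in> M) \<longrightarrow>
      (\<forall>s x. s \<in> S \<longrightarrow> x \<in> M \<longrightarrow> s * x \<in> M) \<longrightarrow> \<theta> ` S \<subseteq> M)" for e G
  have "\<exists>G. finite G \<and> G \<subseteq> S \<and> gen e G"
  proof (induction e)
    case 0
    have "gen 0 {1}" unfolding gen_def
    proof (intro allI impI image_subsetI)
      fix \<theta> M s assume "p_linear p 0 \<theta>" "\<theta> ` {1} \<subseteq> M" "\<forall>s x. s \<in> S \<longrightarrow> x \<in> M \<longrightarrow> s * x \<in> M" "s \<in> S"
      then show "\<theta> s \<in> M" using p_linearD(2)[of p 0 \<theta> s 1] by simp
    qed
    then show ?case using subringD(2)[OF S_subring] by (intro exI[of _ "{1}"]) auto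
  next
    case (Suc e)
    then obtain G where G: "finite G" "G \<subseteq> S" "gen e G" by blast
    let ?H = "(\<lambda>(g, i). g ^ p * b i) ` (G \<times> A)"
    have "gen (Suc e) ?H" unfolding gen_def
    proof (intro allI impI image_subsetI)
      fix \<theta> M s assume \<theta>: "p_linear p (Suc e) \<theta>" "\<theta> ` ?H \<subseteq> M" and
        M: "0 \<in> M" "\<forall>x y. x \<in> M \<longrightarrow> y \<in> M \<longrightarrow> x + y \<in> M" "\<forall>s x. s \<in> S \<longrightarrow> x \<in> M \<longrightarrow> s * x \<in> M"
        and s: "s \<in> S"
      have sum: "sum h K \<in> M" if "\<And>i. i \<in> K \<Longrightarrow> h i \<in> M" for h and K :: "'i set"
        using that M by (induction K rule: infinite_finite_induct) auto
      have t: "(\<lambda>t. \<theta> (t ^ p * b i)) ` S \<subseteq> M" if i: "i \<in> A" for i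
      proof -
        \<comment> \<open>Precomposing with t -> t^p b_i turns a p^-(e+1)-linear map into a
          p^-e-linear one, to which the induction hypothesis applies.\<close>
        have "p_linear p e (\<lambda>t. \<theta> (t ^ p * b i))" unfolding p_linear_def
        proof (intro conjI allI)
          fix f g :: 'l
          have "(f + g) ^ p = f ^ p + g ^ p"
            using char prime_CHAR_field[where 'k='l] by (intro freshmans_dream) auto
          then show "\<theta> ((f + g) ^ p * b i) = \<theta> (f ^ p * b i) + \<theta> (g ^ p * b i)"
            by (simp add: distrib_right p_linearD(1)[OF \<theta>(1)])
          have "(f ^ p ^ e * g) ^ p * b i = f ^ p ^ Suc e * (g ^ p * b i)"
            by (simp add: power_mult_distrib mult_ac flip: power_mult)
          then show "\<theta> ((f ^ p ^ e * g) ^ p * b i) = f * \<theta> (g ^ p * b i)"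
            by (simp only: p_linearD(2)[OF \<theta>(1)])
        qed
        moreover have "(\<lambda>t. \<theta> (t ^ p * b i)) ` G \<subseteq> M" using \<theta>(2) i by auto
        ultimately show ?thesis using G(3) M unfolding gen_def by blast
      qed
      have "\<theta> s = (\<Sum>i\<in>A. \<theta> (\<phi> i s ^ p * b i))"
        by (subst basis[OF s]) (rule p_linearD(4)[OF \<theta>(1)])
      also have "\<dots> \<in> M"
      proof (rule sum)
        fix i assume i: "i \<in> A"
        have "\<phi> i s \<in> S" using \<phi>(2)[OF i] s by blast
        then show "\<theta> (\<phi> i s ^ p * b i) \<in> M" using t[OF i] by blast
      qed
      finally show "\<theta> s \<in> M" .
    qed
    moreover have "?H \<subseteq> S"
      using G(2) b by (auto intro!: subringD(4)[OF S_subring] subring_power[OF S_subring])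
    ultimately show ?case using G(1) A by (intro exI[of _ ?H]) auto
  qed
  then obtain G where "finite G" "G \<subseteq> S" "gen e G" by blast
  then show ?thesis using that[of G] unfolding gen_def by blast
qed

text \<open>By the preceding lemma it suffices to clear the denominators of finitely many values;
  their product avoids the prime \<open>P\<close>.\<close>

lemma clear_denominators:
  assumes \<theta>: "p_linear p e \<theta>" "\<theta> ` S \<subseteq> localization S P" and P: "P \<in> Spec S"
  obtains c where "c \<in> S" "c \<notin> P" "(\<lambda>z. c * \<theta> z) ` S \<subseteq> S"
proof -
  obtain G where G: "finite G" "G \<subseteq> S"
    "\<And>\<theta> M. p_linear p e \<theta> \<Longrightarrow> \<theta> ` G \<subseteq> M \<Longrightarrow> 0 \<in> M \<Longrightarrow> (\<And>x y. x \<in> M \<Longrightarrow> y \<in> M \<Longrightarrow> x + y \<in> M) \<Longrightarrow>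
      (\<And>s x. s \<in> S \<Longrightarrow> x \<in> M \<Longrightarrow> s * x \<in> M) \<Longrightarrow> \<theta> ` S \<subseteq> M"
    using p_linear_image_bound[of e] by metis
  have "\<exists>d. d \<in> S \<and> d \<notin> P \<and> d * \<theta> g \<in> S" if "g \<in> G" for g
  proof -
    have "\<theta> g \<in> localization S P" using \<theta>(2) G(2) that by blast
    then obtain x y where xy: "\<theta> g = x / y" "x \<in> S" "y \<in> S" "y \<notin> P" by (auto simp: localization_def)
    moreover have "y \<noteq> 0" using xy(4) idealD(2)[OF SpecD(1)[OF P]] by auto
    ultimately show ?thesis by (intro exI[of _ y]) auto
  qed
  then obtain d where d: "d g \<in> S" "d g \<notin> P" "d g * \<theta> g \<in> S" if "g \<in> G" for g by metis
  have prodS: "prod d K \<in> S" if "K \<subseteq> G" for K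
    using that d by (intro subring_prod[OF S_subring]) auto
  show ?thesis
  proof (rule that[of "prod d G"])
    show "prod d G \<in> S" by (rule prodS) simp
    have "prod d K \<notin> P" if "finite K" "K \<subseteq> G" for K
      using that
    proof (induction K rule: finite_induct)
      case (insert g K)
      then show ?case using SpecD(3)[OF P, of "d g" "prod d K"] d prodS[of K] by auto
    qed (simp add: SpecD(2)[OF P])
    then show "prod d G \<notin> P" using G(1) by blast
    show "(\<lambda>z. prod d G * \<theta> z) ` S \<subseteq> S"
    proof (rule G(3)[OF p_linear_scale[OF \<theta>(1)]])
      show "(\<lambda>z. prod d G * \<theta> z) ` G \<subseteq> S"
      proof (rule image_subsetI)
        fix g assume g: "g \<in> G"
        have "prod d G = prod d (G - {g}) * d g" using G(1) g by (simp add: prod.remove mult.commute)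
        then have "prod d G * \<theta> g = prod d (G - {g}) * (d g * \<theta> g)" by (simp only: mult.assoc)
        also have "\<dots> \<in> S" by (rule subringD(4)[OF S_subring prodS d(3)[OF g]]) auto
        finally show "prod d G * \<theta> g \<in> S" .
      qed
    qed (auto simp: subringD[OF S_subring])
  qed
qed

end

text \<open>Fedder's maps are constructed on \<open>S\<close>. They are extended to the field
  because log discrepancies are defined by maps on the whole field.\<close>

lemma standard_smooth_frobenius_projective:
  fixes \<iota> :: "'k::alg_closed_field \<Rightarrow> 'l::field"
  assumes "field_hom \<iota>" "CHAR('k) = p" "p > 0" "standard_smooth \<iota> S"
    and frac: "\<And>z. \<exists>a\<in>S. \<exists>b\<in>S. b \<noteq> 0 \<and> z = a / b"
  obtains A :: "(nat \<Rightarrow>\<^sub>0 nat) set" and \<phi> b where "frobenius_projective p S A \<phi> b"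
proof -
  obtain n r a f where "smooth_presentation \<iota> p S n r a f"
    using assms unfolding standard_smooth_def smooth_presentation_def by blast
  then interpret smooth_presentation \<iota> p S n r a f .
  obtain b where b: "\<And>\<alpha>. \<alpha> \<in> exponents_below p n \<Longrightarrow> b \<alpha> \<in> S"
    "\<And>s. s \<in> S \<Longrightarrow> s = (\<Sum>\<alpha>\<in>exponents_below p n. \<phi> \<alpha> s ^ p * b \<alpha>)"
    using frobenius_basis by blast
  have "\<exists>\<psi>. p_linear p 1 \<psi> \<and> (\<forall>s\<in>S. \<psi> s = \<phi> \<alpha> s)" for \<alpha>
    by (rule extend_p_linear[of S "\<phi> \<alpha>" p p 1])
      (use S_subring frac \<phi>_add \<phi>_power_mult p in auto)
  then obtain \<psi> where \<psi>: "\<And>\<alpha>. p_linear p 1 (\<psi> \<alpha>)" "\<And>\<alpha> s. s \<in> S \<Longrightarrow> \<psi> \<alpha> s = \<phi> \<alpha> s" by metis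
  have "frobenius_projective p S (exponents_below p n) \<psi> b"
  proof
    show "CHAR('l) = p" using CHAR_field_hom[OF hom] p by simp
    show "\<psi> i ` S \<subseteq> S" for i using \<psi>(2) \<phi>_S by auto
    show "s = (\<Sum>i\<in>exponents_below p n. \<psi> i s ^ p * b i)" if "s \<in> S" for s
      using b(2)[OF that] that by (simp add: \<psi>)
  qed (use p S_noetherian frac finite_exponents_below \<psi> b in auto)
  then show ?thesis by (rule that)
qed

section \<open>Real-valued valuations\<close>

lemma real_valuationD:
  assumes "real_valuation (v :: 'l::field \<Rightarrow> ereal)"
  shows "v 0 = \<infinity>" "\<And>f. f \<noteq> 0 \<Longrightarrow> \<bar>v f\<bar> \<noteq> \<infinity>" "\<And>f g. v (f * g) = v f + v g"
    "\<And>f g. min (v f) (v g) \<le> v (f + g)" "v 1 = 0"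
proof -
  show *: "v 0 = \<infinity>" "\<And>f. f \<noteq> 0 \<Longrightarrow> \<bar>v f\<bar> \<noteq> \<infinity>" "\<And>f g. v (f * g) = v f + v g"
    "\<And>f g. min (v f) (v g) \<le> v (f + g)" using assms by (auto simp: real_valuation_def)
  show "v 1 = 0" using *(2)[of 1] *(3)[of 1 1] by (cases "v 1") auto
qed

lemma valuation_ereal:
  assumes "real_valuation (v :: 'l::field \<Rightarrow> ereal)" "f \<noteq> 0"
  shows "v f = ereal (real_of_ereal (v f))"
  using assms by (simp add: real_valuation_def ereal_real')

lemma valuation_divide:
  assumes v: "real_valuation (v :: 'l::field \<Rightarrow> ereal)" and b: "b \<noteq> 0"
  shows "v (a / b) = v a - v b"
proof (cases "a = 0")
  case True
  then show ?thesis using v b by (cases "v b") (auto simp: real_valuation_def)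
next
  case False
  have "v a = v (a / b) + v b" using v b unfolding real_valuation_def by (metis nonzero_eq_divide_eq)
  then show ?thesis using valuation_ereal[OF v b] valuation_ereal[OF v False] valuation_ereal[OF v, of "a / b"] b False
    by (cases "v (a / b)"; cases "v a"; cases "v b") auto
qed

lemma valuation_prime:
  assumes R: "is_subring R" and v: "real_valuation v" and nn: "\<And>s. s \<in> R \<Longrightarrow> v s \<ge> 0"
  shows "{s\<in>R. v s > 0} \<in> Spec R"
proof -
  let ?P = "{s\<in>R. v s > 0}"
  have "is_ideal R ?P" unfolding is_ideal_def
  proof (intro conjI ballI)
    fix a assume a: "a \<in> ?P"
    show "a + b \<in> ?P" if "b \<in> ?P" for b
      using a that real_valuationD(4)[OF v, of a b] subringD(3)[OF R] by (auto simp: min_def split: if_splits)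
    show "r * a \<in> ?P" if "r \<in> R" for r
      using a that nn[of r] real_valuationD(3)[OF v, of r a] subringD(4)[OF R]
      by (auto simp: add_nonneg_pos)
  qed (auto simp: real_valuationD(1)[OF v] subringD[OF R])
  moreover have "a \<in> ?P \<or> b \<in> ?P" if "a \<in> R" "b \<in> R" "a * b \<in> ?P" for a b
    using that nn[of a] nn[of b] real_valuationD(3)[OF v, of a b] by (auto simp: less_le)
  moreover have "1 \<notin> ?P" by (simp add: real_valuationD(5)[OF v])
  ultimately show ?thesis unfolding Spec_def by blast
qed

lemma valuation_nonneg_subring_generated:
  assumes v: "real_valuation v" and nn: "\<And>s. s \<in> T \<Longrightarrow> v s \<ge> 0" and s: "s \<in> subring_generated T"
  shows "v s \<ge> 0"
proof -
  have m: "v (-1) = 0"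
  proof -
    have "v (-1) + v (-1) = 0" using real_valuationD(3)[OF v, of "-1" "-1"] real_valuationD(5)[OF v] by simp
    then show ?thesis by (cases "v (-1)") auto
  qed
  have "is_subring {s. v s \<ge> 0}" unfolding is_subring_def
  proof (intro conjI ballI)
    fix a b assume ab: "a \<in> {s. v s \<ge> 0}" "b \<in> {s. v s \<ge> 0}"
    show "a + b \<in> {s. v s \<ge> 0}"
      using ab real_valuationD(4)[OF v, of a b] by (auto simp: min_def split: if_splits)
    show "a * b \<in> {s. v s \<ge> 0}" using ab by (simp add: real_valuationD(3)[OF v])
    show "- a \<in> {s. v s \<ge> 0}" using ab real_valuationD(3)[OF v, of "-1" a] m by simp
  qed (simp_all add: real_valuationD[OF v])
  then show ?thesis using s nn unfolding subring_generated_def by blast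
qed

section \<open>Integral separated schemes\<close>

lemma topspace_zariski: "is_subring R \<Longrightarrow> topspace (zariski R) = Spec R"
  unfolding zariski_def using SpecD(2) subringD(2)[of R] by (auto simp: topology_generated_by_topspace)

lemma openin_zariski_basic: "b \<in> R \<Longrightarrow> openin (zariski R) {P \<in> Spec R. b \<notin> P}"
  unfolding zariski_def by (rule topology_generated_by_Basis) auto

text \<open>The principal open sets are given as a subbasis only. Primality makes D(b) and D(c) meet
  in D(bc), so they form a basis.\<close>

lemma zariski_basis:
  assumes R: "is_subring R" and T: "openin (zariski R) T" and P: "P \<in> T"
  obtains b where "b \<in> R" "b \<notin> P" "{Q \<in> Spec R. b \<notin> Q} \<subseteq> T"
proof -
  have "generate_topology_on ((\<lambda>f. {P \<in> Spec R. f \<notin> P}) ` R) T"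
    using T unfolding zariski_def by (simp add: openin_topology_generated_by_iff)
  then have "T \<subseteq> Spec R \<and> (\<forall>P\<in>T. \<exists>b\<in>R. b \<notin> P \<and> {Q \<in> Spec R. b \<notin> Q} \<subseteq> T)"
  proof (induction rule: generate_topology_on.induct)
    case (Int S T)
    show ?case
    proof (intro conjI ballI)
      show "S \<inter> T \<subseteq> Spec R" using Int by auto
      fix P assume P: "P \<in> S \<inter> T"
      then obtain b c where bc: "b \<in> R" "b \<notin> P" "{Q \<in> Spec R. b \<notin> Q} \<subseteq> S"
        "c \<in> R" "c \<notin> P" "{Q \<in> Spec R. c \<notin> Q} \<subseteq> T" using Int by fast
      have "P \<in> Spec R" using P Int by auto
      then have "b * c \<notin> P" using SpecD(3)[of P R b c] bc by auto
      moreover have "{Q \<in> Spec R. b * c \<notin> Q} \<subseteq> S \<inter> T"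
        using bc idealD(4,5)[OF SpecD(1)] by blast
      ultimately show "\<exists>b\<in>R. b \<notin> P \<and> {Q \<in> Spec R. b \<notin> Q} \<subseteq> S \<inter> T"
        using subringD(4)[OF R bc(1,4)] by blast
    qed
  next
    case (UN K)
    show ?case
    proof (intro conjI ballI)
      show "\<Union>K \<subseteq> Spec R" using UN by auto
      fix P assume "P \<in> \<Union>K"
      then obtain S where S: "S \<in> K" "P \<in> S" by auto
      then obtain b where "b \<in> R" "b \<notin> P" "{Q \<in> Spec R. b \<notin> Q} \<subseteq> S"
        using UN.IH[OF S(1)] by meson
      then show "\<exists>b\<in>R. b \<notin> P \<and> {Q \<in> Spec R. b \<notin> Q} \<subseteq> \<Union>K"
        using Union_upper[OF S(1)] by (meson subset_trans)
    qed
  qed auto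
  then show ?thesis using P that by blast
qed

locale integral_separated_scheme =
  fixes X :: "('x, 'l::field) ringed"
  assumes integral: "integral_scheme X" and sep: "separated X"
begin

lemma nopen_Int: "nopen X U \<Longrightarrow> nopen X V \<Longrightarrow> nopen X (U \<inter> V)"
  using integral by (auto simp: integral_scheme_def nopen_def)

lemma Sect_subring: "nopen X U \<Longrightarrow> is_subring (Sect X U)"
  using integral by (auto simp: integral_scheme_def)

lemma Sect_mono: "nopen X U \<Longrightarrow> nopen X V \<Longrightarrow> V \<subseteq> U \<Longrightarrow> Sect X U \<subseteq> Sect X V"
  using integral unfolding integral_scheme_def subsheaf_of_const_def by blast

lemma Sect_glue:
  assumes "\<U> \<noteq> {}" "\<And>U. U \<in> \<U> \<Longrightarrow> nopen X U" "\<And>U. U \<in> \<U> \<Longrightarrow> f \<in> Sect X U"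
  shows "f \<in> Sect X (\<Union>\<U>)"
proof -
  have "\<forall>\<U>. \<U> \<noteq> {} \<and> (\<forall>U\<in>\<U>. nopen X U) \<longrightarrow> (\<Inter>U\<in>\<U>. Sect X U) \<subseteq> Sect X (\<Union>\<U>)"
    using integral by (simp add: integral_scheme_def subsheaf_of_const_def)
  then have "(\<Inter>U\<in>\<U>. Sect X U) \<subseteq> Sect X (\<Union>\<U>)" using assms(1,2) by simp
  moreover have "f \<in> (\<Inter>U\<in>\<U>. Sect X U)" using assms(3) by simp
  ultimately show ?thesis by (rule subsetD)
qed

lemma affine_cover: "x \<in> points X \<Longrightarrow> \<exists>U. affine_open X U \<and> x \<in> U"
  using integral unfolding integral_scheme_def by blast

lemma nopen_points: "nopen X U \<Longrightarrow> U \<subseteq> points X"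
  unfolding nopen_def points_def by (auto dest: openin_subset)

lemma sheaf_stalkI: "nopen X U \<Longrightarrow> x \<in> U \<Longrightarrow> f \<in> G U \<Longrightarrow> f \<in> sheaf_stalk X G x"
  unfolding sheaf_stalk_def by blast

lemma local_ringI: "nopen X U \<Longrightarrow> x \<in> U \<Longrightarrow> f \<in> Sect X U \<Longrightarrow> f \<in> local_ring X x"
  unfolding local_ring_def by (rule sheaf_stalkI)

lemma SectI:
  assumes W: "nopen X W" and f: "\<And>x. x \<in> W \<Longrightarrow> f \<in> local_ring X x"
  shows "f \<in> Sect X W"
proof -
  let ?\<U> = "{V. nopen X V \<and> V \<subseteq> W \<and> f \<in> Sect X V}"
  have *: "\<exists>V\<in>?\<U>. x \<in> V" if x: "x \<in> W" for x
  proof -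
    obtain V where V: "nopen X V" "x \<in> V" "f \<in> Sect X V"
      using f[OF x] unfolding local_ring_def sheaf_stalk_def by auto
    have "nopen X (V \<inter> W)" using nopen_Int V W by auto
    then have "V \<inter> W \<in> ?\<U>" using V Sect_mono[of V "V \<inter> W"] by auto
    then show ?thesis using V x by blast
  qed
  then have e: "\<Union>?\<U> = W" by blast
  have "?\<U> \<noteq> {}" using * W by (auto simp: nopen_def)
  then have "f \<in> Sect X (\<Union>?\<U>)" by (rule Sect_glue) auto
  then show ?thesis unfolding e .
qed

section \<open>Points of an affine open set and primes of its ring\<close>

definition prime_at :: "'x set \<Rightarrow> 'x \<Rightarrow> 'l set" where
  "prime_at U x = max_ideal X x \<inter> Sect X U"

context
  fixes U assumes U: "affine_open X U"
begin

lemma affine_nopen: "nopen X U"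
  using U by (simp add: affine_open_def)

lemma affine_subring: "is_subring (Sect X U)"
  using affine_nopen by (rule Sect_subring)

lemma affine_homeo: "homeomorphic_map (subtopology (Topol X) U) (zariski (Sect X U)) (prime_at U)"
  using U unfolding affine_open_def prime_at_def by simp

lemma affine_topspace: "topspace (subtopology (Topol X) U) = U"
  using affine_nopen unfolding nopen_def by (auto dest: openin_subset)

lemma prime_at_image: "prime_at U ` U = Spec (Sect X U)"
  using homeomorphic_imp_surjective_map[OF affine_homeo] affine_topspace
    topspace_zariski[OF affine_subring] by simp

lemma prime_at_Spec: "x \<in> U \<Longrightarrow> prime_at U x \<in> Spec (Sect X U)"
  using prime_at_image by blast

lemma prime_at_surj: "P \<in> Spec (Sect X U) \<Longrightarrow> \<exists>x. x \<in> U \<and> P = prime_at U x"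
  unfolding prime_at_image[symmetric] by auto

lemma prime_at_inj: "x \<in> U \<Longrightarrow> y \<in> U \<Longrightarrow> prime_at U x = prime_at U y \<Longrightarrow> x = y"
  using homeomorphic_imp_injective_map[OF affine_homeo] affine_topspace by (auto dest: inj_onD)

lemma affine_local_ring: "x \<in> U \<Longrightarrow> local_ring X x = localization (Sect X U) (prime_at U x)"
  using U unfolding affine_open_def prime_at_def by simp

text \<open>Every element of the field is a section over some nonempty open set. That set meets
  \<open>U\<close>, and the local ring at a common point is a localization of the ring of
  \<open>U\<close>.\<close>

lemma affine_fractions: "\<exists>a\<in>Sect X U. \<exists>b\<in>Sect X U. b \<noteq> 0 \<and> z = a / b"
proof -
  have "z \<in> \<Union>{Sect X U | U. nopen X U}" using integral by (simp add: integral_scheme_def)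
  then obtain W where W: "nopen X W" "z \<in> Sect X W" by auto
  then have "nopen X (U \<inter> W)" using nopen_Int[OF affine_nopen] by blast
  then obtain y where y: "y \<in> U" "y \<in> W" by (auto simp: nopen_def)
  have "z \<in> localization (Sect X U) (prime_at U y)"
    using local_ringI[OF W(1) y(2) W(2)] affine_local_ring[OF y(1)] by simp
  then obtain a b where "a \<in> Sect X U" "b \<in> Sect X U" "b \<notin> prime_at U y" "z = a / b"
    by (auto simp: localization_def)
  moreover have "b \<noteq> 0" using calculation(3) idealD(2)[OF SpecD(1)[OF prime_at_Spec[OF y(1)]]] by auto
  ultimately show ?thesis by blast
qed

lemma affine_basic_open:
  assumes b: "b \<in> Sect X U" shows "openin (Topol X) {x\<in>U. b \<notin> max_ideal X x}"
proof -
  let ?D = "{x\<in>U. b \<notin> max_ideal X x}"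
  have e: "prime_at U ` ?D = {P \<in> Spec (Sect X U). b \<notin> P}"
    unfolding prime_at_image[symmetric] using b by (auto simp: prime_at_def)
  have "?D \<subseteq> topspace (subtopology (Topol X) U)" unfolding affine_topspace by auto
  from homeomorphic_map_openness[OF affine_homeo this] have "openin (subtopology (Topol X) U) ?D"
    unfolding e using openin_zariski_basic[OF b] by simp
  then show ?thesis using affine_nopen openin_trans_full unfolding nopen_def by blast
qed

lemma affine_basis:
  assumes W: "openin (Topol X) W" and x: "x \<in> U" "x \<in> W"
  obtains b where "b \<in> Sect X U" "b \<notin> max_ideal X x" "{y\<in>U. b \<notin> max_ideal X y} \<subseteq> W"
proof -
  have "openin (subtopology (Topol X) U) (W \<inter> U)" using W by (auto simp: openin_subtopology)
  moreover have "W \<inter> U \<subseteq> topspace (subtopology (Topol X) U)" unfolding affine_topspace by auto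
  ultimately have "openin (zariski (Sect X U)) (prime_at U ` (W \<inter> U))"
    using homeomorphic_map_openness[OF affine_homeo, of "W \<inter> U"] by simp
  moreover have "prime_at U x \<in> prime_at U ` (W \<inter> U)" using x by auto
  ultimately obtain b where b: "b \<in> Sect X U" "b \<notin> prime_at U x"
    "{Q \<in> Spec (Sect X U). b \<notin> Q} \<subseteq> prime_at U ` (W \<inter> U)"
    by (rule zariski_basis[OF affine_subring])
  show ?thesis
  proof (rule that[of b])
    show "b \<notin> max_ideal X x" using b by (auto simp: prime_at_def)
    show "{y\<in>U. b \<notin> max_ideal X y} \<subseteq> W"
    proof safe
      fix y assume y: "y \<in> U" "b \<notin> max_ideal X y"
      then have "prime_at U y \<in> prime_at U ` (W \<inter> U)"
        using b(3) prime_at_Spec[OF y(1)] by (auto simp: prime_at_def)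
      then show "y \<in> W" using prime_at_inj y(1) by auto
    qed
  qed (rule b)
qed

lemma unit_off_max_ideal:
  assumes b: "b \<in> Sect X U" "b \<notin> max_ideal X x" "x \<in> U"
  shows "b \<noteq> 0" "inverse b \<in> local_ring X x"
  using b local_ringI[OF affine_nopen b(3) b(1)] by (auto simp: max_ideal_def nonunits_def)

lemma affine_basic_nopen:
  assumes h: "h \<in> Sect X U" "h \<noteq> 0" shows "nopen X {x\<in>U. h \<notin> max_ideal X x}"
proof -
  have "is_ideal (Sect X U) {0}" using subringD(1)[OF affine_subring] by (auto simp: is_ideal_def)
  \<comment> \<open>The generic point of \<open>U\<close> lies in every principal open set with
    \<open>h \<noteq> 0\<close>.\<close>
  then have "{0} \<in> Spec (Sect X U)" by (auto simp: Spec_def)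
  then obtain x where "x \<in> U" "{0} = prime_at U x" using prime_at_surj by meson
  then have "x \<in> {x\<in>U. h \<notin> max_ideal X x}" using h by (auto simp: prime_at_def)
  then show ?thesis using affine_basic_open[OF h(1)] unfolding nopen_def by blast
qed

lemma inverse_in_Sect_basic:
  assumes h: "h \<in> Sect X U" "h \<noteq> 0" shows "inverse h \<in> Sect X {x\<in>U. h \<notin> max_ideal X x}"
  by (rule SectI[OF affine_basic_nopen[OF h]]) (use unit_off_max_ideal h in auto)

text \<open>If the ideal of denominators of \<open>f\<close> contained no power of \<open>h\<close>,
  some prime would contain it and miss \<open>h\<close>. At the corresponding point \<open>f\<close>
  is a fraction whose denominator avoids that prime.\<close>

lemma Sect_basic:
  assumes h: "h \<in> Sect X U" "h \<noteq> 0" and f: "f \<in> Sect X {x\<in>U. h \<notin> max_ideal X x}"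
  obtains n where "h ^ n * f \<in> Sect X U"
proof -
  let ?R = "Sect X U" and ?D = "{b\<in>Sect X U. b * f \<in> Sect X U}"
  have D: "is_ideal ?R ?D" unfolding is_ideal_def
    using subringD[OF affine_subring] by (auto simp: distrib_right mult.assoc)
  have "\<exists>n. h ^ n \<in> ?D"
  proof (rule ccontr)
    assume "\<not> ?thesis"
    then obtain P where P: "P \<in> Spec ?R" "?D \<subseteq> P" "h \<notin> P"
      using prime_avoiding_powers[OF affine_subring D h(1)] by blast
    then obtain x where x: "x \<in> U" "P = prime_at U x" using prime_at_surj by meson
    then have "x \<in> {x\<in>U. h \<notin> max_ideal X x}" using P(3) h by (auto simp: prime_at_def)
    then have "f \<in> local_ring X x" using local_ringI[OF affine_basic_nopen[OF h] _ f] by simp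
    then have "f \<in> localization ?R P" using affine_local_ring x by simp
    then obtain a b where ab: "f = a / b" "a \<in> ?R" "b \<in> ?R" "b \<notin> P" by (auto simp: localization_def)
    moreover have "b \<noteq> 0" using ab(4) idealD(2)[OF SpecD(1)[OF P(1)]] by auto
    ultimately have "b \<in> ?D" by auto
    then show False using P(2) ab by auto
  qed
  then show ?thesis using that by blast
qed

end


section \<open>Centers of valuations\<close>

lemma is_center_Sect:
  assumes U: "nopen X U" and c: "is_center X v x" "x \<in> U" and s: "s \<in> Sect X U"
  shows "v s \<ge> 0" "s \<in> max_ideal X x \<longleftrightarrow> v s > 0"
  using local_ringI[OF U c(2) s] c(1) by (auto simp: is_center_def)

text \<open>The center is the point of the prime where \<open>v\<close> is positive. Denominators in
  its local ring have value zero, so \<open>v\<close> is read off from numerators.\<close>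

lemma center_exists:
  assumes U: "affine_open X U" and v: "real_valuation v" and nn: "\<And>s. s \<in> Sect X U \<Longrightarrow> v s \<ge> 0"
  obtains x where "x \<in> U" "is_center X v x"
proof -
  let ?R = "Sect X U" and ?P = "{s\<in>Sect X U. v s > 0}"
  have "?P \<in> Spec ?R" by (rule valuation_prime[OF affine_subring[OF U] v nn])
  then obtain x where x: "x \<in> U" "?P = prime_at U x" using prime_at_surj[OF U] by meson
  have L: "local_ring X x = localization ?R ?P" using affine_local_ring[OF U x(1)] x(2) by simp
  have el: "\<exists>a b. z = a / b \<and> a \<in> ?R \<and> b \<in> ?R \<and> v b = 0 \<and> b \<noteq> 0 \<and> v z = v a" if "z \<in> local_ring X x" for z
  proof -
    from that obtain a b where ab: "z = a / b" "a \<in> ?R" "b \<in> ?R" "b \<notin> ?P" unfolding L localization_def by auto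
    then have vb: "v b = 0" using nn[of b] by (auto simp: less_le)
    then have "b \<noteq> 0" using real_valuationD(1)[OF v] by auto
    then have "v z = v a" using valuation_divide[OF v] ab(1) vb by simp
    then show ?thesis using ab vb \<open>b \<noteq> 0\<close> by blast
  qed
  have "max_ideal X x = local_ring X x \<inter> {f. v f > 0}"
  proof (rule subset_antisym; rule subsetI)
    fix z assume z: "z \<in> max_ideal X x"
    then have zl: "z \<in> local_ring X x" and zi: "z = 0 \<or> inverse z \<notin> local_ring X x"
      by (auto simp: max_ideal_def nonunits_def)
    have "v z > 0"
    proof (rule ccontr)
      assume neg: "\<not> v z > 0"
      obtain a b where ab: "z = a / b" "a \<in> ?R" "b \<in> ?R" "v b = 0" "b \<noteq> 0" "v z = v a" using el[OF zl] by blast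
      then have a0: "a \<notin> ?P" using neg by simp
      have "z \<noteq> 0" using neg real_valuationD(1)[OF v] by auto
      moreover have "inverse z = b / a" using ab by simp
      then have "inverse z \<in> local_ring X x" unfolding L localization_def using ab a0 by blast
      ultimately show False using zi by simp
    qed
    then show "z \<in> local_ring X x \<inter> {f. v f > 0}" using zl by simp
  next
    fix z assume z: "z \<in> local_ring X x \<inter> {f. v f > 0}"
    have "inverse z \<notin> local_ring X x" if z0: "z \<noteq> 0"
    proof
      assume "inverse z \<in> local_ring X x"
      then obtain a where "a \<in> ?R" "v (inverse z) = v a" using el by blast
      then have "v (inverse z) \<ge> 0" using nn by simp
      moreover have "v z + v (inverse z) = 0"
        using real_valuationD(3)[OF v, of z "inverse z"] real_valuationD(5)[OF v] z0 by simp
      ultimately show False using z by (cases "v z"; cases "v (inverse z)") auto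
    qed
    then show "z \<in> max_ideal X x" using z by (auto simp: max_ideal_def nonunits_def)
  qed
  moreover have "local_ring X x \<subseteq> {f. v f \<ge> 0}"
  proof
    fix z assume "z \<in> local_ring X x"
    then obtain a where "a \<in> ?R" "v z = v a" using el by blast
    then show "z \<in> {f. v f \<ge> 0}" using nn by simp
  qed
  moreover have "x \<in> points X" using x(1) nopen_points[OF affine_nopen[OF U]] by blast
  ultimately show ?thesis using that[OF x(1)] by (simp add: is_center_def)
qed

lemma center_in_affine_unique:
  assumes U: "affine_open X U" and x: "x \<in> U" "is_center X v x" and y: "y \<in> U" "is_center X v y"
  shows "x = y"
proof (rule prime_at_inj[OF U x(1) y(1)])
  show "prime_at U x = prime_at U y"
    using is_center_Sect(2)[OF affine_nopen[OF U] x(2,1)] is_center_Sect(2)[OF affine_nopen[OF U] y(2,1)]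
    by (auto simp: prime_at_def)
qed

text \<open>This is where separatedness enters: the ring of the intersection is generated by the two
  rings, so \<open>v\<close> is nonnegative on it and has a center in the intersection, which agrees
  with both.\<close>

lemma center_unique:
  assumes v: "real_valuation v" and x: "is_center X v x" and y: "is_center X v y"
  shows "x = y"
proof -
  obtain U V where U: "affine_open X U" "x \<in> U" and V: "affine_open X V" "y \<in> V"
    using affine_cover x y unfolding is_center_def by meson
  then have W: "affine_open X (U \<inter> V)" "Sect X (U \<inter> V) = subring_generated (Sect X U \<union> Sect X V)"
    using sep unfolding separated_def by auto
  have "v s \<ge> 0" if "s \<in> Sect X (U \<inter> V)" for s
  proof (rule valuation_nonneg_subring_generated[OF v])
    show "s \<in> subring_generated (Sect X U \<union> Sect X V)" using that W by simp
    show "v t \<ge> 0" if "t \<in> Sect X U \<union> Sect X V" for t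
      using that is_center_Sect(1)[OF affine_nopen[OF U(1)] x U(2)]
        is_center_Sect(1)[OF affine_nopen[OF V(1)] y V(2)] by auto
  qed
  then obtain z where "z \<in> U \<inter> V" "is_center X v z" using center_exists[OF W(1) v] by blast
  then show ?thesis
    using center_in_affine_unique[OF U(1) U(2) x, of z] center_in_affine_unique[OF V(1) V(2) y, of z] by auto
qed

lemma center_eq: "real_valuation v \<Longrightarrow> is_center X v x \<Longrightarrow> center X v = x"
  unfolding center_def using center_unique by blast

lemma center_in_affine:
  assumes U: "affine_open X U" and v: "real_valuation v" and nn: "\<And>s. s \<in> Sect X U \<Longrightarrow> v s \<ge> 0"
  shows "center X v \<in> U" "is_center X v (center X v)"
  using center_exists[OF U v nn] center_eq[OF v] by metis+

lemma ValD:
  assumes "v \<in> Val X U"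
  shows "real_valuation v" "is_center X v (center X v)" "center X v \<in> U"
  using assms center_eq unfolding Val_def by auto

section \<open>Finiteness of ideals\<close>

text \<open>Shrink around \<open>x\<close> to a principal open set D(c) of \<open>U\<close> inside
  \<open>V\<close>, then to a principal open set D(b) of \<open>V\<close> inside D(c). The
  noetherian ring \<open>?T\<close>, generated by the ring of \<open>V\<close> and 1/b, contains the
  ring of \<open>U\<close>, and powers of \<open>d\<close> carry it back.\<close>

lemma affine_ideal_locally_finite:
  assumes U: "affine_open X U" and V: "affine_open X V" "noetherian (Sect X V)"
    and x: "x \<in> U" "x \<in> V" and I: "is_ideal (Sect X U) I"
  obtains d G where "d \<in> Sect X U" "d \<notin> prime_at U x" "finite G" "G \<subseteq> I"
    "\<And>f. f \<in> I \<Longrightarrow> \<exists>N. d ^ N * f \<in> ideal_gen (Sect X U) G"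
proof -
  let ?R = "Sect X U" and ?S = "Sect X V"
  have R: "is_subring ?R" and S: "is_subring ?S" using affine_subring U V by auto
  have oV: "openin (Topol X) V" using affine_nopen[OF V(1)] by (simp add: nopen_def)
  obtain c where c: "c \<in> ?R" "c \<notin> max_ideal X x" "{y\<in>U. c \<notin> max_ideal X y} \<subseteq> V"
    using affine_basis[OF U oV x] by blast
  let ?Dc = "{y\<in>U. c \<notin> max_ideal X y}"
  have c0: "c \<noteq> 0" by (rule unit_off_max_ideal[OF U c(1,2) x(1)])
  note Dc = affine_basic_nopen[OF U c(1) c0]
  obtain b where b: "b \<in> ?S" "b \<notin> max_ideal X x" "{y\<in>V. b \<notin> max_ideal X y} \<subseteq> ?Dc"
    using affine_basis[OF V(1) affine_basic_open[OF U c(1)] x(2)] x c by blast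
  let ?Db = "{y\<in>V. b \<notin> max_ideal X y}"
  have b0: "b \<noteq> 0" by (rule unit_off_max_ideal[OF V(1) b(1,2) x(2)])
  note Db = affine_basic_nopen[OF V(1) b(1) b0]
  have "?S \<subseteq> Sect X ?Dc" by (rule Sect_mono[OF affine_nopen[OF V(1)] Dc c(3)])
  then have SR: "\<exists>n. c ^ n * s \<in> ?R" if "s \<in> ?S" for s
    using Sect_basic[OF U c(1) c0, of s] that by blast
  obtain n where n: "c ^ n * b \<in> ?R" using SR[OF b(1)] by blast
  \<comment> \<open>The factor \<open>c ^ n * b\<close> cancels the denominator \<open>b\<close>
    while staying in \<open>?R\<close>; the extra \<open>c\<close> lets powers of \<open>d\<close>
    clear the denominators of elements of \<open>?S\<close>. At \<open>x\<close> all factors are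
    units.\<close>
  define d where "d = (c ^ n * b) * c"
  have dR: "d \<in> ?R" unfolding d_def by (rule subringD(4)[OF R n c(1)])
  let ?T = "adjoin ?S (inverse b)"
  have T: "noetherian ?T" using V(2) by (rule noetherian_adjoin)
  have RT: "?R \<subseteq> ?T"
  proof
    fix z assume z: "z \<in> ?R"
    have "?Db \<subseteq> U" using b(3) by auto
    then have "z \<in> Sect X ?Db" using z Sect_mono[OF affine_nopen[OF U] Db] by auto
    then obtain m where "b ^ m * z \<in> ?S" by (rule Sect_basic[OF V(1) b(1) b0])
    moreover have "z = inverse b ^ m * (b ^ m * z)" using b0 by (simp flip: mult.assoc power_mult_distrib)
    ultimately show "z \<in> ?T"
      using adjoin_superset[OF S] subringD(4)[OF adjoin_subring[OF S]] subring_power[OF adjoin_subring[OF S]]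
      by (metis subsetD)
  qed
  have TR: "\<exists>N. d ^ N * t \<in> ?R" if "t \<in> ?T" for t
  proof -
    let ?B = "{t. \<exists>N. d ^ N * t \<in> ?R}"
    have B: "is_subring ?B" unfolding is_subring_def
    proof (intro conjI ballI)
      show "0 \<in> ?B" "1 \<in> ?B" using subringD[OF R] by (auto intro: exI[of _ 0])
      fix u w assume "u \<in> ?B" "w \<in> ?B"
      then obtain N M where N: "d ^ N * u \<in> ?R" "d ^ M * w \<in> ?R" by auto
      have e: "d ^ (N + M) * (u + w) = d ^ M * (d ^ N * u) + d ^ N * (d ^ M * w)"
        "d ^ (N + M) * (u * w) = (d ^ N * u) * (d ^ M * w)" "d ^ N * (- u) = - (d ^ N * u)"
        by (simp_all add: power_add algebra_simps)
      have "d ^ M * (d ^ N * u) + d ^ N * (d ^ M * w) \<in> ?R"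
        by (rule subringD(3)[OF R subringD(4)[OF R subring_power[OF R dR] N(1)]
              subringD(4)[OF R subring_power[OF R dR] N(2)]])
      then show "u + w \<in> ?B" unfolding e(1)[symmetric] by blast
      show "u * w \<in> ?B" using subringD(4)[OF R N] unfolding e(2)[symmetric] by blast
      show "- u \<in> ?B" using subringD(5)[OF R N(1)] unfolding e(3)[symmetric] by blast
    qed
    have "?S \<subseteq> ?B"
    proof
      fix s assume "s \<in> ?S"
      then obtain N where N: "c ^ N * s \<in> ?R" using SR by blast
      have "d ^ N * s = (c ^ n * b) ^ N * (c ^ N * s)" by (simp add: d_def power_mult_distrib mult_ac)
      then have "d ^ N * s \<in> ?R" using subringD(4)[OF R subring_power[OF R n] N] by metis
      then show "s \<in> ?B" by blast
    qed
    moreover have "d ^ 1 * inverse b \<in> ?R"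
    proof -
      have "d ^ 1 * inverse b = c ^ n * c" using b0 by (simp add: d_def)
      then show ?thesis using subringD(4)[OF R subring_power[OF R c(1)] c(1)] by simp
    qed
    then have "inverse b \<in> ?B" by blast
    ultimately show ?thesis using adjoin_least[OF B, of ?S "inverse b"] that by blast
  qed
  have Tsub: "is_subring ?T" using T by (rule noetherianD)
  have IR: "I \<subseteq> ?R" by (rule idealD(1)[OF I])
  have IT: "I \<subseteq> ?T" using IR RT by blast
  \<comment> \<open>Generators of the extended ideal may be taken in \<open>I\<close> itself, since
    each generator uses only finitely many elements of \<open>I\<close>.\<close>
  obtain G where G: "finite G" "G \<subseteq> I" "ideal_gen ?T I \<subseteq> ideal_gen ?T G"
  proof -
    have id: "is_ideal ?T (ideal_gen ?T I)" by (rule ideal_gen_ideal[OF Tsub IT])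
    then obtain H where H: "finite H" "H \<subseteq> ideal_gen ?T I" "ideal_gen ?T I = ideal_gen ?T H"
      using noetherianD(2)[OF T] by blast
    have "\<exists>F. finite F \<and> F \<subseteq> I \<and> g \<in> ideal_gen ?T F" if "g \<in> H" for g
    proof -
      have "g \<in> ideal_gen ?T I" using H(2) that by auto
      then show ?thesis by (rule ideal_gen_finite_subset[OF Tsub IT]) blast
    qed
    then obtain F where F: "finite (F g)" "F g \<subseteq> I" "g \<in> ideal_gen ?T (F g)" if "g \<in> H" for g by metis
    have FI: "\<Union>(F ` H) \<subseteq> I" using F by blast
    have "H \<subseteq> ideal_gen ?T (\<Union>(F ` H))"
    proof
      fix g assume g: "g \<in> H"
      have "F g \<subseteq> \<Union>(F ` H)" using g by blast
      from ideal_gen_mono[OF this, of ?T] show "g \<in> ideal_gen ?T (\<Union>(F ` H))" using F(3)[OF g] by blast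
    qed
    moreover have "is_ideal ?T (ideal_gen ?T (\<Union>(F ` H)))" using FI IT by (intro ideal_gen_ideal[OF Tsub]) blast
    ultimately have "ideal_gen ?T I \<subseteq> ideal_gen ?T (\<Union>(F ` H))" unfolding H(3) by (intro ideal_gen_least)
    then show ?thesis using that[of "\<Union>(F ` H)"] FI F(1) H(1) by blast
  qed
  show ?thesis
  proof (rule that[OF dR _ G(1,2)])
    have P: "prime_at U x \<in> Spec ?R" by (rule prime_at_Spec[OF U x(1)])
    have bl: "inverse b \<in> local_ring X x" by (rule unit_off_max_ideal[OF V(1) b(1,2) x(2)])
    show "d \<notin> prime_at U x"
    proof
      assume "d \<in> prime_at U x"
      moreover have cP: "c \<notin> prime_at U x" using c by (auto simp: prime_at_def)
      ultimately have "c ^ n * b \<in> prime_at U x" using SpecD(3)[OF P n c(1)] unfolding d_def by blast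
      then have nu: "c ^ n * b \<in> nonunits (local_ring X x)" by (auto simp: prime_at_def max_ideal_def)
      have cl: "inverse c \<in> local_ring X x" by (rule unit_off_max_ideal[OF U c(1,2) x(1)])
      have L: "is_subring (local_ring X x)"
      proof -
        have Ll: "local_ring X x = localization ?R (prime_at U x)" by (rule affine_local_ring[OF U x(1)])
        have mem: "a \<in> local_ring X x \<Longrightarrow> \<exists>W. nopen X W \<and> x \<in> W \<and> a \<in> Sect X W" for a
          unfolding local_ring_def sheaf_stalk_def by auto
        show ?thesis unfolding is_subring_def
        proof (intro conjI ballI)
          show "0 \<in> local_ring X x" "1 \<in> local_ring X x"
            using local_ringI[OF affine_nopen[OF U] x(1)] subringD(1,2)[OF R] by auto
          fix u w assume "u \<in> local_ring X x" "w \<in> local_ring X x"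
          then obtain W1 W2 where W: "nopen X W1" "x \<in> W1" "u \<in> Sect X W1" "nopen X W2" "x \<in> W2" "w \<in> Sect X W2"
            using mem by meson
          have W12: "nopen X (W1 \<inter> W2)" by (rule nopen_Int[OF W(1,4)])
          have uw: "u \<in> Sect X (W1 \<inter> W2)" "w \<in> Sect X (W1 \<inter> W2)"
            using Sect_mono[OF W(1) W12] Sect_mono[OF W(4) W12] W by auto
          note s = subringD[OF Sect_subring[OF W12]]
          show "u + w \<in> local_ring X x" "u * w \<in> local_ring X x" "- u \<in> local_ring X x"
            using W by (auto intro!: local_ringI[OF W12] s uw)
        qed
      qed
      have "inverse (c ^ n * b) = inverse c ^ n * inverse b" by (simp add: power_inverse)
      also have "\<dots> \<in> local_ring X x" by (rule subringD(4)[OF L subring_power[OF L cl] bl])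
      finally show False using nu c0 b0 by (auto simp: nonunits_def)
    qed
    fix f assume "f \<in> I"
    then have "f \<in> ideal_gen ?T G" using G(3) ideal_gen_superset[of I ?T] by blast
    moreover have GT: "G \<subseteq> ?T" using G(2) IT by blast
    ultimately have "f \<in> {\<Sum>g\<in>G. k g * g | k. k ` G \<subseteq> ?T}"
      using ideal_gen_image[OF Tsub, of "\<lambda>x. x" G] G(1) by simp
    then obtain k where k: "f = (\<Sum>g\<in>G. k g * g)" "k ` G \<subseteq> ?T" by blast
    have "\<exists>N. d ^ N * k g \<in> ?R" if "g \<in> G" for g using TR k(2) that by blast
    then obtain N where N: "d ^ N g * k g \<in> ?R" if "g \<in> G" for g by metis
    define M where "M = (\<Sum>g\<in>G. N g)"
    have M: "d ^ M * k g \<in> ?R" if "g \<in> G" for g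
    proof -
      have "N g \<le> M" unfolding M_def using G(1) that by (intro member_le_sum) auto
      then have "d ^ M * k g = d ^ (M - N g) * (d ^ N g * k g)" by (simp flip: mult.assoc power_add)
      then show ?thesis using subringD(4)[OF R subring_power[OF R dR] N[OF that]] by metis
    qed
    have "d ^ M * f = (\<Sum>g\<in>G. (d ^ M * k g) * g)" unfolding k(1) by (simp add: sum_distrib_left mult.assoc)
    also have "\<dots> \<in> ideal_gen ?R G"
    proof -
      have id: "is_ideal ?R (ideal_gen ?R G)" using G(2) IR by (intro ideal_gen_ideal[OF R]) blast
      show ?thesis
      proof (rule ideal_sum[OF id], rule idealD(4)[OF id M])
        fix g assume "g \<in> G" then show "g \<in> ideal_gen ?R G" by (rule subsetD[OF ideal_gen_superset])
      qed
    qed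
    finally show "\<exists>N. d ^ N * f \<in> ideal_gen ?R G" by blast
  qed
qed

text \<open>No prime contains all the local multipliers \<open>d x\<close>, so finitely many of them
  generate the unit ideal, and the corresponding finite sets together generate
  \<open>I\<close>.\<close>

lemma affine_ideal_finite:
  assumes U: "affine_open X U" and I: "is_ideal (Sect X U) I"
    and cover: "\<And>x. x \<in> U \<Longrightarrow> \<exists>V. affine_open X V \<and> x \<in> V \<and> noetherian (Sect X V)"
  shows "fg_ideal (Sect X U) I"
proof -
  let ?R = "Sect X U"
  have R: "is_subring ?R" by (rule affine_subring[OF U])
  define Q where "Q x d G \<longleftrightarrow> d \<in> ?R \<and> d \<notin> prime_at U x \<and> finite G \<and> G \<subseteq> I \<and>
      (\<forall>f\<in>I. \<exists>N. d ^ N * f \<in> ideal_gen ?R G)" for x d G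
  have "\<exists>d G. Q x d G" if x: "x \<in> U" for x
  proof -
    obtain V where V: "affine_open X V" "x \<in> V" "noetherian (Sect X V)" using cover[OF x] by blast
    show ?thesis unfolding Q_def by (rule affine_ideal_locally_finite[OF U V(1,3) x V(2) I]) blast
  qed
  then have "\<exists>d G. \<forall>x\<in>U. Q x (d x) (G x)" by metis
  then obtain d G where "\<forall>x\<in>U. Q x (d x) (G x)" by blast
  then have dG: "d x \<in> ?R" "d x \<notin> prime_at U x" "finite (G x)" "G x \<subseteq> I"
      "\<And>f. f \<in> I \<Longrightarrow> \<exists>N. d x ^ N * f \<in> ideal_gen ?R (G x)" if "x \<in> U" for x
    using that unfolding Q_def by blast+
  have dR: "d ` U \<subseteq> ?R" using dG(1) by auto
  have "1 \<in> ideal_gen ?R (d ` U)"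
  proof (rule in_ideal_if_all_primes[OF R ideal_gen_ideal[OF R dR]])
    fix P assume "P \<in> Spec ?R"
    then obtain x where x: "x \<in> U" "P = prime_at U x" using prime_at_surj[OF U] by meson
    have "d x \<in> ideal_gen ?R (d ` U)" by (rule subsetD[OF ideal_gen_superset]) (use x in auto)
    then show "\<not> ideal_gen ?R (d ` U) \<subseteq> P" using dG(2)[OF x(1)] x(2) by blast
  qed
  then obtain F where F: "finite F" "F \<subseteq> d ` U" "1 \<in> ideal_gen ?R F"
    by (rule ideal_gen_finite_subset[OF R dR])
  obtain K where K: "finite K" "K \<subseteq> U" "F = d ` K" using finite_subset_image[OF F(1,2)] by blast
  define H where "H = \<Union>(G ` K)"
  have H: "finite H" "H \<subseteq> I" unfolding H_def using K dG(3,4) by blast+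
  have HI: "is_ideal ?R (ideal_gen ?R H)" using H idealD(1)[OF I] by (intro ideal_gen_ideal[OF R]) blast
  have "f \<in> ideal_gen ?R H" if f: "f \<in> I" for f
  proof -
    \<comment> \<open>The ideal of multipliers carrying \<open>f\<close> into the finitely generated
      ideal. It contains powers of the chosen \<open>d x\<close>, so no prime contains it.\<close>
    let ?D = "{r\<in>?R. r * f \<in> ideal_gen ?R H}"
    have D: "is_ideal ?R ?D" unfolding is_ideal_def
      using idealD(2,3,4)[OF HI] subringD(1,3,4)[OF R] by (auto simp: distrib_right mult.assoc)
    have "1 \<in> ?D"
    proof (rule in_ideal_if_all_primes[OF R D], rule notI)
      fix P assume P: "P \<in> Spec ?R" "?D \<subseteq> P"
      have "F \<subseteq> P"
      proof
        fix y assume "y \<in> F"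
        then obtain x where x: "x \<in> K" "y = d x" "x \<in> U" using K by auto
        obtain N where "d x ^ N * f \<in> ideal_gen ?R (G x)" using dG(5)[OF x(3) f] by blast
        moreover have "G x \<subseteq> H" unfolding H_def using x by blast
        ultimately have "d x ^ N * f \<in> ideal_gen ?R H" using ideal_gen_mono by blast
        then have "d x ^ N \<in> P" using P(2) subring_power[OF R dG(1)[OF x(3)]] by blast
        then show "y \<in> P" using Spec_power[OF R P(1) dG(1)[OF x(3)]] x by simp
      qed
      then have "ideal_gen ?R F \<subseteq> P" by (rule ideal_gen_least[OF SpecD(1)[OF P(1)]])
      then show False using F(3) SpecD(2)[OF P(1)] by blast
    qed
    then show ?thesis by simp
  qed
  then show ?thesis using fg_idealI[OF R I H] by blast
qed

section \<open>Stalks of quasi-coherent ideals\<close>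

lemma quasicoherent_stalk:
  assumes q: "quasicoherent_ideal X \<aa>" and V: "affine_open X V" and x: "x \<in> V"
    and g: "g \<in> sheaf_stalk X \<aa> x"
  obtains s b n where "s \<in> \<aa> V" "b \<in> Sect X V" "b \<notin> max_ideal X x" "b \<noteq> 0" "g = s / b ^ n"
proof -
  obtain W where W: "nopen X W" "x \<in> W" "g \<in> \<aa> W" using g by (auto simp: sheaf_stalk_def)
  obtain b where b: "b \<in> Sect X V" "b \<notin> max_ideal X x" "{y\<in>V. b \<notin> max_ideal X y} \<subseteq> W"
    using affine_basis[OF V _ x W(2)] W(1) unfolding nopen_def by blast
  have b0: "b \<noteq> 0" by (rule unit_off_max_ideal[OF V b(1,2) x])
  have "subsheaf_of_const X \<aa>" using q by (simp add: quasicoherent_ideal_def ideal_sheaf_def)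
  then have "\<aa> W \<subseteq> \<aa> {y\<in>V. b \<notin> max_ideal X y}"
    using W(1) affine_basic_nopen[OF V b(1) b0] b(3) by (simp add: subsheaf_of_const_def)
  then have "g \<in> \<aa> {y\<in>V. b \<notin> max_ideal X y}" using W(3) by blast
  also have "\<aa> {y\<in>V. b \<notin> max_ideal X y} = {s / b ^ n | s n. s \<in> \<aa> V}"
    using q V b(1) b0 unfolding quasicoherent_ideal_def by blast
  finally show ?thesis using that b b0 by blast
qed

lemma quasicoherent_nonzero:
  assumes q: "quasicoherent_ideal X \<aa>" "nonzero_sheaf X \<aa>" and V: "affine_open X V"
  obtains g where "g \<in> \<aa> V" "g \<noteq> 0"
proof -
  obtain W f where W: "nopen X W" "f \<in> \<aa> W" "f \<noteq> 0" using q(2) by (auto simp: nonzero_sheaf_def)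
  have "nopen X (V \<inter> W)" using nopen_Int[OF affine_nopen[OF V] W(1)] .
  then obtain y where y: "y \<in> V" "y \<in> W" by (auto simp: nopen_def)
  have "f \<in> sheaf_stalk X \<aa> y" by (rule sheaf_stalkI[of W]) (use W y in auto)
  then obtain s b n where "s \<in> \<aa> V" "b \<noteq> 0" "f = s / b ^ n" by (rule quasicoherent_stalk[OF q(1) V y(1)])
  then show ?thesis using that[of s] W(3) by auto
qed

end

section \<open>Limits of bounded families of functions\<close>

text \<open>Tychonoff's theorem gives a cluster point of the sequence. Pulling its neighbourhoods
  back along \<open>w\<close> turns clustering into convergence along a filter on the
  indices.\<close>

lemma bounded_functions_limit:
  fixes w :: "nat \<Rightarrow> 'a \<Rightarrow> real"
  assumes M: "\<And>n q. \<bar>w n q\<bar> \<le> M q"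
  obtains u G where "G \<noteq> bot" "G \<le> sequentially" "\<And>q. ((\<lambda>n. w n q) \<longlongrightarrow> u q) G"
proof -
  let ?K = "PiE UNIV (\<lambda>q. {- M q..M q})"
  have "compactin (product_topology (\<lambda>_. euclidean) UNIV) ?K"
    by (simp add: compactin_PiE compactin_euclidean_iff)
  then have K: "compact ?K"
    by (simp add: euclidean_product_topology compactin_euclidean_iff)
  have "eventually (\<lambda>x. x \<in> ?K) (filtermap w sequentially)"
    using M by (auto simp: eventually_filtermap abs_le_iff minus_le_iff PiE_iff intro!: always_eventually)
  moreover have "filtermap w sequentially \<noteq> bot" by (simp add: filtermap_bot_iff)
  ultimately obtain u where u: "inf (nhds u) (filtermap w sequentially) \<noteq> bot"
    using K unfolding compact_filter by blast
  define G where "G = inf (filtercomap w (nhds u)) sequentially"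
  show ?thesis
  proof (rule that[of G u])
    show "G \<noteq> bot"
    proof
      assume "G = bot"
      then have "eventually (\<lambda>_. False) G" by simp
      then obtain P Q where PQ: "eventually P (filtercomap w (nhds u))" "eventually Q sequentially" "\<And>n. P n \<Longrightarrow> Q n \<Longrightarrow> False"
        unfolding G_def eventually_inf by blast
      obtain R where R: "eventually R (nhds u)" "\<And>n. R (w n) \<Longrightarrow> P n"
        using PQ(1) unfolding eventually_filtercomap by blast
      have "eventually (\<lambda>x. \<not> R x) (filtermap w sequentially)"
        unfolding eventually_filtermap using PQ(2) by (rule eventually_mono) (use PQ(3) R(2) in blast)
      then have "eventually (\<lambda>_. False) (inf (nhds u) (filtermap w sequentially))"
        unfolding eventually_inf using R(1) by blast
      then show False using u by (simp add: trivial_limit_def)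
    qed
    show "G \<le> sequentially" by (simp add: G_def)
    fix q
    have "filterlim w (nhds u) (filtercomap w (nhds u))" by (rule filterlim_filtercomap)
    then have w: "(w \<longlongrightarrow> u) G" by (rule filterlim_mono) (auto simp: G_def)
    show "((\<lambda>n. w n q) \<longlongrightarrow> u q) G"
    proof (rule topological_tendstoI)
      fix T :: "real set" assume T: "open T" "u q \<in> T"
      have "open ((\<lambda>x::'a \<Rightarrow> real. x q) -` T)"
        by (rule open_vimage[OF T(1) continuous_on_product_coordinates])
      from topological_tendstoD[OF w this] T(2) show "eventually (\<lambda>n. w n q \<in> T) G" by simp
    qed
  qed
qed

text \<open>Fekete's argument: dividing m by \<open>m0\<close> costs only the remainder, at most
  \<open>m0 * \<beta> 1\<close>, and this vanishes after division by m.\<close>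

lemma subadditive_eventually_less:
  fixes \<beta> :: "nat \<Rightarrow> real"
  assumes nn: "\<And>m. m \<ge> 1 \<Longrightarrow> \<beta> m \<ge> 0"
    and sub: "\<And>s t. s \<ge> 1 \<Longrightarrow> t \<ge> 1 \<Longrightarrow> \<beta> (s + t) \<le> \<beta> s + \<beta> t"
    and m0: "m0 \<ge> 1" and c: "\<beta> m0 / m0 < c"
  shows "eventually (\<lambda>m. \<beta> m / m < c) sequentially"
proof -
  have mult: "\<beta> (Suc j * m0) \<le> Suc j * \<beta> m0" for j
  proof (induction j)
    case (Suc j)
    have "\<beta> (Suc j * m0 + m0) \<le> \<beta> (Suc j * m0) + \<beta> m0" using m0 by (intro sub) auto
    also have "Suc j * m0 + m0 = Suc (Suc j) * m0" by simp
    finally show ?case using Suc by (simp add: algebra_simps)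
  qed simp
  have add: "\<beta> (a + r) \<le> \<beta> a + r * \<beta> 1" if "a \<ge> 1" for a r
  proof (induction r)
    case (Suc r)
    have "\<beta> ((a + r) + 1) \<le> \<beta> (a + r) + \<beta> 1" using that by (intro sub) auto
    then show ?case using Suc by (simp add: algebra_simps)
  qed simp
  have bound: "\<beta> m / m \<le> \<beta> m0 / m0 + m0 * \<beta> 1 / m" if m: "m \<ge> m0" for m
  proof -
    \<comment> \<open>The quotient is written as \<open>Suc j\<close> because subadditivity is
      assumed from index 1 on and \<open>\<beta> 0\<close> is uncontrolled.\<close>
    define j r where "j = m div m0 - 1" and "r = m mod m0"
    have d: "m div m0 \<ge> 1" using m m0 by (simp add: div_greater_zero_iff Suc_le_eq)
    then have e: "m = Suc j * m0 + r" "r \<le> m0"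
      using m0 by (simp_all add: j_def r_def less_imp_le)
    have "\<beta> m \<le> Suc j * \<beta> m0 + r * \<beta> 1"
      using add[of "Suc j * m0" r] mult[of j] e(1) m0 by simp
    also have "\<dots> \<le> (m / m0) * \<beta> m0 + m0 * \<beta> 1"
    proof (intro add_mono mult_right_mono)
      have "real (Suc j) * real m0 \<le> real m" unfolding of_nat_mult[symmetric] of_nat_le_iff using e(1) by linarith
      then show "real (Suc j) \<le> real m / real m0" using m0 by (simp add: field_simps)
    qed (use e(2) nn m0 in auto)
    finally have "\<beta> m / m \<le> ((m / m0) * \<beta> m0 + m0 * \<beta> 1) / m" by (simp add: divide_right_mono)
    also have "\<dots> = \<beta> m0 / m0 + m0 * \<beta> 1 / m" using m m0 by (simp add: field_simps)
    finally show ?thesis .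
  qed
  have "(\<lambda>m. \<beta> m0 / m0 + (m0 * \<beta> 1) / real m) \<longlonglongrightarrow> \<beta> m0 / m0 + 0"
    by (intro tendsto_add tendsto_const lim_const_over_n)
  then have "eventually (\<lambda>m. \<beta> m0 / m0 + (m0 * \<beta> 1) / real m < c) sequentially"
    using c by (intro order_tendstoD(2)) auto
  then show ?thesis using eventually_ge_at_top[of m0]
    by eventually_elim (use bound in fastforce)
qed


section \<open>Log discrepancies on smooth varieties\<close>

locale smooth_variety_char_p =
  fixes \<iota> :: "'k::alg_closed_field \<Rightarrow> 'l::field" and X :: "('x, 'l) ringed" and p :: nat
  assumes char: "CHAR('k) = p" "p > 0" and smooth: "smooth_variety \<iota> X"
begin

sublocale integral_separated_scheme X
  by standard (use smooth in \<open>auto simp: smooth_variety_def variety_def\<close>)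

lemma hom: "field_hom \<iota>"
  using smooth by (simp add: smooth_variety_def variety_def)

lemma p_ge_2: "p \<ge> 2"
  using prime_CHAR_field[where 'k='k] char prime_ge_2_nat by auto

lemma p_power_gt_1: "e \<ge> 1 \<Longrightarrow> real p ^ e > 1"
  using p_ge_2 by (intro one_less_power) auto

section \<open>Standard smooth affine open sets\<close>

definition smooth_affine :: "'x set \<Rightarrow> bool" where
  "smooth_affine V \<longleftrightarrow> affine_open X V \<and> standard_smooth \<iota> (Sect X V)"

lemma smooth_affine_projective:
  assumes "smooth_affine V"
  obtains A :: "(nat \<Rightarrow>\<^sub>0 nat) set" and \<phi> b where "frobenius_projective p (Sect X V) A \<phi> b"
proof -
  have V: "affine_open X V" "standard_smooth \<iota> (Sect X V)" using assms by (simp_all add: smooth_affine_def)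
  show ?thesis
    by (rule standard_smooth_frobenius_projective[OF hom char V(2) affine_fractions[OF V(1)]]) (rule that)
qed

lemma smooth_affine_noetherian: "smooth_affine V \<Longrightarrow> noetherian (Sect X V)"
  by (erule smooth_affine_projective) (rule frobenius_projective.noeth)

lemma smooth_affine_cover: "x \<in> points X \<Longrightarrow> \<exists>V. smooth_affine V \<and> x \<in> V"
  using smooth unfolding smooth_variety_def smooth_affine_def by blast

lemma finite_smooth_affine_cover:
  obtains \<V> where "finite \<V>" "\<And>V. V \<in> \<V> \<Longrightarrow> smooth_affine V" "points X \<subseteq> \<Union>\<V>"
proof -
  have "compact_space (Topol X)"
    using smooth by (simp add: smooth_variety_def variety_def finite_type_def)
  moreover have "\<And>V. V \<in> {V. smooth_affine V} \<Longrightarrow> openin (Topol X) V"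
    unfolding smooth_affine_def using affine_nopen by (auto simp: nopen_def)
  moreover have "topspace (Topol X) \<subseteq> \<Union>{V. smooth_affine V}"
    using smooth_affine_cover by (auto simp: points_def)
  ultimately obtain \<V> where "finite \<V>" "\<V> \<subseteq> {V. smooth_affine V}" "topspace (Topol X) \<subseteq> \<Union>\<V>"
    unfolding compact_space_alt by (metis (no_types, lifting))
  then show ?thesis using that[of \<V>] by (auto simp: points_def)
qed

text \<open>At \<open>0\<close> the infinite value becomes the real number 0, so statements about
  \<open>real_val\<close> carry nonvanishing hypotheses.\<close>

definition real_val :: "('l \<Rightarrow> ereal) \<Rightarrow> 'l \<Rightarrow> real" where
  "real_val v q = real_of_ereal (v q)"

lemma real_val: "real_valuation v \<Longrightarrow> q \<noteq> 0 \<Longrightarrow> v q = ereal (real_val v q)"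
  unfolding real_val_def by (rule valuation_ereal)

lemma E_real:
  assumes v: "real_valuation v" and e: "e \<ge> 1" and f: "f \<noteq> 0" "\<psi> f \<noteq> 0"
  shows "E p e f \<psi> v = ereal ((real_val v f - real p ^ e * real_val v (\<psi> f)) / (real p ^ e - 1))"
  unfolding E_def real_val[OF v f(1)] real_val[OF v f(2)] using p_power_gt_1[OF e] by simp

section \<open>Estimates for the log discrepancy\<close>

lemma cartier_of_Sect:
  assumes V: "affine_open X V" and \<psi>: "p_linear p e \<psi>" "\<psi> ` Sect X V \<subseteq> Sect X V" and x: "x \<in> V"
  shows "\<psi> \<in> cartier_maps X p e x"
  using p_linear_localization[OF affine_subring[OF V] \<psi> char(2) prime_at_Spec[OF V x]] \<psi>(1)
  by (simp add: cartier_maps_def affine_local_ring[OF V x])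

lemma log_discrepancy_ge:
  assumes e: "e \<ge> 1" and \<psi>: "\<psi> \<in> cartier_maps X p e (center X v)" and f: "f \<noteq> 0" "\<psi> f \<noteq> 0"
  shows "E p e f \<psi> v \<le> log_discrepancy X p v"
proof -
  have "E p e f \<psi> v = E p (e * 1) f (\<psi> ^^ 1) v" by simp
  also have "\<dots> \<le> (SUP n\<in>{1..}. E p (e * n) f (\<psi> ^^ n) v)" by (rule SUP_upper) simp
  also have "\<dots> \<le> log_disc_map p e v \<psi>" unfolding log_disc_map_def by (rule SUP_upper) (simp add: f)
  also have "\<dots> \<le> (SUP \<psi>\<in>cartier_maps X p e (center X v) - {\<lambda>_. 0}. log_disc_map p e v \<psi>)"
    by (rule SUP_upper) (use \<psi> f in auto)
  also have "\<dots> \<le> log_discrepancy X p v" unfolding log_discrepancy_def by (rule SUP_upper) (use e in simp)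
  finally show ?thesis .
qed

text \<open>Iterates of a map that preserves the local ring are maps of the same kind, so the
  supremum over iterates is absorbed into the supremum over maps.\<close>

lemma less_log_discrepancy:
  assumes c: "c < log_discrepancy X p v"
  obtains e \<psi> f where "e \<ge> 1" "\<psi> \<in> cartier_maps X p e (center X v)" "f \<noteq> 0" "c < E p e f \<psi> v"
proof -
  obtain e \<psi> f n where e: "e \<ge> 1" "n \<ge> 1" "\<psi> \<in> cartier_maps X p e (center X v)" "f \<noteq> 0"
    "c < E p (e * n) f (\<psi> ^^ n) v"
    using c unfolding log_discrepancy_def log_disc_map_def less_SUP_iff by auto
  have "(\<psi> ^^ n) ` local_ring X (center X v) \<subseteq> local_ring X (center X v)"
  proof (induction n)
    case (Suc n)
    then show ?case using e(3) by (auto simp: cartier_maps_def)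
  qed simp
  then have "\<psi> ^^ n \<in> cartier_maps X p (e * n) (center X v)"
    using e(3) p_linear_funpow by (auto simp: cartier_maps_def)
  then show ?thesis using e that[of "e * n" "\<psi> ^^ n" f] by simp
qed

text \<open>Finitely many images \<psi>(q) generate the unit ideal of S, and v is nonnegative on S.
  So one of them has value at most 0, and this \<psi> shows A(v) >= v(q) / (p^e - 1). The finite set
  of maps is chosen before v.\<close>

lemma log_discrepancy_bound:
  assumes V: "smooth_affine V" and q: "q \<in> Sect X V" "q \<noteq> 0"
  obtains C where "C > 0"
    "\<And>v. v \<in> Val X V \<Longrightarrow> ereal (real_val v q / C) \<le> log_discrepancy X p v"
proof -
  let ?S = "Sect X V"
  have aff: "affine_open X V" using V by (simp add: smooth_affine_def)
  have S: "is_subring ?S" by (rule affine_subring[OF aff])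
  obtain A :: "(nat \<Rightarrow>\<^sub>0 nat) set" and \<phi> b where "frobenius_projective p ?S A \<phi> b"
    using smooth_affine_projective[OF V] by metis
  then interpret fp: frobenius_projective p ?S A \<phi> b .
  let ?G = "{\<psi> q | \<psi> e. e \<ge> 1 \<and> p_linear p e \<psi> \<and> \<psi> ` ?S \<subseteq> ?S}"
  have G: "?G \<subseteq> ?S" using q by auto
  obtain F where F: "finite F" "F \<subseteq> ?G" "1 \<in> ideal_gen ?S F"
    by (rule ideal_gen_finite_subset[OF S G fp.cartier_images_generate[OF q]])
  have "\<forall>x\<in>F. \<exists>e \<psi>. x = \<psi> q \<and> e \<ge> 1 \<and> p_linear p e \<psi> \<and> \<psi> ` ?S \<subseteq> ?S"
    using F(2) by blast
  then obtain e \<psi> where \<psi>: "x = \<psi> x q" "e x \<ge> 1" "p_linear p (e x) (\<psi> x)" "\<psi> x ` ?S \<subseteq> ?S" if "x \<in> F" for x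
    by metis
  \<comment> \<open>One constant above every \<open>p ^ e x - 1\<close>; the summand 1 ensures
    positivity.\<close>
  define C where "C = 1 + (\<Sum>x\<in>F. real p ^ e x)"
  have C: "C > 0" unfolding C_def by (simp add: sum_nonneg add_pos_nonneg)
  show ?thesis
  proof (rule that[OF C])
    fix v assume v: "v \<in> Val X V"
    note rvv = ValD(1)[OF v]
    have nn: "v s \<ge> 0" if "s \<in> ?S" for s
      by (rule is_center_Sect(1)[OF affine_nopen[OF aff] ValD(2,3)[OF v] that])
    have "\<exists>x\<in>F. \<not> v x > 0"
    proof (rule ccontr)
      assume neg: "\<not> ?thesis"
      have P: "{s\<in>?S. v s > 0} \<in> Spec ?S" by (rule valuation_prime[OF S rvv nn])
      have "F \<subseteq> {s\<in>?S. v s > 0}" using neg F(2) G by auto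
      then have "ideal_gen ?S F \<subseteq> {s\<in>?S. v s > 0}" by (rule ideal_gen_least[OF SpecD(1)[OF P]])
      then show False using F(3) SpecD(2)[OF P] by auto
    qed
    then obtain x where x: "x \<in> F" "\<not> v x > 0" by blast
    have x0: "x \<noteq> 0" using x(2) real_valuationD(1)[OF rvv] by auto
    then have px: "\<psi> x q \<noteq> 0" using \<psi>(1)[OF x(1)] by simp
    have le: "real_val v x \<le> 0" using x(2) real_val[OF rvv x0] by simp
    have q0: "real_val v q \<ge> 0" using nn[OF q(1)] real_val[OF rvv q(2)] by simp
    let ?N = "real p ^ e x"
    have N: "?N > 1" by (rule p_power_gt_1[OF \<psi>(2)[OF x(1)]])
    have "?N \<le> (\<Sum>x\<in>F. real p ^ e x)" by (rule member_le_sum) (use F(1) x(1) in auto)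
    then have "?N - 1 \<le> C" by (simp add: C_def)
    then have "real_val v q / C \<le> real_val v q / (?N - 1)" using q0 N by (intro divide_left_mono) (auto intro: mult_pos_pos C)
    also have "\<dots> \<le> (real_val v q - ?N * real_val v (\<psi> x q)) / (?N - 1)"
    proof (rule divide_right_mono)
      have "?N * real_val v (\<psi> x q) \<le> 0" using le \<psi>(1)[OF x(1)] N by (simp add: mult_nonneg_nonpos)
      then show "real_val v q \<le> real_val v q - ?N * real_val v (\<psi> x q)" by simp
    qed (use N in simp)
    finally have "ereal (real_val v q / C) \<le> E p (e x) q (\<psi> x) v"
      using E_real[of v "e x" q "\<psi> x"] rvv \<psi>(2)[OF x(1)] q(2) px by simp
    also have "\<dots> \<le> log_discrepancy X p v"
      using log_discrepancy_ge[of "e x" "\<psi> x" v q] \<psi>(2)[OF x(1)] q(2) px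
        cartier_of_Sect[OF aff \<psi>(3,4)[OF x(1)] ValD(3)[OF v]] by simp
    finally show "ereal (real_val v q / C) \<le> log_discrepancy X p v" .
  qed
qed

lemma Val_smooth_affine:
  assumes "v \<in> Val X U" obtains V where "smooth_affine V" "v \<in> Val X V"
  using smooth_affine_cover[of "center X v"] ValD[OF assms] that unfolding Val_def is_center_def by blast

lemma log_discrepancy_nonneg:
  assumes v: "v \<in> Val X U" shows "0 \<le> log_discrepancy X p v"
proof -
  obtain V where V: "smooth_affine V" "v \<in> Val X V" using Val_smooth_affine[OF v] .
  have S: "is_subring (Sect X V)" using V(1) affine_subring by (simp add: smooth_affine_def)
  obtain C where "C > 0" "\<And>v. v \<in> Val X V \<Longrightarrow> ereal (real_val v 1 / C) \<le> log_discrepancy X p v"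
    using log_discrepancy_bound[OF V(1) subringD(2)[OF S]] by auto
  from this(2)[OF V(2)] show ?thesis
    using real_valuationD(5)[OF ValD(1)[OF V(2)]] by (simp add: real_val_def zero_ereal_def)
qed

text \<open>A nontrivial valuation is positive on some nonzero section over \<open>V\<close>, since
  the field consists of fractions of such sections; apply the bound to that section.\<close>

lemma log_discrepancy_pos:
  assumes v: "v \<in> Val X V" "v \<noteq> trivial_valuation" and V: "smooth_affine V"
  shows "0 < log_discrepancy X p v"
proof -
  note rvv = ValD(1)[OF v(1)]
  have aff: "affine_open X V" using V by (simp add: smooth_affine_def)
  have nn: "v s \<ge> 0" if "s \<in> Sect X V" for s
    by (rule is_center_Sect(1)[OF affine_nopen[OF aff] ValD(2,3)[OF v(1)] that])
  have "\<exists>q\<in>Sect X V. q \<noteq> 0 \<and> real_val v q > 0"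
  proof (rule ccontr)
    assume "\<not> ?thesis"
    then have z: "v q = 0" if "q \<in> Sect X V" "q \<noteq> 0" for q
      using that nn[OF that(1)] real_val[OF rvv that(2)] by (auto simp: less_le zero_ereal_def)
    have "v z = trivial_valuation z" for z
    proof (cases "z = 0")
      case True
      then show ?thesis by (simp add: trivial_valuation_def real_valuationD(1)[OF rvv])
    next
      case False
      obtain a b where ab: "a \<in> Sect X V" "b \<in> Sect X V" "b \<noteq> 0" "z = a / b"
        using affine_fractions[OF aff] by blast
      then have "a \<noteq> 0" using False by auto
      then show ?thesis using ab z valuation_divide[OF rvv ab(3), of a] False by (simp add: trivial_valuation_def)
    qed
    then show False using v(2) by blast
  qed
  then obtain q where q: "q \<in> Sect X V" "q \<noteq> 0" "real_val v q > 0" by blast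
  obtain C where "C > 0" "\<And>v. v \<in> Val X V \<Longrightarrow> ereal (real_val v q / C) \<le> log_discrepancy X p v"
    using log_discrepancy_bound[OF V q(1,2)] by metis
  moreover have "0 < ereal (real_val v q / C)" using q(3) calculation(1) by (simp add: zero_ereal_def)
  ultimately show ?thesis using v(1) by (metis less_le_trans)
qed

end

section \<open>Asymptotic multiplier ideals\<close>

locale graded_ideals = smooth_variety_char_p \<iota> X p
  for \<iota> :: "'k::alg_closed_field \<Rightarrow> 'l::field" and X :: "('x, 'l) ringed" and p :: nat +
  fixes \<aa> :: "nat \<Rightarrow> 'x set \<Rightarrow> 'l set" and t :: real
  assumes graded: "graded_sequence X \<aa>" and t: "t \<ge> 0"
begin

lemma qc: "m \<ge> 1 \<Longrightarrow> quasicoherent_ideal X (\<aa> m)"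
  using graded by (simp add: graded_sequence_def)

lemma a_ideal: "m \<ge> 1 \<Longrightarrow> nopen X V \<Longrightarrow> is_ideal (Sect X V) (\<aa> m V)"
  using qc[of m] by (simp add: quasicoherent_ideal_def ideal_sheaf_def)

lemma a_mult: "r \<ge> 1 \<Longrightarrow> m \<ge> 1 \<Longrightarrow> nopen X V \<Longrightarrow> f \<in> \<aa> r V \<Longrightarrow> g \<in> \<aa> m V \<Longrightarrow> f * g \<in> \<aa> (r + m) V"
  using graded by (simp add: graded_sequence_def)

lemma a_nonzero:
  assumes "m \<ge> 1" "affine_open X V" obtains g where "g \<in> \<aa> m V" "g \<noteq> 0"
proof -
  have "nonzero_sheaf X (\<aa> m)" using graded assms(1) by (simp add: graded_sequence_def)
  then show ?thesis by (rule quasicoherent_nonzero[OF qc[OF assms(1)] _ assms(2)]) (rule that)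
qed

section \<open>Values of the graded sequence\<close>

lemma val_ideal_le:
  assumes v: "v \<in> Val X V" and V: "affine_open X V" and g: "g \<in> \<aa> m V"
  shows "val_ideal X v (\<aa> m) \<le> v g"
  unfolding val_ideal_def
  by (rule INF_lower) (rule sheaf_stalkI[of V], use affine_nopen[OF V] ValD(3)[OF v] g in auto)

text \<open>A germ is a section over \<open>V\<close> divided by a unit at the center, so the
  infimum over germs is approached by sections over \<open>V\<close>, which can be tested on other
  valuations as well.\<close>

lemma val_ideal_less:
  assumes v: "v \<in> Val X V" and V: "affine_open X V" and m: "m \<ge> 1" and c: "val_ideal X v (\<aa> m) < ereal c"
  obtains g where "g \<in> \<aa> m V" "g \<noteq> 0" "real_val v g < c"
proof -
  note rvv = ValD(1)[OF v]
  obtain f where f: "f \<in> sheaf_stalk X (\<aa> m) (center X v)" "v f < ereal c"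
    using c unfolding val_ideal_def INF_less_iff by blast
  obtain s b n where s: "s \<in> \<aa> m V" "b \<in> Sect X V" "b \<notin> max_ideal X (center X v)" "b \<noteq> 0" "f = s / b ^ n"
    by (rule quasicoherent_stalk[OF qc[OF m] V ValD(3)[OF v] f(1)])
  have "v b = 0"
    using is_center_Sect[OF affine_nopen[OF V] ValD(2,3)[OF v] s(2)] s(3) by (auto simp: less_le)
  then have "v (b ^ n) = 0" by (induction n) (simp_all add: real_valuationD(3,5)[OF rvv])
  then have "v f = v s" using s(4,5) valuation_divide[OF rvv, of "b ^ n" s] by simp
  then have vs: "v s < ereal c" using f(2) by simp
  then have "s \<noteq> 0" using real_valuationD(1)[OF rvv] by auto
  then show ?thesis using that[OF s(1)] vs real_val[OF rvv] by simp
qed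

definition \<beta> :: "('l \<Rightarrow> ereal) \<Rightarrow> nat \<Rightarrow> real" where
  "\<beta> v m = real_of_ereal (val_ideal X v (\<aa> m))"

lemma val_ideal_real:
  assumes v: "v \<in> Val X U" and m: "m \<ge> 1"
  shows "val_ideal X v (\<aa> m) = ereal (\<beta> v m)" "\<beta> v m \<ge> 0"
proof -
  obtain V where V: "smooth_affine V" "v \<in> Val X V" using Val_smooth_affine[OF v] .
  have aff: "affine_open X V" using V(1) by (simp add: smooth_affine_def)
  note rvv = ValD(1)[OF v]
  obtain g where g: "g \<in> \<aa> m V" "g \<noteq> 0" using a_nonzero[OF m aff] .
  have "val_ideal X v (\<aa> m) \<le> ereal (real_val v g)"
    unfolding real_val[OF rvv g(2), symmetric] by (rule val_ideal_le[OF V(2) aff g(1)])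
  moreover have "0 \<le> val_ideal X v (\<aa> m)"
    unfolding val_ideal_def
  proof (rule INF_greatest)
    fix f assume "f \<in> sheaf_stalk X (\<aa> m) (center X v)"
    then obtain W where W: "nopen X W" "center X v \<in> W" "f \<in> \<aa> m W" by (auto simp: sheaf_stalk_def)
    have "f \<in> Sect X W" using idealD(1)[OF a_ideal[OF m W(1)]] W(3) by blast
    then show "0 \<le> v f" by (rule is_center_Sect(1)[OF W(1) ValD(2)[OF v] W(2)])
  qed
  ultimately show "val_ideal X v (\<aa> m) = ereal (\<beta> v m)" "\<beta> v m \<ge> 0"
    unfolding \<beta>_def by (cases "val_ideal X v (\<aa> m)"; simp)+
qed

lemma \<beta>_subadditive:
  assumes v: "v \<in> Val X U" and r: "r \<ge> 1" "m \<ge> 1"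
  shows "\<beta> v (r + m) \<le> \<beta> v r + \<beta> v m"
proof (rule ccontr)
  assume neg: "\<not> ?thesis"
  obtain V where V: "smooth_affine V" "v \<in> Val X V" using Val_smooth_affine[OF v] .
  have aff: "affine_open X V" using V(1) by (simp add: smooth_affine_def)
  note rvv = ValD(1)[OF v]
  \<comment> \<open>Half of the assumed defect: the infimum is only approximated, once for each of
    the two ideals.\<close>
  define d where "d = (\<beta> v (r + m) - \<beta> v r - \<beta> v m) / 2"
  have d: "d > 0" using neg by (simp add: d_def)
  have "val_ideal X v (\<aa> r) < ereal (\<beta> v r + d)" using val_ideal_real(1)[OF v r(1)] d by simp
  then obtain f where f: "f \<in> \<aa> r V" "f \<noteq> 0" "real_val v f < \<beta> v r + d"
    by (rule val_ideal_less[OF V(2) aff r(1)])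
  have "val_ideal X v (\<aa> m) < ereal (\<beta> v m + d)" using val_ideal_real(1)[OF v r(2)] d by simp
  then obtain g where g: "g \<in> \<aa> m V" "g \<noteq> 0" "real_val v g < \<beta> v m + d"
    by (rule val_ideal_less[OF V(2) aff r(2)])
  have "ereal (\<beta> v (r + m)) \<le> v (f * g)"
    using val_ideal_le[OF V(2) aff a_mult[OF r affine_nopen[OF aff] f(1) g(1)]] val_ideal_real(1)[OF v, of "r + m"] r by simp
  also have "v (f * g) = ereal (real_val v f + real_val v g)" by (simp add: real_valuationD(3)[OF rvv] real_val[OF rvv f(2)] real_val[OF rvv g(2)])
  finally show False using f(3) g(3) by (simp add: d_def field_simps)
qed

section \<open>The defining inequality and the resulting ideal sheaf\<close>

definition mult_cond :: "('l \<Rightarrow> ereal) \<Rightarrow> 'l \<Rightarrow> bool" where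
  "mult_cond v f \<longleftrightarrow> eventually
     (\<lambda>m. v f + log_discrepancy X p v - ereal (t / real m) * val_ideal X v (\<aa> m) > 0) sequentially"

abbreviation J where "J \<equiv> asymptotic_multiplier X p \<aa> t"

lemma J_eq: "J U = {f\<in>Sect X U. \<forall>v\<in>Val_star X U. mult_cond v f}"
  by (simp add: asymptotic_multiplier_def mult_cond_def)

text \<open>The condition sees \<open>f\<close> only through its value and improves as the value
  grows. This is what closes the sections under sums and multiples.\<close>

lemma mult_cond_mono: "v f \<le> v g \<Longrightarrow> mult_cond v f \<Longrightarrow> mult_cond v g"
  unfolding mult_cond_def
  by (erule eventually_mono, erule less_le_trans) (intro ereal_minus_mono add_right_mono order_refl)

lemma mult_cond_infinite:
  assumes v: "v \<in> Val X U" and inf: "v f + log_discrepancy X p v = \<infinity>"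
  shows "mult_cond v f"
  unfolding mult_cond_def inf
  using eventually_ge_at_top[of 1] by eventually_elim (simp add: val_ideal_real[OF v])

lemma mult_cond_0: assumes "v \<in> Val X U" shows "mult_cond v 0"
proof (rule mult_cond_infinite[OF assms])
  show "v 0 + log_discrepancy X p v = \<infinity>"
    using log_discrepancy_nonneg[OF assms] real_valuationD(1)[OF ValD(1)[OF assms]] by auto
qed

text \<open>
  The values of the ideals are subadditive in \<open>m\<close>, so by Fekete's argument the inequality holds
  eventually as soon as it holds for a single \<open>m\<close>.
\<close>

lemma not_mult_cond_bound:
  assumes v: "v \<in> Val X U" and f: "f \<noteq> 0" and nc: "\<not> mult_cond v f"
  obtains A where "log_discrepancy X p v = ereal A"
    "\<And>m. m \<ge> 1 \<Longrightarrow> real_val v f + A \<le> t / m * \<beta> v m"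
proof -
  note rvv = ValD(1)[OF v]
  have vf: "v f = ereal (real_val v f)" by (rule real_val[OF rvv f])
  \<comment> \<open>An infinite log discrepancy would satisfy the condition, so a violation makes it
    a real number.\<close>
  have "log_discrepancy X p v \<noteq> \<infinity>" using mult_cond_infinite[OF v, of f] nc vf by auto
  then obtain A where A: "log_discrepancy X p v = ereal A"
    using log_discrepancy_nonneg[OF v] by (cases "log_discrepancy X p v") auto
  have "real_val v f + A \<le> t / m * \<beta> v m" if m: "m \<ge> 1" for m
  proof (rule ccontr)
    assume "\<not> ?thesis"
    then have gt: "t / m * \<beta> v m < real_val v f + A" by simp
    have "eventually (\<lambda>m. t / real m * \<beta> v m < real_val v f + A) sequentially"
    proof (cases "t = 0")
      case True
      then show ?thesis using gt by simp
    next
      case False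
      then have "t > 0" using t by simp
      then have "eventually (\<lambda>m. \<beta> v m / m < (real_val v f + A) / t) sequentially"
        using gt m
        by (intro subadditive_eventually_less[of "\<beta> v" m] val_ideal_real(2)[OF v] \<beta>_subadditive[OF v])
          (auto simp: field_simps)
      then show ?thesis by eventually_elim (use \<open>t > 0\<close> in \<open>simp add: field_simps\<close>)
    qed
    then have "mult_cond v f" unfolding mult_cond_def using eventually_ge_at_top[of 1]
      by eventually_elim (simp add: vf A val_ideal_real(1)[OF v] zero_ereal_def)
    then show False using nc by simp
  qed
  then show ?thesis using that A by blast
qed

lemma J_ideal: assumes U: "nopen X U" shows "is_ideal (Sect X U) (J U)"
  unfolding is_ideal_def
proof (intro conjI ballI)
  note R = subringD[OF Sect_subring[OF U]]
  have Val: "v \<in> Val X U" if "v \<in> Val_star X U" for v using that by (simp add: Val_star_def)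
  show "J U \<subseteq> Sect X U" by (auto simp: J_eq)
  show "0 \<in> J U" using R(1) mult_cond_0 Val by (auto simp: J_eq)
  fix f assume f: "f \<in> J U"
  show "f + g \<in> J U" if g: "g \<in> J U" for g
  proof -
    have "mult_cond v (f + g)" if v: "v \<in> Val_star X U" for v
    proof -
      have "min (v f) (v g) \<le> v (f + g)" by (rule real_valuationD(4)[OF ValD(1)[OF Val[OF v]]])
      then consider "v f \<le> v (f + g)" | "v g \<le> v (f + g)" by (auto simp: min_def split: if_splits)
      then show ?thesis using f g v mult_cond_mono unfolding J_eq by cases blast+
    qed
    then show ?thesis using f g R(3) by (auto simp: J_eq)
  qed
  show "r * f \<in> J U" if r: "r \<in> Sect X U" for r
  proof -
    have "mult_cond v (r * f)" if v: "v \<in> Val_star X U" for v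
    proof -
      have "0 \<le> v r" by (rule is_center_Sect(1)[OF U ValD(2,3)[OF Val[OF v]] r])
      then have "v f \<le> v (r * f)"
        using real_valuationD(3)[OF ValD(1)[OF Val[OF v]], of r f] add_right_mono[of 0 "v r" "v f"] by simp
      then show ?thesis using f v mult_cond_mono unfolding J_eq by blast
    qed
    then show ?thesis using f r R(4) by (auto simp: J_eq)
  qed
qed

lemma J_subsheaf: "subsheaf_of_const X J"
  unfolding subsheaf_of_const_def
proof (intro conjI allI impI)
  fix U V assume UV: "nopen X U \<and> nopen X V \<and> V \<subseteq> U"
  then have "Val_star X V \<subseteq> Val_star X U" by (auto simp: Val_star_def Val_def)
  moreover have "Sect X U \<subseteq> Sect X V" using UV Sect_mono by blast
  ultimately show "J U \<subseteq> J V" unfolding J_eq by blast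
next
  fix \<U> assume \<U>: "\<U> \<noteq> {} \<and> (\<forall>U\<in>\<U>. nopen X U)"
  show "(\<Inter>U\<in>\<U>. J U) \<subseteq> J (\<Union>\<U>)"
  proof
    fix f assume f: "f \<in> (\<Inter>U\<in>\<U>. J U)"
    have "f \<in> Sect X (\<Union>\<U>)" by (rule Sect_glue) (use \<U> f in \<open>auto simp: J_eq\<close>)
    moreover have "mult_cond v f" if v: "v \<in> Val_star X (\<Union>\<U>)" for v
    proof -
      obtain U where "U \<in> \<U>" "v \<in> Val_star X U" using v unfolding Val_star_def Val_def by blast
      then show ?thesis using f unfolding J_eq by blast
    qed
    ultimately show "f \<in> J (\<Union>\<U>)" by (simp add: J_eq)
  qed
qed

end

context graded_ideals
begin

section \<open>The limit valuation and quasi-coherence\<close>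

lemma real_val_mult:
  assumes "real_valuation v" "f \<noteq> 0" "g \<noteq> 0" shows "real_val v (f * g) = real_val v f + real_val v g"
proof -
  have "ereal (real_val v (f * g)) = ereal (real_val v f + real_val v g)"
    using real_val[OF assms(1), of "f * g"] real_val[OF assms(1,2)] real_val[OF assms(1,3)] assms real_valuationD(3)[OF assms(1), of f g]
    by simp
  then show ?thesis by simp
qed

lemma real_val_power:
  assumes "real_valuation v" "f \<noteq> 0" shows "real_val v (f ^ n) = n * real_val v f"
proof (induction n)
  case 0
  then show ?case using real_valuationD(5)[OF assms(1)] by (simp add: real_val_def)
next
  case (Suc n)
  then show ?case using real_val_mult[OF assms(1,2), of "f ^ n"] assms(2) by (simp add: algebra_simps)
qed

lemma real_val_add:
  assumes "real_valuation v" "f \<noteq> 0" "g \<noteq> 0" "f + g \<noteq> 0" shows "min (real_val v f) (real_val v g) \<le> real_val v (f + g)"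
  using real_valuationD(4)[OF assms(1), of f g] real_val[OF assms(1,2)] real_val[OF assms(1,3)] real_val[OF assms(1,4)]
  by (simp add: min_def split: if_splits)

lemma real_val_divide:
  assumes "real_valuation v" "f \<noteq> 0" "g \<noteq> 0" shows "real_val v (f / g) = real_val v f - real_val v g"
  using real_val_mult[OF assms(1), of "f / g" g] assms by simp

text \<open>
  Dividing by the value of \<open>g\<close> keeps all inequalities homogeneous, so the log discrepancies of
  the rescaled valuations never have to be computed.
\<close>

lemma limit_contradiction:
  fixes v :: "nat \<Rightarrow> 'l \<Rightarrow> ereal" and A :: "nat \<Rightarrow> real"
  assumes U: "affine_open X U" and V: "smooth_affine V" and h: "h \<in> Sect X U" "h \<noteq> 0"
    and s: "s \<in> J {x\<in>U. h \<notin> max_ideal X x}" "s \<in> Sect X U" "s \<noteq> 0"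
    and vU: "\<And>n. v n \<in> Val X U" and vV: "\<And>n. v n \<in> Val X V" and nt: "\<And>n. v n \<noteq> trivial_valuation"
    and A: "\<And>n. log_discrepancy X p (v n) = ereal (A n)"
    and le: "\<And>n m. m \<ge> 1 \<Longrightarrow> n * real_val (v n) h + real_val (v n) s + A n \<le> t / m * \<beta> (v n) m"
  shows False
proof -
  let ?R = "Sect X U" and ?S = "Sect X V"
  have aV: "affine_open X V" using V by (simp add: smooth_affine_def)
  note val = ValD(1)[OF vU]
  have nnU: "real_val (v n) q \<ge> 0" if "q \<in> ?R" "q \<noteq> 0" for n q
    using is_center_Sect(1)[OF affine_nopen[OF U] ValD(2,3)[OF vU] that(1)] real_val[OF val that(2)] by simp
  have nnV: "real_val (v n) q \<ge> 0" if "q \<in> ?S" "q \<noteq> 0" for n q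
    using is_center_Sect(1)[OF affine_nopen[OF aV] ValD(2,3)[OF vV] that(1)] real_val[OF val that(2)] by simp
  have \<beta>_le: "\<beta> (v n) m \<le> real_val (v n) q" if "m \<ge> 1" "q \<in> \<aa> m V" "q \<noteq> 0" for n m q
    using val_ideal_le[OF vV aV that(2)] val_ideal_real(1)[OF vV that(1)] real_val[OF val that(3)] by simp
  have le': "n * real_val (v n) h + real_val (v n) s + A n \<le> t / m * real_val (v n) q" if "m \<ge> 1" "q \<in> \<aa> m V" "q \<noteq> 0" for n m q
  proof -
    have "t / m * \<beta> (v n) m \<le> t / m * real_val (v n) q"
      by (rule mult_left_mono[OF \<beta>_le[OF that]]) (use t in simp)
    then show ?thesis using le[OF that(1), of n] by linarith
  qed
  have Apos: "A n > 0" for n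
    using log_discrepancy_pos[OF vV nt V, of n] A[of n] by (simp add: zero_ereal_def)
  obtain g where g: "g \<in> \<aa> 1 V" "g \<noteq> 0" by (rule a_nonzero[OF order_refl aV])
  have Ag: "n * real_val (v n) h + A n \<le> t * real_val (v n) g" for n
    using le'[OF _ g, of n] nnU[OF s(2,3), of n] by simp
  have nh: "0 \<le> n * real_val (v n) h" for n using nnU[OF h, of n] by simp
  have tg: "0 < t * real_val (v n) g" for n using Ag[of n] Apos[of n] nh[of n] by linarith
  have gS: "g \<in> ?S" using idealD(1)[OF a_ideal[OF _ affine_nopen[OF aV]], of 1] g(1) by auto
  have gpos: "real_val (v n) g > 0" for n
    using tg[of n] nnV[OF gS g(2), of n] t by (auto simp: zero_less_mult_iff)
  have tpos: "t > 0" using tg[of 0] gpos[of 0] t by (auto simp: zero_less_mult_iff)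
  define w where "w n q = real_val (v n) q / real_val (v n) g" for n q
  have "\<exists>C. \<forall>n. w n q \<le> C" if q: "q \<in> ?S" "q \<noteq> 0" for q
  proof -
    obtain C where C: "C > 0" "\<And>v. v \<in> Val X V \<Longrightarrow> ereal (real_val v q / C) \<le> log_discrepancy X p v"
      using log_discrepancy_bound[OF V q] by metis
    have "w n q \<le> C * t" for n
    proof -
      have "real_val (v n) q / C \<le> A n" using C(2)[OF vV, of n] A[of n] by simp
      also have "\<dots> \<le> t * real_val (v n) g" using Ag[of n] nh[of n] by linarith
      finally show ?thesis using C(1) gpos[of n] by (simp add: w_def field_simps)
    qed
    then show ?thesis by blast
  qed
  then obtain C where C: "w n q \<le> C q" if "q \<in> ?S" "q \<noteq> 0" for n q by metis
  have w0: "w n q \<ge> 0" if "q \<in> ?S" "q \<noteq> 0" for n q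
    using nnV[OF that] gpos by (simp add: w_def less_imp_le)
  \<comment> \<open>A general element is a fraction of two sections over \<open>V\<close>, whose
    normalised values lie between 0 and a constant.\<close>
  have "\<exists>M. \<forall>n. \<bar>w n q\<bar> \<le> M" for q
  proof (cases "q = 0")
    case True
    then show ?thesis using real_valuationD(1)[OF val] by (auto simp: w_def real_val_def)
  next
    case False
    obtain a b where ab: "a \<in> ?S" "b \<in> ?S" "b \<noteq> 0" "q = a / b" using affine_fractions[OF aV] by blast
    have a0: "a \<noteq> 0" using False ab by auto
    have "w n q = w n a - w n b" for n
      unfolding w_def ab(4) real_val_divide[OF val a0 ab(3)] by (simp add: diff_divide_distrib)
    then have "\<bar>w n q\<bar> \<le> C a + C b" for n
      using C[OF ab(1) a0, of n] C[OF ab(2,3), of n] w0[OF ab(1) a0, of n] w0[OF ab(2,3), of n] by simp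
    then show ?thesis by blast
  qed
  then obtain M where M: "\<bar>w n q\<bar> \<le> M q" for n q by metis
  obtain u G where G: "G \<noteq> bot" "G \<le> sequentially" and lim: "\<And>q. ((\<lambda>n. w n q) \<longlongrightarrow> u q) G"
    using bounded_functions_limit[of w M, OF M] by metis
  define y where "y q = (if q = 0 then \<infinity> else ereal (u q))" for q
  have u_mult: "u (q * q') = u q + u q'" if "q \<noteq> 0" "q' \<noteq> 0" for q q'
  proof -
    have "w n (q * q') = w n q + w n q'" for n
      by (simp add: w_def real_val_mult[OF val that] add_divide_distrib)
    then have "((\<lambda>n. w n (q * q')) \<longlongrightarrow> u q + u q') G" using tendsto_add[OF lim lim] by simp
    then show ?thesis using tendsto_unique[OF G(1) lim] by blast
  qed
  have u_add: "min (u q) (u q') \<le> u (q + q')" if "q \<noteq> 0" "q' \<noteq> 0" "q + q' \<noteq> 0" for q q'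
  proof (rule tendsto_le[OF G(1) lim tendsto_min[OF lim lim]], rule always_eventually, rule allI)
    fix n
    show "min (w n q) (w n q') \<le> w n (q + q')"
      using real_val_add[OF val that, of n] gpos[of n]
      by (auto simp: w_def min_le_iff_disj intro: divide_right_mono)
  qed
  have y: "real_valuation y" unfolding real_valuation_def
  proof (intro conjI allI impI)
    fix q q'
    show "y (q * q') = y q + y q'" by (auto simp: y_def u_mult)
    show "min (y q) (y q') \<le> y (q + q')"
      using u_add[of q q'] by (auto simp: y_def min_def split: if_splits)
  qed (auto simp: y_def)
  have u_nn: "u q \<ge> 0" if "\<And>n. real_val (v n) q \<ge> 0" for q
    by (rule tendsto_lowerbound[OF lim _ G(1)])
      (use that gpos in \<open>auto simp: w_def less_imp_le intro!: always_eventually\<close>)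
  have yU: "y q \<ge> 0" if "q \<in> ?R" for q using u_nn[OF nnU[OF that]] by (simp add: y_def)
  have yV: "y q \<ge> 0" if "q \<in> ?S" for q using u_nn[OF nnV[OF that]] by (simp add: y_def)
  have "w n g = 1" for n using gpos[of n] by (simp add: w_def)
  then have ug: "u g = 1" using tendsto_unique[OF G(1) lim[of g], of 1] by simp
  have uh: "u h = 0"
  proof (rule antisym)
    have wh: "w n h \<le> t / n" if "n \<ge> 1" for n
    proof -
      have "n * real_val (v n) h \<le> t * real_val (v n) g" using Ag[of n] Apos[of n] by linarith
      then show ?thesis using gpos[of n] that by (simp add: w_def field_simps)
    qed
    have "((\<lambda>n. t / real n) \<longlongrightarrow> 0) G" using lim_const_over_n G(2) by (rule filterlim_mono[OF _ order_refl])
    then show "u h \<le> 0"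
    proof (rule tendsto_le[OF G(1) _ lim])
      have "eventually (\<lambda>n. w n h \<le> t / n) sequentially"
        using eventually_ge_at_top[of 1] by eventually_elim (rule wh)
      then show "eventually (\<lambda>n. w n h \<le> t / n) G" using G(2) by (rule filter_leD[rotated])
    qed
    show "0 \<le> u h" by (rule u_nn[OF nnU[OF h]])
  qed
  \<comment> \<open>The limit is nonnegative on both rings, so one center lies in \<open>U\<close>,
    which carries \<open>h\<close> and \<open>s\<close>, and in \<open>V\<close>, which carries the
    estimates.\<close>
  let ?x = "center X y"
  have cU: "?x \<in> U" "is_center X y ?x" using center_in_affine[OF U y yU] by auto
  have cV: "?x \<in> V" using center_in_affine[OF aV y yV] by auto
  have "y h = 0" using h(2) uh by (simp add: y_def zero_ereal_def)
  then have "h \<notin> max_ideal X ?x" using is_center_Sect(2)[OF affine_nopen[OF U] cU(2,1) h(1)] by simp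
  then have "y \<in> Val X {x\<in>U. h \<notin> max_ideal X x}" using y cU unfolding Val_def by blast
  \<comment> \<open>The normalisation keeps the value of \<open>g\<close> equal to 1 in the
    limit.\<close>
  moreover have "y \<noteq> trivial_valuation"
  proof
    assume "y = trivial_valuation"
    then have "y g = 0" using g(2) by (simp add: trivial_valuation_def)
    then show False using g(2) ug by (simp add: y_def zero_ereal_def)
  qed
  ultimately have "mult_cond y s" using s(1) by (auto simp: J_eq Val_star_def)
  then have "eventually (\<lambda>m. m \<ge> 1 \<and> y s + log_discrepancy X p y - ereal (t / real m) * val_ideal X y (\<aa> m) > 0) sequentially"
    unfolding mult_cond_def using eventually_ge_at_top[of "1::nat"] by eventually_elim simp
  then obtain m where m: "m \<ge> 1" "y s + log_discrepancy X p y - ereal (t / real m) * val_ideal X y (\<aa> m) > 0"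
    using eventually_happens'[OF sequentially_bot] by blast
  have yValV: "y \<in> Val X V" using y cV cU(2) unfolding Val_def by blast
  have ruy: "real_val y q = u q" if "q \<noteq> 0" for q using that by (simp add: real_val_def y_def)
  have "ereal (t / m * \<beta> y m - u s) < log_discrepancy X p y"
  proof -
    have "y s = ereal (u s)" using s(3) by (simp add: y_def)
    then have "0 < ereal (u s) + log_discrepancy X p y - ereal (t / m * \<beta> y m)"
      using m(2) by (simp add: val_ideal_real(1)[OF yValV m(1)])
    then show ?thesis by (cases "log_discrepancy X p y") (auto simp: zero_ereal_def algebra_simps)
  qed
  then obtain e \<theta> f where E: "e \<ge> 1" "\<theta> \<in> cartier_maps X p e ?x" "f \<noteq> 0"
    "ereal (t / m * \<beta> y m - u s) < E p e f \<theta> y"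
    by (rule less_log_discrepancy)
  have \<theta>f: "\<theta> f \<noteq> 0"
  proof
    assume "\<theta> f = 0"
    then have "E p e f \<theta> y = - \<infinity>"
      using E(3) p_power_gt_1[OF E(1)] char(2) by (simp add: E_def y_def)
    then show False using E(4) by simp
  qed
  define N where "N = real p ^ e"
  have N: "N > 1" unfolding N_def by (rule p_power_gt_1[OF E(1)])
  define K where "K = (u f - N * u (\<theta> f)) / (N - 1)"
  have K: "t / m * \<beta> y m - u s < K"
    using E(4) E_real[of y e f \<theta>] y E(1,3) \<theta>f by (simp add: K_def N_def ruy)
  have "\<beta> y m < (K + u s) * m / t" using K tpos m(1) by (simp add: field_simps)
  then have "val_ideal X y (\<aa> m) < ereal ((K + u s) * m / t)" by (simp add: val_ideal_real(1)[OF yValV m(1)])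
  \<comment> \<open>A strict inequality leaves room for a section \<open>q\<close> over
    \<open>V\<close>. The same \<open>q\<close> bounds \<open>\<beta> (v n) m\<close> for all
    \<open>n\<close>, which is the upper semicontinuity needed.\<close>
  then obtain q where q: "q \<in> \<aa> m V" "q \<noteq> 0" "real_val y q < (K + u s) * m / t"
    by (rule val_ideal_less[OF yValV aV m(1)])
  have uq: "t / m * u q < K + u s" using q(3) tpos m(1) by (simp add: ruy[OF q(2)] field_simps)
  obtain B :: "(nat \<Rightarrow>\<^sub>0 nat) set" and \<phi> b where "frobenius_projective p ?S B \<phi> b"
    using smooth_affine_projective[OF V] by metis
  then interpret fp: frobenius_projective p ?S B \<phi> b .
  have \<theta>: "p_linear p e \<theta>" "\<theta> ` ?S \<subseteq> localization ?S (prime_at V ?x)"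
  proof -
    show "p_linear p e \<theta>" using E(2) by (simp add: cartier_maps_def)
    have "?S \<subseteq> local_ring X ?x" using local_ringI[OF affine_nopen[OF aV] cV] by blast
    then show "\<theta> ` ?S \<subseteq> localization ?S (prime_at V ?x)"
      using E(2) affine_local_ring[OF aV cV] by (auto simp: cartier_maps_def)
  qed
  \<comment> \<open>\<open>\<theta>\<close> preserves the local ring at the center of the limit
    only; \<open>c * \<theta>\<close> preserves \<open>?S\<close> and hence the local rings at the
    centers of all \<open>v n\<close>.\<close>
  obtain c where c: "c \<in> ?S" "c \<notin> prime_at V ?x" "(\<lambda>z. c * \<theta> z) ` ?S \<subseteq> ?S"
    by (rule fp.clear_denominators[OF \<theta> prime_at_Spec[OF aV cV]])
  have c0: "c \<noteq> 0" using c(2) idealD(2)[OF SpecD(1)[OF prime_at_Spec[OF aV cV]]] by auto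
  have "y c = 0"
    using is_center_Sect[OF affine_nopen[OF aV] cU(2) cV c(1)] c(1,2) by (auto simp: prime_at_def less_le)
  then have uc: "u c = 0" using c0 by (simp add: y_def zero_ereal_def)
  \<comment> \<open>Compensates for the factor \<open>c\<close>: the image of \<open>f'\<close>
    under the new map is again \<open>\<theta> f\<close>, and the limit gives \<open>f'\<close> and
    \<open>f\<close> the same value since \<open>c\<close> has value zero.\<close>
  define f' where "f' = (1 / c) ^ (p ^ e) * f"
  have f'0: "f' \<noteq> 0" using c0 E(3) by (simp add: f'_def)
  have \<theta>f': "c * \<theta> f' = \<theta> f" unfolding f'_def p_linearD(2)[OF \<theta>(1)] using c0 by simp
  have uf': "u f' = u f"
  proof -
    have "f = c ^ (p ^ e) * f'" using c0 by (simp add: f'_def power_one_over)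
    then have "u f = u (c ^ (p ^ e)) + u f'" using u_mult[of "c ^ (p ^ e)" f'] c0 f'0 by simp
    moreover have "u 1 = 0" using real_valuationD(5)[OF y] by (simp add: y_def zero_ereal_def)
    then have "u (c ^ k) = 0" for k using uc c0 by (induction k) (simp_all add: u_mult)
    ultimately show ?thesis by simp
  qed
  have bound: "n * real_val (v n) h + real_val (v n) s + (real_val (v n) f' - N * real_val (v n) (\<theta> f)) / (N - 1) \<le> t / m * real_val (v n) q" for n
  proof -
    have "(\<lambda>z. c * \<theta> z) \<in> cartier_maps X p e (center X (v n))"
      by (rule cartier_of_Sect[OF aV p_linear_scale[OF \<theta>(1)] c(3) ValD(3)[OF vV]])
    then have "E p e f' (\<lambda>z. c * \<theta> z) (v n) \<le> ereal (A n)"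
      using log_discrepancy_ge[of e "\<lambda>z. c * \<theta> z" "v n" f'] E(1) f'0 \<theta>f \<theta>f' A[of n] by simp
    then have "(real_val (v n) f' - N * real_val (v n) (\<theta> f)) / (N - 1) \<le> A n"
      using E_real[of "v n" e f' "\<lambda>z. c * \<theta> z"] val E(1) f'0 \<theta>f \<theta>f' by (simp add: N_def)
    then show ?thesis using le'[OF m(1) q(1,2), of n] by linarith
  qed
  \<comment> \<open>The nonnegative term with \<open>h\<close> is dropped and everything is divided
    by the value of \<open>g\<close>. Only finitely many coordinates of \<open>w n\<close> remain,
    so the inequality passes to the limit.\<close>
  have "w n s + (w n f' - N * w n (\<theta> f)) / (N - 1) \<le> t / m * w n q" for n
  proof -
    let ?g = "real_val (v n) g"
    have "real_val (v n) s + (real_val (v n) f' - N * real_val (v n) (\<theta> f)) / (N - 1) \<le> t / m * real_val (v n) q"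
      using bound[of n] nh[of n] by linarith
    then have "(real_val (v n) s + (real_val (v n) f' - N * real_val (v n) (\<theta> f)) / (N - 1)) / ?g \<le> (t / m * real_val (v n) q) / ?g"
      using gpos[of n] by (intro divide_right_mono) auto
    moreover have "(real_val (v n) s + (real_val (v n) f' - N * real_val (v n) (\<theta> f)) / (N - 1)) / ?g
        = w n s + (w n f' - N * w n (\<theta> f)) / (N - 1)"
      by (simp add: w_def add_divide_distrib diff_divide_distrib mult.commute[of "N - 1"])
    ultimately show ?thesis by (simp add: w_def)
  qed
  moreover have "((\<lambda>n. w n s + (w n f' - N * w n (\<theta> f)) / (N - 1)) \<longlongrightarrow> u s + (u f' - N * u (\<theta> f)) / (N - 1)) G"
    by (intro tendsto_intros lim) (use N in simp)
  moreover have "((\<lambda>n. t / m * w n q) \<longlongrightarrow> t / m * u q) G" by (intro tendsto_intros lim)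
  ultimately have "u s + (u f' - N * u (\<theta> f)) / (N - 1) \<le> t / m * u q"
    using tendsto_le[OF G(1)] by (metis (no_types, lifting) always_eventually)
  then show False using uq by (simp add: uf' K_def)
qed

text \<open>For a single valuation some power of \<open>h\<close> may be enough; the content is that
  one power serves all valuations centered in \<open>U\<close>.\<close>

lemma J_extend:
  assumes U: "affine_open X U" and h: "h \<in> Sect X U" "h \<noteq> 0"
    and s: "s \<in> J {x\<in>U. h \<notin> max_ideal X x}" "s \<in> Sect X U"
  shows "\<exists>n. h ^ n * s \<in> J U"
proof (rule ccontr)
  assume neg: "\<not> ?thesis"
  have R: "is_subring (Sect X U)" by (rule affine_subring[OF U])
  have s0: "s \<noteq> 0" using neg idealD(2)[OF J_ideal[OF affine_nopen[OF U]]] by auto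
  have "\<exists>v. v \<in> Val_star X U \<and> \<not> mult_cond v (h ^ n * s)" for n
  proof -
    have "h ^ n * s \<in> Sect X U" by (intro subringD(4)[OF R] subring_power[OF R] h s)
    then show ?thesis using neg unfolding J_eq by blast
  qed
  then obtain v where v: "\<And>n. v n \<in> Val_star X U" "\<And>n. \<not> mult_cond (v n) (h ^ n * s)" by metis
  have vU: "v n \<in> Val X U" "v n \<noteq> trivial_valuation" for n using v(1)[of n] by (auto simp: Val_star_def)
  obtain \<V> where \<V>: "finite \<V>" "\<And>V. V \<in> \<V> \<Longrightarrow> smooth_affine V" "points X \<subseteq> \<Union>\<V>"
    using finite_smooth_affine_cover by metis
  \<comment> \<open>Pigeonhole: each center lies in one of finitely many standard smooth
    sets.\<close>
  have "\<exists>V\<in>\<V>. infinite {n. center X (v n) \<in> V}"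
  proof (rule ccontr)
    assume "\<not> ?thesis"
    then have "finite (\<Union>V\<in>\<V>. {n. center X (v n) \<in> V})" using \<V>(1) by blast
    moreover have "n \<in> (\<Union>V\<in>\<V>. {n. center X (v n) \<in> V})" for n
    proof -
      have "center X (v n) \<in> points X" using ValD(2)[OF vU(1)[of n]] by (simp add: is_center_def)
      then show ?thesis using \<V>(3) by auto
    qed
    then have "(\<Union>V\<in>\<V>. {n. center X (v n) \<in> V}) = UNIV" by blast
    ultimately show False by simp
  qed
  then obtain V where V: "V \<in> \<V>" "infinite {n. center X (v n) \<in> V}" by blast
  obtain r :: "nat \<Rightarrow> nat" where r: "strict_mono r" "\<And>n. r n \<in> {n. center X (v n) \<in> V}"
    using infinite_enumerate[OF V(2)] by blast
  have vV: "v (r n) \<in> Val X V" for n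
    using ValD(1,2)[OF vU(1), of "r n"] r(2)[of n] unfolding Val_def by blast
  \<comment> \<open>Since \<open>n \<le> r n\<close> and \<open>h\<close> has nonnegative value, the
    coefficient \<open>r n\<close> can be lowered to \<open>n\<close> along the subsequence.\<close>
  have "\<exists>A. log_discrepancy X p (v (r n)) = ereal A \<and>
      (\<forall>m\<ge>1. n * real_val (v (r n)) h + real_val (v (r n)) s + A \<le> t / m * \<beta> (v (r n)) m)" for n
  proof -
    have hs: "h ^ r n * s \<noteq> 0" using h(2) s0 by simp
    note val = ValD(1)[OF vU(1), of "r n"]
    obtain A where A: "log_discrepancy X p (v (r n)) = ereal A" and A2:
      "\<And>m. m \<ge> 1 \<Longrightarrow> real_val (v (r n)) (h ^ r n * s) + A \<le> t / m * \<beta> (v (r n)) m"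
      by (rule not_mult_cond_bound[OF vU(1) hs v(2)]) (rule that; simp)
    have "real_val (v (r n)) (h ^ r n * s) = r n * real_val (v (r n)) h + real_val (v (r n)) s"
      using real_val_mult[OF val, of "h ^ r n" s] real_val_power[OF val h(2)] h(2) s0 by simp
    moreover have "real_val (v (r n)) h \<ge> 0"
      using is_center_Sect(1)[OF affine_nopen[OF U] ValD(2,3)[OF vU(1)] h(1), of "r n"] real_val[OF val h(2)] by simp
    then have "n * real_val (v (r n)) h \<le> r n * real_val (v (r n)) h"
      using seq_suble[OF r(1), of n] by (intro mult_right_mono) auto
    ultimately have "n * real_val (v (r n)) h + real_val (v (r n)) s + A \<le> t / m * \<beta> (v (r n)) m" if "m \<ge> 1" for m
      using A2[OF that] by linarith
    then show ?thesis using A by blast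
  qed
  then obtain A where A: "\<And>n. log_discrepancy X p (v (r n)) = ereal (A n)"
    "\<And>n m. m \<ge> 1 \<Longrightarrow> n * real_val (v (r n)) h + real_val (v (r n)) s + A n \<le> t / m * \<beta> (v (r n)) m"
    by metis
  show False
    by (rule limit_contradiction[OF U \<V>(2)[OF V(1)] h s s0, of "\<lambda>n. v (r n)" A])
      (use vU vV A in auto)
qed

theorem J_coherent: "coherent_ideal X J"
  unfolding coherent_ideal_def quasicoherent_ideal_def ideal_sheaf_def
proof (intro conjI allI impI J_subsheaf J_ideal)
  fix U h assume "affine_open X U \<and> h \<in> Sect X U \<and> h \<noteq> 0"
  then have U: "affine_open X U" and h: "h \<in> Sect X U" "h \<noteq> 0" by auto
  let ?D = "{x\<in>U. h \<notin> max_ideal X x}"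
  have D: "nopen X ?D" by (rule affine_basic_nopen[OF U h])
  have hD: "h \<in> Sect X ?D" using Sect_mono[OF affine_nopen[OF U] D] h(1) by auto
  have iD: "inverse h \<in> Sect X ?D" by (rule inverse_in_Sect_basic[OF U h])
  have JD: "is_ideal (Sect X ?D) (J ?D)" by (rule J_ideal[OF D])
  have "J U \<subseteq> J ?D" using J_subsheaf affine_nopen[OF U] D unfolding subsheaf_of_const_def by auto
  then have "s / h ^ n \<in> J ?D" if "s \<in> J U" for s n
    using idealD(5)[OF JD subring_power[OF Sect_subring[OF D] iD], of s n] that
    by (auto simp: divide_inverse power_inverse)
  moreover have "\<exists>s n. f = s / h ^ n \<and> s \<in> J U" if f: "f \<in> J ?D" for f
  proof -
    have "f \<in> Sect X ?D" using f by (simp add: J_eq)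
    \<comment> \<open>Denominators are cleared twice: first to obtain a section over
      \<open>U\<close>, then to bring it into the multiplier ideal.\<close>
    then obtain k where k: "h ^ k * f \<in> Sect X U" by (rule Sect_basic[OF U h])
    have "h ^ k * f \<in> J ?D" by (rule idealD(4)[OF JD subring_power[OF Sect_subring[OF D] hD] f])
    then obtain n where "h ^ n * (h ^ k * f) \<in> J U" using J_extend[OF U h _ k] by blast
    moreover have "f = h ^ n * (h ^ k * f) / h ^ (n + k)" using h(2) by (simp add: power_add)
    ultimately show ?thesis by blast
  qed
  ultimately show "J ?D = {s / h ^ n | s n. s \<in> J U}" by blast
next
  fix U assume U: "affine_open X U"
  show "fg_ideal (Sect X U) (J U)"
  proof (rule affine_ideal_finite[OF U J_ideal[OF affine_nopen[OF U]]])
    fix x assume "x \<in> U"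
    then have "x \<in> points X" using nopen_points[OF affine_nopen[OF U]] by blast
    then obtain V where "smooth_affine V" "x \<in> V" using smooth_affine_cover by blast
    then show "\<exists>V. affine_open X V \<and> x \<in> V \<and> noetherian (Sect X V)"
      using smooth_affine_noetherian unfolding smooth_affine_def by blast
  qed
qed

end

theorem theoremB:
  fixes \<iota> :: "'k::alg_closed_field \<Rightarrow> 'l::field"
    and X :: "('x, 'l) ringed"
    and \<aa> :: "nat \<Rightarrow> 'x set \<Rightarrow> 'l set"
    and p :: nat and t :: real
  assumes "CHAR('k) = p" and "p > 0"
    and "smooth_variety \<iota> X"
    and "graded_sequence X \<aa>"
    and "t \<ge> 0"
  shows "coherent_ideal X (asymptotic_multiplier X p \<aa> t)"
proof -
  interpret graded_ideals \<iota> X p \<aa> t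
    by standard (use assms in auto)
  show ?thesis by (rule J_coherent)
qed

end
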